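(* Let $n$ and $r$ be integers with $3 \leq r < n$, let $t=\lfloor (n-1)/2 \rfloor$, and let $H$ be an $n$-vertex $r$-uniform hypergraph. If either (a) $r\leq t$ and $\delta(H) \geq \binom{t}{r-1} +1$, or (b) $r\geq n/2$ and $\delta(H) \geq r$, then $H$ contains a hamiltonian Berge cycle, i.e. a Berge cycle of length $n$.
   Context: A hypergraph is a family of (distinct) subsets, called edges, of a vertex set; it is $r$-uniform if every edge has exactly $r$ vertices. The degree of a vertex is the number of edges containing it, and $\delta(H)$ is the minimum degree. A Berge cycle of length $\ell$ is a list $v_1, e_1, v_2, \ldots, v_\ell, e_\ell, v_1$ of $\ell$ distinct vertices and $\ell$ distinct edges with $\{v_i, v_{i+1}\} \subseteq e_i$ for all $i$ (indices modulo $\ell$). *)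

theory Defs
  imports Complex_Main
begin

definition hypergraph :: "'a set \<Rightarrow> 'a set set \<Rightarrow> bool" where
  "hypergraph V E \<longleftrightarrow> (\<forall>e\<in>E. e \<subseteq> V)"

definition uniform_hypergraph :: "nat \<Rightarrow> 'a set \<Rightarrow> 'a set set \<Rightarrow> bool" where
  "uniform_hypergraph r V E \<longleftrightarrow> hypergraph V E \<and> (\<forall>e\<in>E. finite e \<and> card e = r)"

definition hdegree :: "'a set set \<Rightarrow> 'a \<Rightarrow> nat" where
  "hdegree E v = card {e \<in> E. v \<in> e}"

(* Meaningful only for a finite nonempty vertex set. *)
definition min_hdegree :: "'a set \<Rightarrow> 'a set set \<Rightarrow> nat" where
  "min_hdegree V E = Min (hdegree E ` V)"

(* The cycle v_1, e_1, ..., v_l, e_l, v_1 is given by the list vs of its vertices and the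
   list es of its edges, both indexed from 0. *)
definition berge_cycle :: "'a set \<Rightarrow> 'a set set \<Rightarrow> nat \<Rightarrow> 'a list \<Rightarrow> 'a set list \<Rightarrow> bool" where
  "berge_cycle V E l vs es \<longleftrightarrow>
     length vs = l \<and> length es = l \<and>
     distinct vs \<and> distinct es \<and>
     set vs \<subseteq> V \<and> set es \<subseteq> E \<and>
     (\<forall>i<l. {vs ! i, vs ! ((i + 1) mod l)} \<subseteq> es ! i)"

definition hamiltonian_berge_cycle :: "'a set \<Rightarrow> 'a set set \<Rightarrow> 'a list \<Rightarrow> 'a set list \<Rightarrow> bool" where
  "hamiltonian_berge_cycle V E vs es \<longleftrightarrow> berge_cycle V E (card V) vs es"

end

theory Submission
  imports Defs
begin

text \<open>Adding edges preserves the hypotheses, so the hypergraph may be assumed saturated: it has no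
hamiltonian cycle, but a hamiltonian Berge path $v_1, e_1, \ldots, e_{n-1}, v_n$. Call the edges
outside the path free. If $v_1$ lies together with $v_{i+1}$ in a free edge, or lies in $e_i$, then
the path can be rotated at $i$. As in Dirac's theorem, if one of the two ends can be rotated at an
index by means of a free edge, then the other end cannot be rotated there. For $r \ge n/2$ this and
counting suffice.

For $r \le t$ one first excludes cycles of length $n - 1$: a vertex $w$ outside such a cycle can
neither be inserted nor exchanged for a vertex of the cycle, and its degree then leaves only a few
tight configurations, which die by inspecting further exchanges. Hence $v_1$ and $v_n$ cannot be
rotated at $i$ and $i - 1$ respectively. An end with fewer than $t$ free neighbours lies in at least
$t$ path edges, so double counting over all rotations yields an end with $t$ free neighbours, and for
even $n$ a path both of whose ends have $t$ free neighbours; these must fill the first and the last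
$t$ indices. The $t + 1$ vertices of one half provide only $\binom{t}{r-1}$ edges at its end, so each
end also lies in a path edge of its own half that reaches into the other half; rotating at both ends
frees these two edges, and they close a hamiltonian cycle.\<close>

declare One_nat_def [simp del]

section \<open>Natural numbers and binomial coefficients\<close>

lemma binomial_le_binomial:
  assumes "j \<le> k" "j + k \<le> m"
  shows "m choose j \<le> m choose k"
proof (cases "2 * k \<le> m")
  case False
  have "m choose j \<le> m choose (m - k)" by (rule binomial_mono) (use assms False in auto)
  then show ?thesis using assms by (simp add: binomial_symmetric[of k m])
qed (use assms in \<open>simp add: binomial_mono\<close>)

lemma le_binomial: "1 \<le> k \<Longrightarrow> k < m \<Longrightarrow> m \<le> m choose k"
  using binomial_le_binomial[of 1 k m] by (simp add: choose_one)

lemma two_mult_le_binomial: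
  assumes "2 \<le> k" "k + 2 \<le> m"
  shows "2 * m \<le> (m choose k) + 2"
proof -
  obtain d where m: "m = d + 4" using assms by (intro that[of "m - 4"]) simp
  have "4 * m \<le> m * (m - 1) + 4" unfolding m by (simp add: algebra_simps)
  then have "2 * m \<le> m * (m - 1) div 2 + 2" by presburger
  then show ?thesis
    using binomial_le_binomial[of 2 k m] assms unfolding choose_two by linarith
qed

lemma binomial_add_mult_le:
  assumes "m \<le> t"
  shows "(m choose Suc k) + (t - m) * (m choose k) \<le> t choose Suc k"
  using assms
proof (induction t rule: dec_induct)
  case (step j)
  have "m choose k \<le> j choose k" using step by (intro binomial_right_mono) simp
  then show ?case using step by (simp add: Suc_diff_le)
qed simp

lemma down_closed_interval:
  fixes S :: "nat set"
  assumes "finite S" "\<And>i. i \<in> S \<Longrightarrow> lo \<le> i" "\<And>i. i \<in> S \<Longrightarrow> lo < i \<Longrightarrow> i - 1 \<in> S"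
  shows "S = {lo..<lo + card S}"
proof (cases "S = {}")
  case False
  define M where "M = Max S"
  have M: "M \<in> S" "\<And>i. i \<in> S \<Longrightarrow> i \<le> M" using False assms(1) by (auto simp: M_def)
  have "{lo..M} \<subseteq> S"
  proof
    fix i assume "i \<in> {lo..M}"
    then have "i \<le> M" "lo \<le> i" by auto
    then show "i \<in> S"
    proof (induction i rule: inc_induct)
      case (step i)
      then show ?case using assms(3)[of "Suc i"] by simp
    qed (rule M(1))
  qed
  moreover have "S \<subseteq> {lo..M}" using M(2) assms(2) by (simp add: subset_iff)
  ultimately have "S = {lo..M}" by (rule subset_antisym[rotated])
  moreover have "lo \<le> M" by (rule assms(2)[OF M(1)])
  ultimately show ?thesis by (simp add: atLeastLessThanSuc_atLeastAtMost)
qed simp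

lemma no_descent_split:
  fixes A B :: "nat set"
  assumes un: "A \<union> B = {lo..<hi}" and disj: "A \<inter> B = {}"
    and desc: "\<And>i. i \<in> A \<Longrightarrow> lo < i \<Longrightarrow> i - 1 \<notin> B"
  shows "A = {lo..<lo + card A}" "B = {lo + card A..<hi}"
proof -
  have A: "A \<subseteq> {lo..<hi}" using un by blast
  show split: "A = {lo..<lo + card A}"
  proof (rule down_closed_interval)
    show "finite A" using A finite_subset by blast
    show "lo \<le> i" if "i \<in> A" for i using A that by auto
    show "i - 1 \<in> A" if "i \<in> A" "lo < i" for i
    proof -
      have "i - 1 \<in> {lo..<hi}" using A that by auto
      then show ?thesis using desc[OF that] un by blast
    qed
  qed
  have "B = {lo..<hi} - A" using un disj by blast
  also have "\<dots> = {lo + card A..<hi}" by (subst split) auto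
  finally show "B = {lo + card A..<hi}" .
qed

lemma card_le_1I: "finite A \<Longrightarrow> (\<And>x y. x \<in> A \<Longrightarrow> y \<in> A \<Longrightarrow> x = y) \<Longrightarrow> card A \<le> 1"
  unfolding One_nat_def by (subst card_le_Suc0_iff_eq) auto

lemma bij_betw_comp_involution:
  assumes "bij_betw v A W" "\<And>j. j \<in> A \<Longrightarrow> p j \<in> A" "\<And>j. j \<in> A \<Longrightarrow> p (p j) = j"
  shows "bij_betw (\<lambda>j. v (p j)) A W"
proof -
  have "bij_betw p A A" by (rule bij_betw_byWitness[where f' = p]) (use assms in auto)
  then show ?thesis using bij_betw_trans[OF _ assms(1)] by (simp add: comp_def)
qed

section \<open>Positions modulo \<open>m\<close>\<close>

lemma bij_betw_mod_shift:
  fixes m :: nat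
  assumes "0 < m"
  shows "bij_betw (\<lambda>j. (i + j) mod m) {a..<a + m} {..<m}"
proof -
  have inj: "inj_on (\<lambda>j. (i + j) mod m) {a..<a + m}"
  proof (rule linorder_inj_onI')
    fix x y assume xy: "x \<in> {a..<a + m}" "y \<in> {a..<a + m}" "x < y"
    show "(i + x) mod m \<noteq> (i + y) mod m"
    proof
      assume "(i + x) mod m = (i + y) mod m"
      then have "m dvd i + y - (i + x)" using xy mod_eq_dvd_iff_nat[of "i + x" "i + y" m] by simp
      then show False using xy by (auto dest: dvd_imp_le)
    qed
  qed
  have "(\<lambda>j. (i + j) mod m) ` {a..<a + m} = {..<m}"
    by (rule card_subset_eq) (use assms card_image[OF inj] in auto)
  then show ?thesis using inj by (simp add: bij_betw_def)
qed

definition cyc_succ :: "nat \<Rightarrow> nat \<Rightarrow> nat" where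
  "cyc_succ m i = Suc i mod m"

definition cyc_preds :: "nat \<Rightarrow> nat set \<Rightarrow> nat set" where
  "cyc_preds m A = {i \<in> {..<m}. cyc_succ m i \<in> A}"

definition pred_closure :: "nat \<Rightarrow> nat set \<Rightarrow> nat set" where
  "pred_closure m A = A \<union> cyc_preds m A"

lemma cyc_succ_less: "0 < m \<Longrightarrow> cyc_succ m i < m"
  by (simp add: cyc_succ_def)

lemma cyc_succ_eq: "i < m \<Longrightarrow> cyc_succ m i = (if Suc i = m then 0 else Suc i)"
  by (auto simp: cyc_succ_def)

lemma cyc_succ_mod: "cyc_succ m (i mod m) = Suc i mod m"
  by (simp add: cyc_succ_def mod_Suc_eq)

lemma bij_betw_cyc_succ: "bij_betw (cyc_succ m) {..<m} {..<m}"
proof (cases "m = 0")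
  case False
  then show ?thesis
    using bij_betw_mod_shift[of m 1 0]
    by (simp add: cyc_succ_def[abs_def] lessThan_atLeast0 One_nat_def)
qed (simp add: bij_betw_def)

lemma cyc_succ_inject: "i < m \<Longrightarrow> j < m \<Longrightarrow> cyc_succ m i = cyc_succ m j \<longleftrightarrow> i = j"
  using bij_betw_cyc_succ[of m] by (auto simp: bij_betw_def inj_on_eq_iff)

lemma ex_cyc_pred:
  assumes "j < m"
  obtains i where "i < m" "cyc_succ m i = j"
proof -
  have "j \<in> cyc_succ m ` {..<m}" using assms bij_betw_cyc_succ[of m] by (simp add: bij_betw_def)
  then show thesis using that by blast
qed

lemma cyc_succ_neq: "i < m \<Longrightarrow> 2 \<le> m \<Longrightarrow> cyc_succ m i \<noteq> i"
  and cyc_succ_succ_neq: "i < m \<Longrightarrow> 3 \<le> m \<Longrightarrow> cyc_succ m (cyc_succ m i) \<noteq> i"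
  by (auto simp: cyc_succ_eq split: if_splits)

lemma cyc_succ_image_subset: "A \<subseteq> {..<m} \<Longrightarrow> cyc_succ m ` A \<subseteq> {..<m}"
  using bij_betw_cyc_succ[of m] by (auto simp: bij_betw_def)

lemma card_cyc_succ_image: "A \<subseteq> {..<m} \<Longrightarrow> card (cyc_succ m ` A) = card A"
  using bij_betw_cyc_succ[of m] by (meson bij_betw_def card_image inj_on_subset)

lemma cyc_preds_subset: "cyc_preds m A \<subseteq> {..<m}"
  by (auto simp: cyc_preds_def)

lemma finite_cyc_preds [simp]: "finite (cyc_preds m A)"
  by (simp add: cyc_preds_def)

lemma card_cyc_preds:
  assumes "A \<subseteq> {..<m}"
  shows "card (cyc_preds m A) = card A"
proof -
  have "cyc_succ m ` cyc_preds m A = A"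
  proof
    show "A \<subseteq> cyc_succ m ` cyc_preds m A"
    proof
      fix j assume j: "j \<in> A"
      then obtain i where "i < m" "cyc_succ m i = j" using assms ex_cyc_pred by blast
      then show "j \<in> cyc_succ m ` cyc_preds m A" using j by (auto simp: cyc_preds_def)
    qed
  qed (auto simp: cyc_preds_def)
  then show ?thesis using card_cyc_succ_image[OF cyc_preds_subset] by metis
qed

lemma cyc_preds_closed:
  assumes A: "A \<subseteq> {..<m}" "A \<noteq> {}" and closed: "cyc_preds m A \<subseteq> A"
  shows "A = {..<m}"
proof -
  obtain a where a: "a \<in> A" "a < m" using A by blast
  have step_back: "(j + k) mod m \<in> A \<Longrightarrow> j \<in> A" if "j < m" for j k
  proof (induction k)
    case (Suc k)
    then have "(j + k) mod m \<in> cyc_preds m A"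
      using that by (simp add: cyc_preds_def cyc_succ_mod)
    then show ?case using closed Suc.IH by blast
  qed (use that in simp)
  have "j \<in> A" if "j < m" for j
  proof -
    have "(j + (a + (m - j))) mod m = a" using that a(2) by (simp add: add.left_commute)
    then show ?thesis using step_back[OF that, of "a + (m - j)"] a(1) by metis
  qed
  then show ?thesis using A(1) by blast
qed

lemma cyc_succ_image_fixed:
  assumes "A \<subseteq> {..<m}" "A \<noteq> {}" "cyc_succ m ` A = A"
  shows "A = {..<m}"
proof (rule cyc_preds_closed[OF assms(1,2)])
  show "cyc_preds m A \<subseteq> A"
  proof
    fix i assume "i \<in> cyc_preds m A"
    then have i: "i < m" "cyc_succ m i \<in> cyc_succ m ` A" using assms(3) by (auto simp: cyc_preds_def)
    then obtain j where "j \<in> A" "cyc_succ m i = cyc_succ m j" by blast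
    then show "i \<in> A" using cyc_succ_inject[of i m j] assms(1) i(1) by auto
  qed
qed

lemma card_cyc_succ_image_Un_gt:
  assumes "A \<subseteq> {..<m}" "A \<noteq> {}" "A \<noteq> {..<m}"
  shows "card A < card (A \<union> cyc_succ m ` A)"
proof (rule psubset_card_mono)
  have fin: "finite A" by (rule finite_subset[OF assms(1)]) simp
  then show "finite (A \<union> cyc_succ m ` A)" by simp
  have "cyc_succ m ` A \<noteq> A" using cyc_succ_image_fixed[OF assms(1,2)] assms(3) by blast
  then have "\<not> cyc_succ m ` A \<subseteq> A"
    using card_subset_eq[OF fin] card_cyc_succ_image[OF assms(1)] by blast
  then show "A \<subset> A \<union> cyc_succ m ` A" by blast
qed

lemma card_cyc_succ_image_Int_less:
  assumes "A \<subseteq> {..<m}" "A \<noteq> {}" "A \<noteq> {..<m}"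
  shows "card (A \<inter> cyc_succ m ` A) < card A"
proof -
  have "finite A" by (rule finite_subset[OF assms(1)]) simp
  then have "card A + card (cyc_succ m ` A) = card (A \<union> cyc_succ m ` A) + card (A \<inter> cyc_succ m ` A)"
    by (intro card_Un_Int) simp_all
  then show ?thesis
    using card_cyc_succ_image_Un_gt[OF assms] card_cyc_succ_image[OF assms(1)] by linarith
qed

lemma pred_closure_subset: "A \<subseteq> {..<m} \<Longrightarrow> pred_closure m A \<subseteq> {..<m}"
  using cyc_preds_subset by (auto simp: pred_closure_def)

lemma finite_pred_closure: "A \<subseteq> {..<m} \<Longrightarrow> finite (pred_closure m A)"
  by (meson finite_lessThan finite_subset pred_closure_subset)

lemma pred_closure_mono: "A \<subseteq> B \<Longrightarrow> pred_closure m A \<subseteq> pred_closure m B"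
  by (auto simp: pred_closure_def cyc_preds_def)

lemma pred_closure_Int_empty:
  assumes "A \<subseteq> {..<m}" "B \<subseteq> {..<m}" "A \<inter> B = {}"
    "\<And>a. a \<in> A \<Longrightarrow> cyc_succ m a \<notin> B" "\<And>b. b \<in> B \<Longrightarrow> cyc_succ m b \<notin> A"
  shows "pred_closure m A \<inter> pred_closure m B = {}"
proof -
  have "i = j" if "cyc_succ m i = cyc_succ m j" "i \<in> cyc_preds m A" "j \<in> cyc_preds m B" for i j
    using that cyc_succ_inject by (auto simp: cyc_preds_def)
  then show ?thesis using assms(3-5) by (auto simp: pred_closure_def cyc_preds_def)
qed

lemma card_pred_closure_gt:
  assumes "A \<subseteq> {..<m}" "A \<noteq> {}" "A \<noteq> {..<m}"
  shows "card A < card (pred_closure m A)"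
proof (rule psubset_card_mono[OF finite_pred_closure[OF assms(1)]])
  show "A \<subset> pred_closure m A"
    using cyc_preds_closed[OF assms(1,2)] assms(3) by (auto simp: pred_closure_def)
qed

lemma card_pred_closure_independent:
  assumes "A \<subseteq> {..<m}" "\<And>a. a \<in> A \<Longrightarrow> cyc_succ m a \<notin> A"
  shows "card (pred_closure m A) = 2 * card A"
proof -
  have "A \<inter> cyc_preds m A = {}" using assms(2) by (auto simp: cyc_preds_def)
  then show ?thesis
    using card_cyc_preds[OF assms(1)] finite_subset[OF assms(1)]
    by (simp add: pred_closure_def card_Un_disjoint)
qed

lemma card_pred_closure_pair:
  assumes "i < m" "3 \<le> m"
  shows "card (pred_closure m {i, cyc_succ m i}) = 3"
proof -
  obtain p where p: "p < m" "cyc_succ m p = i" using ex_cyc_pred[OF assms(1)] .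
  have "cyc_preds m {i, cyc_succ m i} = {p, i}"
    using p assms(1) cyc_succ_inject by (auto simp: cyc_preds_def)
  then have "pred_closure m {i, cyc_succ m i} = {p, i, cyc_succ m i}" by (auto simp: pred_closure_def)
  moreover have "p \<noteq> i" "i \<noteq> cyc_succ m i" "p \<noteq> cyc_succ m i"
    using p assms cyc_succ_neq[of p m] cyc_succ_neq[of i m] cyc_succ_succ_neq[of p m] by auto
  ultimately show ?thesis by simp
qed

lemma pred_closure_pair_Int_separated:
  assumes J: "\<And>f. f \<in> G \<Longrightarrow> J f \<subseteq> {..<m}"
    and separated: "\<And>f f' a. f \<in> G \<Longrightarrow> f' \<in> G \<Longrightarrow> f \<noteq> f' \<Longrightarrow> a \<in> J f \<Longrightarrow> cyc_succ m a \<notin> J f'"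
    and fg: "f \<in> G" "g \<in> G" "g \<noteq> f" and pair: "{p, cyc_succ m p} \<subseteq> J f"
  shows "pred_closure m {p, cyc_succ m p} \<inter> pred_closure m (J g) = {}"
proof (rule pred_closure_Int_empty)
  show "{p, cyc_succ m p} \<subseteq> {..<m}" "J g \<subseteq> {..<m}" using J[OF fg(1)] J[OF fg(2)] pair by auto
  show "{p, cyc_succ m p} \<inter> J g = {}"
    using separated[OF fg(1,2)] separated[OF fg(2,1)] fg(3) pair by blast
  show "cyc_succ m a \<notin> J g" if "a \<in> {p, cyc_succ m p}" for a
    using separated[OF fg(1,2)] fg(3) pair that by blast
  show "cyc_succ m a \<notin> {p, cyc_succ m p}" if "a \<in> J g" for a
    using separated[OF fg(2,1)] fg(3) pair that by blast
qed

lemma card_UN_pred_closure_pairs: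
  assumes "3 \<le> m" "finite H" and p: "\<And>f. f \<in> H \<Longrightarrow> p f < m"
    and disj: "\<And>f g. f \<in> H \<Longrightarrow> g \<in> H \<Longrightarrow> f \<noteq> g \<Longrightarrow>
      pred_closure m {p f, cyc_succ m (p f)} \<inter> pred_closure m {p g, cyc_succ m (p g)} = {}"
  shows "card (\<Union>f\<in>H. pred_closure m {p f, cyc_succ m (p f)}) = 3 * card H"
proof -
  have "card (\<Union>f\<in>H. pred_closure m {p f, cyc_succ m (p f)})
      = (\<Sum>f\<in>H. card (pred_closure m {p f, cyc_succ m (p f)}))"
  proof (rule card_UN_disjoint[OF assms(2)])
    show "\<forall>f\<in>H. finite (pred_closure m {p f, cyc_succ m (p f)})"
      using p cyc_succ_less[of m] assms(1) by (intro ballI finite_pred_closure) auto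
  qed (use disj in blast)
  also have "\<dots> = (\<Sum>f\<in>H. 3)" by (intro sum.cong refl card_pred_closure_pair p assms(1))
  finally show ?thesis by simp
qed

text \<open>A consecutive pair inside a separated family belongs to one member only, so its closure is
disjoint from everything the other members contribute.\<close>

lemma card_pred_closure_UN_ge:
  assumes m: "3 \<le> m" and J: "\<And>f. f \<in> G \<Longrightarrow> J f \<subseteq> {..<m}"
    and separated: "\<And>f f' a. f \<in> G \<Longrightarrow> f' \<in> G \<Longrightarrow> f \<noteq> f' \<Longrightarrow> a \<in> J f \<Longrightarrow> cyc_succ m a \<notin> J f'"
    and HK: "H \<subseteq> G" "K \<subseteq> G" "H \<inter> K = {}" "finite H"
    and consecutive: "\<And>f. f \<in> H \<Longrightarrow> \<exists>a\<in>J f. cyc_succ m a \<in> J f"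
  shows "card (pred_closure m (\<Union>f\<in>K. J f)) + 3 * card H \<le> card (pred_closure m (\<Union>f\<in>G. J f))"
proof -
  obtain p where p: "\<And>f. f \<in> H \<Longrightarrow> p f \<in> J f \<and> cyc_succ m (p f) \<in> J f"
    using consecutive by metis
  define P where "P f = {p f, cyc_succ m (p f)}" for f
  have PJ: "P f \<subseteq> J f" if "f \<in> H" for f using p[OF that] by (simp add: P_def)
  have disj: "pred_closure m (P f) \<inter> pred_closure m (J g) = {}" if "f \<in> H" "g \<in> G" "g \<noteq> f" for f g
    unfolding P_def
  proof (rule pred_closure_pair_Int_separated[of G J m f g])
    show "f \<in> G" using that(1) HK(1) by blast
    show "{p f, cyc_succ m (p f)} \<subseteq> J f" using PJ[OF that(1)] by (simp add: P_def)
  qed (use J separated that in auto)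
  have cardH: "card (\<Union>f\<in>H. pred_closure m (P f)) = 3 * card H"
    unfolding P_def
  proof (rule card_UN_pred_closure_pairs[OF m HK(4)])
    show "p f < m" if "f \<in> H" for f using p[OF that] J HK(1) that by blast
    show "pred_closure m {p f, cyc_succ m (p f)} \<inter> pred_closure m {p g, cyc_succ m (p g)} = {}"
      if "f \<in> H" "g \<in> H" "f \<noteq> g" for f g
      using disj[of f g] pred_closure_mono[OF PJ[OF that(2)]] HK(1) that unfolding P_def by blast
  qed
  have finite: "finite (pred_closure m (\<Union>f\<in>G. J f))" by (intro finite_pred_closure UN_least J)
  have subH: "(\<Union>f\<in>H. pred_closure m (P f)) \<subseteq> pred_closure m (\<Union>f\<in>G. J f)"
    using PJ HK(1) by (intro UN_least pred_closure_mono) blast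
  have subK: "pred_closure m (\<Union>f\<in>K. J f) \<subseteq> pred_closure m (\<Union>f\<in>G. J f)"
    using HK(2) by (intro pred_closure_mono) blast
  have "pred_closure m (\<Union>f\<in>K. J f) \<inter> (\<Union>f\<in>H. pred_closure m (P f)) = {}"
  proof -
    have "pred_closure m (P f) \<inter> pred_closure m (\<Union>f\<in>K. J f) = {}" if "f \<in> H" for f
      using disj[OF that] HK(2,3) that by (fastforce simp: pred_closure_def cyc_preds_def)
    then show ?thesis by blast
  qed
  then have "card (pred_closure m (\<Union>f\<in>K. J f) \<union> (\<Union>f\<in>H. pred_closure m (P f)))
      = card (pred_closure m (\<Union>f\<in>K. J f)) + 3 * card H"
    unfolding cardH[symmetric] using subH subK finite
    by (intro card_Un_disjoint) (auto intro: finite_subset)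
  moreover have "card (pred_closure m (\<Union>f\<in>K. J f) \<union> (\<Union>f\<in>H. pred_closure m (P f)))
      \<le> card (pred_closure m (\<Union>f\<in>G. J f))"
    using subH subK by (intro card_mono[OF finite]) blast
  ultimately show ?thesis by simp
qed

section \<open>Hamiltonian paths in uniform hypergraphs\<close>

locale uniform_hg =
  fixes V :: "'a set" and E :: "'a set set" and n r :: nat
  assumes finite_V: "finite V" and card_V: "card V = n"
    and three_le_r: "3 \<le> r" and r_less_n: "r < n"
    and edge_subset: "e \<in> E \<Longrightarrow> e \<subseteq> V" and card_edge: "e \<in> E \<Longrightarrow> card e = r"
begin

lemma four_le_n: "4 \<le> n"
  using three_le_r r_less_n by simp

lemma finite_E: "finite E"
  using finite_V edge_subset by (meson PowI finite_Pow_iff finite_subset subsetI)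

lemma finite_edge: "f \<in> E \<Longrightarrow> finite f"
  using edge_subset finite_V finite_subset by blast

lemma edge_eqI: "f \<in> E \<Longrightarrow> g \<in> E \<Longrightarrow> f \<subseteq> g \<Longrightarrow> f = g"
  using card_edge finite_edge by (metis card_subset_eq)

lemma hdegree_le_card: "F \<subseteq> E \<Longrightarrow> hdegree F x \<le> card F"
  unfolding hdegree_def using finite_E by (intro card_mono) (auto intro: finite_subset)

lemma hdegree_pos_iff: "F \<subseteq> E \<Longrightarrow> 0 < hdegree F x \<longleftrightarrow> (\<exists>f\<in>F. x \<in> f)"
  unfolding hdegree_def using finite_subset[OF _ finite_E, of F] by (auto simp: card_gt_0_iff)

lemma hdegree_le_1_unique:
  assumes "F \<subseteq> E" "hdegree F x \<le> 1" "f \<in> F" "x \<in> f" "g \<in> F" "x \<in> g"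
  shows "f = g"
proof -
  have "finite {f \<in> F. x \<in> f}" using finite_subset[OF assms(1) finite_E] by simp
  then show ?thesis
    using assms(2-) unfolding hdegree_def One_nat_def by (subst (asm) card_le_Suc0_iff_eq) auto
qed

lemma hdegree_split:
  assumes "inj_on c I" "c ` I \<subseteq> E"
  shows "hdegree E x = hdegree (E - c ` I) x + card {i \<in> I. x \<in> c i}"
proof -
  have "{f \<in> E. x \<in> f} = {f \<in> E - c ` I. x \<in> f} \<union> c ` {i \<in> I. x \<in> c i}" using assms(2) by auto
  moreover have "card (c ` {i \<in> I. x \<in> c i}) = card {i \<in> I. x \<in> c i}"
    by (rule card_image) (rule inj_on_subset[OF assms(1)], auto)
  moreover have "finite (c ` {i \<in> I. x \<in> c i})"
    by (rule finite_subset[OF _ finite_E]) (use assms(2) in auto)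
  moreover have "{f \<in> E - c ` I. x \<in> f} \<inter> c ` {i \<in> I. x \<in> c i} = {}" by auto
  ultimately show ?thesis unfolding hdegree_def using finite_E by (simp add: card_Un_disjoint)
qed

lemma sum_hdegree:
  assumes "F \<subseteq> E"
  shows "(\<Sum>x\<in>V. hdegree F x) = r * card F"
  unfolding hdegree_def
proof (rule sum_multicount[OF finite_V finite_subset[OF assms finite_E]])
  show "\<forall>f\<in>F. card {x \<in> V. x \<in> f} = r"
  proof
    fix f assume "f \<in> F"
    then have f: "f \<in> E" using assms by blast
    then have "{x \<in> V. x \<in> f} = f" using edge_subset by blast
    then show "card {x \<in> V. x \<in> f} = r" using card_edge[OF f] by simp
  qed
qed

lemma hdegree_le_binomial:
  assumes "F \<subseteq> E" "finite A" and inside: "\<And>f. f \<in> F \<Longrightarrow> x \<in> f \<Longrightarrow> f - {x} \<subseteq> A"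
  shows "hdegree F x \<le> card A choose (r - 1)"
proof -
  let ?G = "{f \<in> F. x \<in> f}"
  have "inj_on (\<lambda>f. f - {x}) ?G" by (rule inj_onI) (metis (lifting) insert_Diff mem_Collect_eq)
  then have "hdegree F x = card ((\<lambda>f. f - {x}) ` ?G)" by (simp add: hdegree_def card_image)
  also have "\<dots> \<le> card {B. B \<subseteq> A \<and> card B = r - 1}"
    using assms(1,2) inside card_edge by (intro card_mono) (auto simp: card_Diff_singleton)
  also have "\<dots> = card A choose (r - 1)" using n_subsets[OF assms(2)] by simp
  finally show ?thesis .
qed

lemma star_complete:
  assumes "F \<subseteq> E" "finite A" "\<And>f. f \<in> F \<Longrightarrow> x \<in> f \<Longrightarrow> f - {x} \<subseteq> A"
    and full: "card A choose (r - 1) \<le> hdegree F x" and B: "B \<subseteq> A" "card B = r - 1"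
  shows "insert x B \<in> F"
proof -
  let ?G = "{f \<in> F. x \<in> f}" and ?S = "{B. B \<subseteq> A \<and> card B = r - 1}"
  have "inj_on (\<lambda>f. f - {x}) ?G" by (rule inj_onI) (metis (lifting) insert_Diff mem_Collect_eq)
  then have "card ((\<lambda>f. f - {x}) ` ?G) = hdegree F x" by (simp add: hdegree_def card_image)
  moreover have "card ?S = card A choose (r - 1)" by (rule n_subsets[OF assms(2)])
  moreover have "(\<lambda>f. f - {x}) ` ?G \<subseteq> ?S"
    using assms(1,3) card_edge by (auto simp: card_Diff_singleton)
  ultimately have "(\<lambda>f. f - {x}) ` ?G = ?S" using assms(2) full by (intro card_seteq) auto
  then have "B \<in> (\<lambda>f. f - {x}) ` ?G" using B by simp
  then obtain f where "f \<in> F" "x \<in> f" "B = f - {x}" by blast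
  then show ?thesis by (simp add: insert_absorb)
qed

lemma card_edge_indices:
  assumes "bij_betw u I (V - {x})" "f \<in> E"
  shows "u ` {i \<in> I. u i \<in> f} = f - {x}"
    "card {i \<in> I. u i \<in> f} = (if x \<in> f then r - 1 else r)"
proof -
  have inj: "inj_on u {i \<in> I. u i \<in> f}"
    by (rule inj_on_subset[OF bij_betw_imp_inj_on[OF assms(1)]]) auto
  have "u ` {i \<in> I. u i \<in> f} = u ` I \<inter> f" by blast
  also have "\<dots> = (V - {x}) \<inter> f" by (simp only: bij_betw_imp_surj_on[OF assms(1)])
  also have "\<dots> = f - {x}" using edge_subset[OF assms(2)] by blast
  finally show image: "u ` {i \<in> I. u i \<in> f} = f - {x}" .
  have "card {i \<in> I. u i \<in> f} = card (f - {x})" using card_image[OF inj] image by simp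
  then show "card {i \<in> I. u i \<in> f} = (if x \<in> f then r - 1 else r)"
    using card_edge[OF assms(2)] by (simp add: card_Diff_singleton_if)
qed

text \<open>Paths are indexed as $v_1, e_1, \ldots, e_{n-1}, v_n$; values of the functions outside these
ranges are irrelevant.\<close>

definition ham_path :: "(nat \<Rightarrow> 'a) \<Rightarrow> (nat \<Rightarrow> 'a set) \<Rightarrow> bool" where
  "ham_path v e \<longleftrightarrow> bij_betw v {1..n} V \<and> inj_on e {1..<n} \<and> e ` {1..<n} \<subseteq> E \<and>
     (\<forall>i\<in>{1..<n}. v i \<in> e i \<and> v (Suc i) \<in> e i)"

definition free_edges :: "(nat \<Rightarrow> 'a set) \<Rightarrow> 'a set set" where
  "free_edges e = E - e ` {1..<n}"

definition path_degree :: "(nat \<Rightarrow> 'a set) \<Rightarrow> 'a \<Rightarrow> nat" where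
  "path_degree e x = card {i \<in> {1..<n}. x \<in> e i}"

lemma ham_path_bij: "ham_path v e \<Longrightarrow> bij_betw v {1..n} V"
  and ham_path_inj: "ham_path v e \<Longrightarrow> inj_on e {1..<n}"
  and path_edges_subset: "ham_path v e \<Longrightarrow> e ` {1..<n} \<subseteq> E"
  and path_edge_left: "ham_path v e \<Longrightarrow> 1 \<le> i \<Longrightarrow> i < n \<Longrightarrow> v i \<in> e i"
  and path_edge_right: "ham_path v e \<Longrightarrow> 1 \<le> i \<Longrightarrow> i < n \<Longrightarrow> v (Suc i) \<in> e i"
  and path_edge_mem: "ham_path v e \<Longrightarrow> 1 \<le> i \<Longrightarrow> i < n \<Longrightarrow> e i \<in> E"
  by (auto simp: ham_path_def)

lemma path_vertex_mem: "ham_path v e \<Longrightarrow> 1 \<le> i \<Longrightarrow> i \<le> n \<Longrightarrow> v i \<in> V"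
  using ham_path_bij[of v e] by (auto simp: bij_betw_def)

lemma start_mem: "ham_path v e \<Longrightarrow> v 1 \<in> V"
  using path_vertex_mem[of v e 1] four_le_n by simp

lemma path_vertex_inject:
  "ham_path v e \<Longrightarrow> 1 \<le> i \<Longrightarrow> i \<le> n \<Longrightarrow> 1 \<le> j \<Longrightarrow> j \<le> n \<Longrightarrow> v i = v j \<longleftrightarrow> i = j"
  using ham_path_bij[of v e] by (auto simp: bij_betw_def inj_on_eq_iff)

lemma path_edge_inject:
  "ham_path v e \<Longrightarrow> 1 \<le> i \<Longrightarrow> i < n \<Longrightarrow> 1 \<le> j \<Longrightarrow> j < n \<Longrightarrow> e i = e j \<longleftrightarrow> i = j"
  using ham_path_inj[of v e] by (auto simp: inj_on_eq_iff)

lemma path_vertexE: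
  assumes "ham_path v e" "x \<in> V"
  obtains i where "1 \<le> i" "i \<le> n" "x = v i"
  using ham_path_bij[OF assms(1)] assms(2) by (auto simp: bij_betw_def)

lemma card_vertex_image: "ham_path v e \<Longrightarrow> A \<subseteq> {1..n} \<Longrightarrow> card (v ` A) = card A"
  using ham_path_bij by (metis bij_betw_def card_image inj_on_subset)

lemma vertex_mem_image_iff:
  "ham_path v e \<Longrightarrow> 1 \<le> i \<Longrightarrow> i \<le> n \<Longrightarrow> A \<subseteq> {1..n} \<Longrightarrow> v i \<in> v ` A \<longleftrightarrow> i \<in> A"
  by (rule inj_on_image_mem_iff[OF bij_betw_imp_inj_on[OF ham_path_bij]]) auto

lemma free_edges_subset: "free_edges e \<subseteq> E"
  by (auto simp: free_edges_def)

lemma finite_free_edges: "finite (free_edges e)"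
  using finite_subset[OF free_edges_subset finite_E] .

lemma free_edge_mem: "f \<in> free_edges e \<Longrightarrow> f \<in> E"
  by (simp add: free_edges_def)

lemma path_edge_not_free: "1 \<le> i \<Longrightarrow> i < n \<Longrightarrow> e i \<notin> free_edges e"
  by (auto simp: free_edges_def)

lemma edge_cases:
  assumes "f \<in> E"
  obtains "f \<in> free_edges e" | i where "1 \<le> i" "i < n" "f = e i"
  using assms by (cases "f \<in> free_edges e") (auto simp: free_edges_def)

lemma card_free_edges:
  assumes "ham_path v e"
  shows "card (free_edges e) + (n - 1) = card E"
proof -
  have "card (e ` {1..<n}) = n - 1" using ham_path_inj[OF assms] by (simp add: card_image)
  then show ?thesis
    using path_edges_subset[OF assms] finite_E unfolding free_edges_def
    by (metis card_Diff_subset card_mono finite_imageI finite_atLeastLessThan le_add_diff_inverse2)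
qed

lemma hdegree_eq_free_path:
  "ham_path v e \<Longrightarrow> hdegree E x = hdegree (free_edges e) x + path_degree e x"
  unfolding free_edges_def path_degree_def by (intro hdegree_split ham_path_inj path_edges_subset)

lemma sum_path_degree:
  assumes "ham_path v e"
  shows "(\<Sum>x\<in>V. path_degree e x) = r * (n - 1)"
proof -
  have "(\<Sum>x\<in>V. hdegree E x) = (\<Sum>x\<in>V. hdegree (free_edges e) x) + (\<Sum>x\<in>V. path_degree e x)"
    using hdegree_eq_free_path[OF assms] by (simp add: sum.distrib)
  then have "r * card E = r * card (free_edges e) + (\<Sum>x\<in>V. path_degree e x)"
    by (simp add: sum_hdegree free_edges_subset)
  then show ?thesis unfolding card_free_edges[OF assms, symmetric] by (simp add: distrib_left)
qed

lemma bij_betw_after_start: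
  assumes "ham_path v e"
  shows "bij_betw (\<lambda>i. v (Suc i)) {1..<n} (V - {v 1})"
proof -
  have rest: "bij_betw v ({1..n} - {1}) (V - {v 1})"
    using ham_path_bij[OF assms] four_le_n by (intro bij_betw_DiffI) (auto simp: bij_betw_def)
  have "bij_betw Suc {1..<n} ({1..n} - {1})"
    by (rule bij_betw_byWitness[where f' = "\<lambda>i. i - 1"]) (auto simp: One_nat_def)
  from bij_betw_trans[OF this rest] show ?thesis by (simp add: comp_def)
qed

lemma bij_betw_before_end:
  assumes "ham_path v e"
  shows "bij_betw v {1..<n} (V - {v n})"
proof -
  have "bij_betw v ({1..n} - {n}) (V - {v n})"
    using ham_path_bij[OF assms] four_le_n by (intro bij_betw_DiffI) (auto simp: bij_betw_def)
  moreover have "{1..n} - {n} = {1..<n}" by auto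
  ultimately show ?thesis by simp
qed

lemma ham_path_replace_edge:
  assumes h: "ham_path v e" and i: "1 \<le> i" "i < n" and f: "f \<in> free_edges e" "v i \<in> f" "v (Suc i) \<in> f"
  shows "ham_path v (e(i := f))" "free_edges (e(i := f)) = insert (e i) (free_edges e) - {f}"
proof -
  have "f \<notin> e ` {1..<n}" using f(1) by (auto simp: free_edges_def)
  then have "inj_on (e(i := f)) {1..<n}" using ham_path_inj[OF h] by (intro inj_on_fun_updI)
  then show "ham_path v (e(i := f))"
    unfolding ham_path_def
    using ham_path_bij[OF h] path_edge_mem[OF h] path_edge_left[OF h] path_edge_right[OF h]
      free_edge_mem[OF f(1)] f(2,3) by auto
  have "e ` ({1..<n} - {i}) = e ` {1..<n} - {e i}"
    using inj_on_image_set_diff[OF ham_path_inj[OF h], of "{1..<n}" "{i}"] i by simp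
  then have "(e(i := f)) ` {1..<n} = insert f (e ` {1..<n} - {e i})"
    unfolding fun_upd_image using i by simp
  then show "free_edges (e(i := f)) = insert (e i) (free_edges e) - {f}"
    using path_edge_mem[OF h i] by (auto simp: free_edges_def)
qed

text \<open>Rotation at $i$: the path becomes $v_i, \ldots, v_1, v_{i+1}, \ldots, v_n$, where \<open>f\<close> joins
$v_1$ and $v_{i+1}$.\<close>

definition rotation :: "nat \<Rightarrow> 'a set \<Rightarrow> (nat \<Rightarrow> 'a) \<Rightarrow> (nat \<Rightarrow> 'a set) \<Rightarrow> bool" where
  "rotation i f v e \<longleftrightarrow>
     1 \<le> i \<and> i < n \<and> f \<in> insert (e i) (free_edges e) \<and> v 1 \<in> f \<and> v (Suc i) \<in> f"

definition rotate_verts :: "nat \<Rightarrow> (nat \<Rightarrow> 'a) \<Rightarrow> nat \<Rightarrow> 'a" where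
  "rotate_verts i v = (\<lambda>j. v (if j \<le> i then i + 1 - j else j))"

definition rotate_edges :: "nat \<Rightarrow> 'a set \<Rightarrow> (nat \<Rightarrow> 'a set) \<Rightarrow> nat \<Rightarrow> 'a set" where
  "rotate_edges i f e = (\<lambda>j. e (if j < i then i - j else j))(i := f)"

lemma rotate_verts_start: "1 \<le> i \<Longrightarrow> rotate_verts i v 1 = v i"
  and rotate_verts_gt: "i < j \<Longrightarrow> rotate_verts i v j = v j"
  and rotate_verts_le: "j \<le> i \<Longrightarrow> rotate_verts i v j = v (i + 1 - j)"
  and rotate_edges_pivot: "rotate_edges i f e i = f"
  and rotate_edges_gt: "i < j \<Longrightarrow> rotate_edges i f e j = e j"
  and rotate_edges_lt: "j < i \<Longrightarrow> rotate_edges i f e j = e (i - j)"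
  by (auto simp: rotate_verts_def rotate_edges_def)

lemma rotation_index: "rotation i f v e \<Longrightarrow> 1 \<le> i" "rotation i f v e \<Longrightarrow> i < n"
  by (simp_all add: rotation_def)

lemma rotation_end: "rotation i f v e \<Longrightarrow> rotate_verts i v n = v n"
  by (simp add: rotation_def rotate_verts_gt)

lemma rotate_edges_image:
  assumes "ham_path v e" "rotation i f v e"
  shows "inj_on (rotate_edges i f e) {1..<n}"
    "rotate_edges i f e ` {1..<n} = insert f (e ` {1..<n} - {e i})"
proof -
  define g where "g = (\<lambda>j. e (if j < i then i - j else j))"
  have i: "i \<in> {1..<n}" and f: "f \<in> insert (e i) (free_edges e)"
    using assms(2) by (auto simp: rotation_def)
  have "bij_betw g {1..<n} (e ` {1..<n})"
    unfolding g_def using ham_path_inj[OF assms(1)] i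
    by (intro bij_betw_comp_involution[where p = "\<lambda>j. if j < i then i - j else j"])
       (auto simp: bij_betw_def)
  then have inj: "inj_on g {1..<n}" and image: "g ` {1..<n} = e ` {1..<n}" by (auto simp: bij_betw_def)
  have rotate: "rotate_edges i f e = g(i := f)" and "g i = e i"
    by (simp_all add: rotate_edges_def g_def)
  show "inj_on (rotate_edges i f e) {1..<n}"
  proof (cases "f = e i")
    case True
    have "g(i := f) = g" using \<open>g i = e i\<close> True by (simp add: fun_upd_idem_iff)
    then show ?thesis using inj by (simp add: rotate)
  next
    case False
    then have "f \<notin> g ` {1..<n}" using f unfolding image free_edges_def by blast
    then show ?thesis unfolding rotate using inj by (rule inj_on_fun_updI[rotated])
  qed
  have "g ` ({1..<n} - {i}) = e ` {1..<n} - {e i}"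
    using inj_on_image_set_diff[OF inj, of "{1..<n}" "{i}"] i by (simp add: image \<open>g i = e i\<close>)
  then show "rotate_edges i f e ` {1..<n} = insert f (e ` {1..<n} - {e i})"
    unfolding rotate fun_upd_image using i by simp
qed

lemma ham_path_rotate:
  assumes h: "ham_path v e" and rot: "rotation i f v e"
  shows "ham_path (rotate_verts i v) (rotate_edges i f e)"
proof -
  have i: "1 \<le> i" "i < n" and f: "f \<in> E" "v 1 \<in> f" "v (Suc i) \<in> f"
    using rot path_edge_mem[OF h] by (auto simp: rotation_def free_edges_def)
  have "bij_betw (rotate_verts i v) {1..n} V"
    unfolding rotate_verts_def using i
    by (intro ham_path_bij[OF h]
        bij_betw_comp_involution[where p = "\<lambda>j. if j \<le> i then i + 1 - j else j"]) auto
  moreover have "rotate_verts i v j \<in> rotate_edges i f e j \<and>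
      rotate_verts i v (Suc j) \<in> rotate_edges i f e j" if j: "1 \<le> j" "j < n" for j
  proof -
    consider "j < i" | "j = i" | "i < j" by linarith
    then show ?thesis
    proof cases
      case 1
      then have "Suc (i - j) = i + 1 - j" "i + 1 - Suc j = i - j" by auto
      with 1 path_edge_left[OF h, of "i - j"] path_edge_right[OF h, of "i - j"] i
      show ?thesis by (simp add: rotate_verts_le rotate_edges_lt)
    next
      case 2
      then show ?thesis using f i by (simp add: rotate_verts_def rotate_edges_def)
    next
      case 3
      then show ?thesis using path_edge_left[OF h] path_edge_right[OF h] j
        by (simp add: rotate_verts_gt rotate_edges_gt)
    qed
  qed
  ultimately show ?thesis
    unfolding ham_path_def using rotate_edges_image[OF h rot] f(1) path_edges_subset[OF h] by auto
qed

lemma free_edges_rotate: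
  assumes "ham_path v e" "rotation i f v e"
  shows "free_edges (rotate_edges i f e) = insert (e i) (free_edges e) - {f}"
  using rotate_edges_image(2)[OF assms] path_edge_mem[OF assms(1)] assms(2)
  by (auto simp: free_edges_def rotation_def)

lemma rotation_path_edge: "ham_path v e \<Longrightarrow> 1 \<le> i \<Longrightarrow> i < n \<Longrightarrow> v 1 \<in> e i \<Longrightarrow> rotation i (e i) v e"
  using path_edge_right[of v e i] by (simp add: rotation_def)

lemma free_edges_rotate_path_edge:
  "ham_path v e \<Longrightarrow> rotation i (e i) v e \<Longrightarrow> free_edges (rotate_edges i (e i) e) = free_edges e"
  using free_edges_rotate[of v e i "e i"] path_edge_not_free[of i e] rotation_index[of i "e i" v e]
  by auto

lemma path_degree_cong:
  "ham_path v e \<Longrightarrow> ham_path v' e' \<Longrightarrow> free_edges e' = free_edges e \<Longrightarrow> path_degree e' x = path_degree e x"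
  using hdegree_eq_free_path[of v e x] hdegree_eq_free_path[of v' e' x] by simp

definition reverse_verts :: "(nat \<Rightarrow> 'a) \<Rightarrow> nat \<Rightarrow> 'a" where
  "reverse_verts v = (\<lambda>j. v (n + 1 - j))"

definition reverse_edges :: "(nat \<Rightarrow> 'a set) \<Rightarrow> nat \<Rightarrow> 'a set" where
  "reverse_edges e = (\<lambda>j. e (n - j))"

lemma reverse_verts_start [simp]: "reverse_verts v 1 = v n"
  and reverse_verts_end [simp]: "reverse_verts v n = v 1"
  by (simp_all add: reverse_verts_def)

lemma bij_betw_reverse_edges:
  assumes "ham_path v e"
  shows "bij_betw (reverse_edges e) {1..<n} (e ` {1..<n})"
  unfolding reverse_edges_def using ham_path_inj[OF assms]
  by (intro bij_betw_comp_involution[where p = "\<lambda>j. n - j"]) (auto simp: bij_betw_def)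

lemma ham_path_reverse:
  assumes h: "ham_path v e"
  shows "ham_path (reverse_verts v) (reverse_edges e)"
proof -
  have "bij_betw (reverse_verts v) {1..n} V"
    unfolding reverse_verts_def
    by (intro ham_path_bij[OF h] bij_betw_comp_involution[where p = "\<lambda>j. n + 1 - j"]) auto
  moreover have "reverse_verts v j \<in> reverse_edges e j \<and> reverse_verts v (Suc j) \<in> reverse_edges e j"
    if "1 \<le> j" "j < n" for j
  proof -
    have "n + 1 - j = Suc (n - j)" "n + 1 - Suc j = n - j" using that by auto
    then show ?thesis using path_edge_left[OF h, of "n - j"] path_edge_right[OF h, of "n - j"] that
      by (simp add: reverse_verts_def reverse_edges_def)
  qed
  ultimately show ?thesis
    unfolding ham_path_def using bij_betw_reverse_edges[OF h] path_edges_subset[OF h]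
    by (auto simp: bij_betw_def)
qed

lemma free_edges_reverse: "ham_path v e \<Longrightarrow> free_edges (reverse_edges e) = free_edges e"
  using bij_betw_reverse_edges[of v e] by (simp add: free_edges_def bij_betw_def)

text \<open>All index sets below consist of indices of path edges: $i$ counts as a free index of $v_1$ if
$v_{i+1}$, and of $v_n$ if $v_i$, is joined to the respective end by a free edge, so that reversal
acts on each of the sets by $i \mapsto n - i$.\<close>

definition start_free :: "(nat \<Rightarrow> 'a) \<Rightarrow> (nat \<Rightarrow> 'a set) \<Rightarrow> nat set" where
  "start_free v e = {i \<in> {1..<n}. \<exists>f\<in>free_edges e. v 1 \<in> f \<and> v (Suc i) \<in> f}"

definition start_edges :: "(nat \<Rightarrow> 'a) \<Rightarrow> (nat \<Rightarrow> 'a set) \<Rightarrow> nat set" where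
  "start_edges v e = {i \<in> {1..<n}. v 1 \<in> e i}"

definition end_free :: "(nat \<Rightarrow> 'a) \<Rightarrow> (nat \<Rightarrow> 'a set) \<Rightarrow> nat set" where
  "end_free v e = {i \<in> {1..<n}. \<exists>f\<in>free_edges e. v n \<in> f \<and> v i \<in> f}"

definition end_edges :: "(nat \<Rightarrow> 'a) \<Rightarrow> (nat \<Rightarrow> 'a set) \<Rightarrow> nat set" where
  "end_edges v e = {i \<in> {1..<n}. v n \<in> e i}"

definition start_pivots :: "(nat \<Rightarrow> 'a) \<Rightarrow> (nat \<Rightarrow> 'a set) \<Rightarrow> nat set" where
  "start_pivots v e = start_free v e \<union> start_edges v e"

definition end_pivots :: "(nat \<Rightarrow> 'a) \<Rightarrow> (nat \<Rightarrow> 'a set) \<Rightarrow> nat set" where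
  "end_pivots v e = end_free v e \<union> end_edges v e"

lemmas index_set_defs = start_free_def start_edges_def end_free_def end_edges_def

lemma index_sets_subset:
  "start_free v e \<subseteq> {1..<n}" "start_edges v e \<subseteq> {1..<n}" "end_free v e \<subseteq> {1..<n}"
  "end_edges v e \<subseteq> {1..<n}" "start_pivots v e \<subseteq> {1..<n}" "end_pivots v e \<subseteq> {1..<n}"
  by (auto simp: index_set_defs start_pivots_def end_pivots_def)

lemma finite_index_sets [simp]:
  "finite (start_free v e)" "finite (start_edges v e)" "finite (end_free v e)"
  "finite (end_edges v e)" "finite (start_pivots v e)" "finite (end_pivots v e)"
  by (auto simp: index_set_defs start_pivots_def end_pivots_def)

lemma index_set_reverse:
  assumes "ham_path v e" "1 \<le> i" "i < n"
  shows start_free_reverse: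
      "i \<in> start_free (reverse_verts v) (reverse_edges e) \<longleftrightarrow> n - i \<in> end_free v e"
    and start_edges_reverse:
      "i \<in> start_edges (reverse_verts v) (reverse_edges e) \<longleftrightarrow> n - i \<in> end_edges v e"
    and end_free_reverse:
      "i \<in> end_free (reverse_verts v) (reverse_edges e) \<longleftrightarrow> n - i \<in> start_free v e"
    and end_edges_reverse:
      "i \<in> end_edges (reverse_verts v) (reverse_edges e) \<longleftrightarrow> n - i \<in> start_edges v e"
proof -
  have "1 \<le> n - i" "n + 1 - i = Suc (n - i)" using assms(2,3) by auto
  then show
    "i \<in> start_free (reverse_verts v) (reverse_edges e) \<longleftrightarrow> n - i \<in> end_free v e"
    "i \<in> start_edges (reverse_verts v) (reverse_edges e) \<longleftrightarrow> n - i \<in> end_edges v e"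
    "i \<in> end_free (reverse_verts v) (reverse_edges e) \<longleftrightarrow> n - i \<in> start_free v e"
    "i \<in> end_edges (reverse_verts v) (reverse_edges e) \<longleftrightarrow> n - i \<in> start_edges v e"
    using assms(2,3) free_edges_reverse[OF assms(1)]
    by (simp_all add: index_set_defs reverse_verts_def reverse_edges_def)
qed

lemma
  assumes "ham_path v e" "1 \<le> i" "i < n"
  shows start_pivots_reverse:
      "i \<in> start_pivots (reverse_verts v) (reverse_edges e) \<longleftrightarrow> n - i \<in> end_pivots v e"
    and end_pivots_reverse:
      "i \<in> end_pivots (reverse_verts v) (reverse_edges e) \<longleftrightarrow> n - i \<in> start_pivots v e"
  using index_set_reverse[OF assms] by (simp_all add: start_pivots_def end_pivots_def)

lemma card_reflect:
  assumes "A \<subseteq> {1..<n}" "B \<subseteq> {1..<n}" "\<And>i. 1 \<le> i \<Longrightarrow> i < n \<Longrightarrow> i \<in> A \<longleftrightarrow> n - i \<in> B"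
  shows "card A = card B"
proof -
  have "n - i \<in> A" if "i \<in> B" for i
  proof -
    have "i \<in> {1..<n}" using assms(2) that by blast
    then have "1 \<le> n - i" "n - i < n" "n - (n - i) = i" by auto
    then show ?thesis using assms(3)[of "n - i"] that by simp
  qed
  then have "bij_betw (\<lambda>i. n - i) A B"
    using assms by (intro bij_betw_byWitness[where f' = "\<lambda>i. n - i"]) (auto dest!: subsetD)
  then show ?thesis by (rule bij_betw_same_card)
qed

lemma card_start_free_reverse:
  "ham_path v e \<Longrightarrow> card (start_free (reverse_verts v) (reverse_edges e)) = card (end_free v e)"
  and card_end_free_reverse:
  "ham_path v e \<Longrightarrow> card (end_free (reverse_verts v) (reverse_edges e)) = card (start_free v e)"
  and card_start_pivots_reverse:
  "ham_path v e \<Longrightarrow> card (start_pivots (reverse_verts v) (reverse_edges e)) = card (end_pivots v e)"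
  by (rule card_reflect[OF index_sets_subset(1,3) start_free_reverse]
      card_reflect[OF index_sets_subset(3,1) end_free_reverse]
      card_reflect[OF index_sets_subset(5,6) start_pivots_reverse]; assumption)+

lemma start_pivots_iff:
  "ham_path v e \<Longrightarrow> i \<in> start_pivots v e \<longleftrightarrow> (\<exists>f. rotation i f v e)"
  using path_edge_right[of v e i]
  by (auto simp: start_pivots_def start_free_def start_edges_def rotation_def)

lemma start_free_rotation: "i \<in> start_free v e \<Longrightarrow> \<exists>f\<in>free_edges e. rotation i f v e"
  by (auto simp: start_free_def rotation_def)

lemma start_edges_rotation: "ham_path v e \<Longrightarrow> i \<in> start_edges v e \<Longrightarrow> rotation i (e i) v e"
  by (simp add: start_edges_def rotation_path_edge)

lemma one_in_start_edges: "ham_path v e \<Longrightarrow> 1 \<in> start_edges v e"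
  using path_edge_left[of v e 1] four_le_n by (simp add: start_edges_def)

lemma card_start_edges: "card (start_edges v e) = path_degree e (v 1)"
  by (simp add: start_edges_def path_degree_def)

lemma start_edges_subset_vertices: "start_edges v e \<subseteq> {1..n}"
  by (auto simp: start_edges_def)

text \<open>The edge with the largest index in \<open>start_edges\<close> contains all vertices $v_i$ and one more.\<close>

lemma card_linked_start_edges:
  assumes h: "ham_path v e"
    and linked: "\<And>i j. i \<in> start_edges v e \<Longrightarrow> j \<in> start_edges v e \<Longrightarrow> i < j \<Longrightarrow> v i \<in> e j"
  shows "card (start_edges v e) < r"
proof -
  define l where "l = Max (start_edges v e)"
  have l_mem: "l \<in> start_edges v e"
    unfolding l_def using one_in_start_edges[OF h] by (intro Max_in) auto
  have le_l: "i \<le> l" if "i \<in> start_edges v e" for i using that by (simp add: l_def)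
  have l: "1 \<le> l" "l < n" using l_mem by (simp_all add: start_edges_def)
  have inside: "v ` insert (Suc l) (start_edges v e) \<subseteq> e l"
  proof (rule image_subsetI)
    fix i assume "i \<in> insert (Suc l) (start_edges v e)"
    then consider "i = Suc l" | "i = l" | "i \<in> start_edges v e" "i < l" using le_l by fastforce
    then show "v i \<in> e l"
      by cases (use path_edge_left[OF h l] path_edge_right[OF h l] linked[OF _ l_mem] in auto)
  qed
  have "Suc l \<notin> start_edges v e" using le_l[of "Suc l"] by auto
  then have "Suc (card (start_edges v e)) = card (insert (Suc l) (start_edges v e))" by simp
  also have "\<dots> = card (v ` insert (Suc l) (start_edges v e))"
    by (rule card_vertex_image[OF h, symmetric]) (use l in \<open>auto simp: start_edges_def\<close>)
  also have "\<dots> \<le> r"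
    using card_mono[OF finite_edge[OF path_edge_mem[OF h l]] inside] card_edge[OF path_edge_mem[OF h l]]
    by simp
  finally show ?thesis by simp
qed

lemma hdegree_start:
  "ham_path v e \<Longrightarrow> hdegree E (v 1) = hdegree (free_edges e) (v 1) + card (start_edges v e)"
  by (simp add: hdegree_eq_free_path card_start_edges)

lemma start_edge_indices:
  assumes "ham_path v e" "f \<in> E" "v 1 \<in> f"
  shows "(\<lambda>i. v (Suc i)) ` {i \<in> {1..<n}. v (Suc i) \<in> f} = f - {v 1}"
    "card {i \<in> {1..<n}. v (Suc i) \<in> f} = r - 1"
  using card_edge_indices[OF bij_betw_after_start[OF assms(1)] assms(2)] assms(3) by auto

lemma card_end_edge_indices:
  "ham_path v e \<Longrightarrow> f \<in> E \<Longrightarrow> v n \<in> f \<Longrightarrow> card {i \<in> {1..<n}. v i \<in> f} = r - 1"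
  using card_edge_indices(2)[OF bij_betw_before_end] by simp

lemma start_edge_minus_subset:
  assumes "ham_path v e" "f \<in> E" "v 1 \<in> f"
    and "\<And>i. 1 \<le> i \<Longrightarrow> i < n \<Longrightarrow> v (Suc i) \<in> f \<Longrightarrow> i \<in> S"
  shows "f - {v 1} \<subseteq> (\<lambda>i. v (Suc i)) ` S"
  unfolding start_edge_indices(1)[OF assms(1-3), symmetric] by (rule image_mono) (use assms(4) in auto)

lemma hdegree_start_le_binomial:
  assumes "ham_path v e" "F \<subseteq> E" "finite S"
    and "\<And>f i. f \<in> F \<Longrightarrow> v 1 \<in> f \<Longrightarrow> 1 \<le> i \<Longrightarrow> i < n \<Longrightarrow> v (Suc i) \<in> f \<Longrightarrow> i \<in> S"
  shows "hdegree F (v 1) \<le> card S choose (r - 1)"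
proof -
  have "hdegree F (v 1) \<le> card ((\<lambda>i. v (Suc i)) ` S) choose (r - 1)"
    using assms by (intro hdegree_le_binomial start_edge_minus_subset) auto
  also have "\<dots> \<le> card S choose (r - 1)"
    by (intro binomial_right_mono card_image_le[OF assms(3)])
  finally show ?thesis .
qed

lemma hdegree_free_start_le:
  "ham_path v e \<Longrightarrow> hdegree (free_edges e) (v 1) \<le> card (start_free v e) choose (r - 1)"
  by (rule hdegree_start_le_binomial[OF _ free_edges_subset]) (auto simp: start_free_def)

lemma start_free_rotateI:
  assumes "ham_path v e" "rotation i f v e"
    and "k \<in> insert (e i) (free_edges e)" "k \<noteq> f" "v i \<in> k"
    and "i < l" "l < n" "v (Suc l) \<in> k"
  shows "l \<in> start_free (rotate_verts i v) (rotate_edges i f e)"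
proof -
  have "k \<in> free_edges (rotate_edges i f e)" using free_edges_rotate[OF assms(1,2)] assms(3,4) by simp
  moreover have "rotate_verts i v 1 = v i" "rotate_verts i v (Suc l) = v (Suc l)"
    using rotation_index[OF assms(2)] assms(6) by (simp_all add: rotate_verts_start rotate_verts_gt)
  ultimately show ?thesis using assms(5-8) by (auto simp: start_free_def)
qed

end

locale nonhamiltonian_hg = uniform_hg +
  assumes nonhamiltonian: "\<nexists>vs es. hamiltonian_berge_cycle V E vs es"
begin

lemma no_closing_edge:
  assumes h: "ham_path v e" and f: "f \<in> free_edges e" "v 1 \<in> f"
  shows "v n \<notin> f"
proof
  assume end_f: "v n \<in> f"
  let ?vs = "map v [1..<Suc n]" and ?es = "map e [1..<n] @ [f]"
  have n: "1 < n" using four_le_n by simp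
  have "hamiltonian_berge_cycle V E ?vs ?es"
    unfolding hamiltonian_berge_cycle_def berge_cycle_def
  proof (intro conjI allI impI)
    show "length ?vs = card V" "length ?es = card V" using card_V n by auto
    have range: "set [1..<Suc n] = {1..n}" by auto
    then show "distinct ?vs" "set ?vs \<subseteq> V"
      using ham_path_bij[OF h] by (auto simp: distinct_map bij_betw_def simp del: upt_Suc)
    show "distinct ?es" using ham_path_inj[OF h] f by (auto simp: distinct_map free_edges_def)
    show "set ?es \<subseteq> E" using path_edges_subset[OF h] free_edge_mem[OF f(1)] by auto
    fix i assume i: "i < card V"
    have vs_nth: "j < n \<Longrightarrow> ?vs ! j = v (Suc j)" for j by (simp add: One_nat_def del: upt_Suc)
    show "{?vs ! i, ?vs ! ((i + 1) mod card V)} \<subseteq> ?es ! i"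
    proof (cases "i + 1 = n")
      case True
      then have "?es ! i = f" using n by (subst nth_append) auto
      moreover have "?vs ! i = v n" "?vs ! ((i + 1) mod card V) = v 1"
        using vs_nth[of i] vs_nth[of 0] True card_V n by (auto simp: One_nat_def)
      ultimately show ?thesis using end_f f by auto
    next
      case False
      then have i1: "Suc i < n" using i card_V by simp
      have "?es ! i = e (Suc i)" using i1 by (auto simp: nth_append One_nat_def)
      moreover have "?vs ! i = v (Suc i)" "?vs ! ((i + 1) mod card V) = v (Suc (Suc i))"
        using vs_nth[of i] vs_nth[of "Suc i"] i1 card_V by (simp_all add: One_nat_def del: upt_Suc)
      ultimately show ?thesis using path_edge_left[OF h _ i1] path_edge_right[OF h _ i1] by simp
    qed
  qed
  then show False using nonhamiltonian by blast
qed

lemma free_end_edge_rotate: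
  assumes "ham_path v e" "rotation i f v e" "g \<in> free_edges e" "v n \<in> g"
  shows "g \<in> free_edges (rotate_edges i f e)"
proof -
  have "g \<noteq> f" using no_closing_edge[OF assms(1,3)] assms(2,4) by (auto simp: rotation_def)
  then show ?thesis using free_edges_rotate[OF assms(1,2)] assms(3) by simp
qed

lemma start_pivots_not_end_free:
  assumes "ham_path v e" "i \<in> start_pivots v e"
  shows "i \<notin> end_free v e"
proof
  assume "i \<in> end_free v e"
  then obtain g where g: "g \<in> free_edges e" "v n \<in> g" "v i \<in> g" by (auto simp: end_free_def)
  obtain f where rot: "rotation i f v e" using assms start_pivots_iff by blast
  show False
    using no_closing_edge[OF ham_path_rotate[OF assms(1) rot] free_end_edge_rotate[OF assms(1) rot g(1,2)]]
      g rotation_end[OF rot] rotation_index[OF rot] by (simp add: rotate_verts_start)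
qed

lemma start_free_not_end_edges:
  assumes "ham_path v e" "i \<in> start_free v e"
  shows "i \<notin> end_edges v e"
proof
  assume "i \<in> end_edges v e"
  then have i: "1 \<le> i" "i < n" "v n \<in> e i" by (auto simp: end_edges_def)
  obtain f where f: "f \<in> free_edges e" and rot: "rotation i f v e"
    using start_free_rotation[OF assms(2)] by blast
  have "e i \<noteq> f" using path_edge_not_free[OF i(1,2)] f by blast
  then have "e i \<in> free_edges (rotate_edges i f e)" using free_edges_rotate[OF assms(1) rot] by simp
  from no_closing_edge[OF ham_path_rotate[OF assms(1) rot] this] show False
    using path_edge_left[OF assms(1) i(1,2)] i rotation_end[OF rot] by (simp add: rotate_verts_start)
qed

lemma start_free_not_end_free: "ham_path v e \<Longrightarrow> i \<in> start_free v e \<Longrightarrow> i \<notin> end_free v e"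
  and start_edges_not_end_free: "ham_path v e \<Longrightarrow> i \<in> start_edges v e \<Longrightarrow> i \<notin> end_free v e"
  using start_pivots_not_end_free by (auto simp: start_pivots_def)

lemma start_free_not_end_pivots: "ham_path v e \<Longrightarrow> i \<in> start_free v e \<Longrightarrow> i \<notin> end_pivots v e"
  using start_free_not_end_free start_free_not_end_edges by (auto simp: end_pivots_def)

lemma end_free_rotate_gt:
  assumes "ham_path v e" "rotation i f v e" "l \<in> end_free v e" "i < l"
  shows "l \<in> end_free (rotate_verts i v) (rotate_edges i f e)"
proof -
  obtain g where "g \<in> free_edges e" "v n \<in> g" "v l \<in> g" "1 \<le> l" "l < n"
    using assms(3) by (auto simp: end_free_def)
  then show ?thesis
    using free_end_edge_rotate[OF assms(1,2)] rotation_end[OF assms(2)] assms(4)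
    by (auto simp: end_free_def rotate_verts_gt)
qed

lemma end_free_rotate_le:
  assumes "ham_path v e" "rotation i f v e" "l \<in> end_free v e" "l \<le> i"
  shows "i + 1 - l \<in> end_free (rotate_verts i v) (rotate_edges i f e)"
proof -
  obtain g where g: "g \<in> free_edges e" "v n \<in> g" "v l \<in> g" and l: "1 \<le> l"
    using assms(3) by (auto simp: end_free_def)
  have "i + 1 - l \<le> i" "i + 1 - (i + 1 - l) = l" using l assms(4) by auto
  then have "rotate_verts i v (i + 1 - l) = v l" by (simp add: rotate_verts_le)
  then show ?thesis
    using free_end_edge_rotate[OF assms(1,2) g(1,2)] rotation_end[OF assms(2)]
      rotation_index[OF assms(2)] g l assms(4) by (auto simp: end_free_def)
qed

lemma end_pivots_rotate_gt:
  assumes "ham_path v e" "rotation i f v e" "l \<in> end_pivots v e" "i < l"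
  shows "l \<in> end_pivots (rotate_verts i v) (rotate_edges i f e)"
  using assms(3) end_free_rotate_gt[OF assms(1,2) _ assms(4)] rotation_end[OF assms(2)] assms(4)
  by (auto simp: end_pivots_def end_edges_def rotate_edges_gt)

lemma card_end_free_rotate:
  assumes "ham_path v e" "rotation i f v e"
  shows "card (end_free v e) \<le> card (end_free (rotate_verts i v) (rotate_edges i f e))"
proof -
  let ?p = "\<lambda>l. if l \<le> i then i + 1 - l else l"
  have "inj_on ?p {1..}" by (auto simp: inj_on_def)
  then have "inj_on ?p (end_free v e)" by (rule inj_on_subset) (auto simp: end_free_def)
  moreover have "?p ` end_free v e \<subseteq> end_free (rotate_verts i v) (rotate_edges i f e)"
    using end_free_rotate_gt[OF assms] end_free_rotate_le[OF assms] by auto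
  ultimately show ?thesis by (meson card_inj_on_le finite_index_sets(3))
qed

end

section \<open>Large rank\<close>

locale large_rank_hg = nonhamiltonian_hg +
  assumes n_le_2r: "n \<le> 2 * r" and degree_ge: "x \<in> V \<Longrightarrow> r \<le> hdegree E x"
begin

lemma ex_free_edge:
  assumes "ham_path v e"
  obtains f where "f \<in> free_edges e"
proof -
  have "n * r \<le> (\<Sum>x\<in>V. hdegree E x)"
    using sum_bounded_below[of V r "hdegree E"] degree_ge card_V by simp
  then have "n \<le> card E" using three_le_r by (simp add: sum_hdegree)
  then have "free_edges e \<noteq> {}" using card_free_edges[OF assms] four_le_n by auto
  then show thesis using that by blast
qed

lemma card_start_edges_ge:
  assumes "ham_path v e" "\<forall>f\<in>free_edges e. v 1 \<notin> f"
  shows "r \<le> card (start_edges v e)"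
proof -
  have "hdegree (free_edges e) (v 1) = 0" using assms(2) hdegree_pos_iff[OF free_edges_subset] by blast
  then show ?thesis using hdegree_start[OF assms(1)] degree_ge[OF start_mem[OF assms(1)]] by simp
qed

lemma ex_path_free_at_end:
  assumes h: "ham_path v e"
  shows "\<exists>v e. ham_path v e \<and> (\<exists>g\<in>free_edges e. v n \<in> g)"
proof (cases "\<exists>f\<in>free_edges e. v 1 \<in> f \<or> v n \<in> f")
  case True
  then show ?thesis using h ham_path_reverse[OF h] free_edges_reverse[OF h] reverse_verts_end by metis
next
  case False
  obtain f where f: "f \<in> free_edges e" using ex_free_edge[OF h] .
  have ge: "r \<le> card (start_edges v e)" using card_start_edges_ge[OF h] False by blast
  have "\<exists>i\<in>start_edges v e. v i \<in> f"
  proof (rule ccontr)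
    assume "\<not> ?thesis"
    then have "f \<subseteq> V - v ` insert n (start_edges v e)"
      using f False edge_subset[OF free_edge_mem[OF f]] by blast
    then have "card f \<le> card (V - v ` insert n (start_edges v e))"
      using finite_V by (intro card_mono) auto
    also have "\<dots> = n - card (v ` insert n (start_edges v e))"
      using finite_V card_V path_vertex_mem[OF h] four_le_n
      by (subst card_Diff_subset) (auto simp: start_edges_def)
    also have "card (v ` insert n (start_edges v e)) = Suc (card (start_edges v e))"
      using four_le_n by (subst card_vertex_image[OF h]) (auto simp: start_edges_def)
    finally show False using card_edge[OF free_edge_mem[OF f]] ge n_le_2r three_le_r by linarith
  qed
  then obtain i where i: "i \<in> start_edges v e" "v i \<in> f" by blast
  have rot: "rotation i (e i) v e" using start_edges_rotation[OF h i(1)] .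
  let ?v = "rotate_verts i v" and ?e = "rotate_edges i (e i) e"
  have h': "ham_path ?v ?e" using ham_path_rotate[OF h rot] .
  have "f \<in> free_edges (reverse_edges ?e)" "reverse_verts ?v n \<in> f"
    using f i(2) free_edges_reverse[OF h'] free_edges_rotate_path_edge[OF h rot] rotation_index[OF rot]
    by (simp_all add: rotate_verts_start)
  then show ?thesis using ham_path_reverse[OF h'] by blast
qed

lemma start_edges_eq_complement:
  assumes h: "ham_path v e" and g: "g \<in> free_edges e" "v n \<in> g" and none: "\<forall>f\<in>free_edges e. v 1 \<notin> f"
  shows "start_edges v e = {j \<in> {1..<n}. v j \<notin> g}" "card (start_edges v e) = r"
proof -
  let ?K = "{j \<in> {1..<n}. v j \<in> g}"
  have eq: "{j \<in> {1..<n}. v j \<notin> g} = {1..<n} - ?K" by auto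
  have "?K \<subseteq> end_free v e" using g by (auto simp: end_free_def)
  then have sub: "start_edges v e \<subseteq> {j \<in> {1..<n}. v j \<notin> g}"
    using start_edges_not_end_free[OF h] by (auto simp: start_edges_def)
  have card: "card {j \<in> {1..<n}. v j \<notin> g} = n - 1 - (r - 1)"
    unfolding eq using card_end_edge_indices[OF h free_edge_mem[OF g(1)] g(2)]
    by (subst card_Diff_subset) auto
  have ge: "r \<le> card (start_edges v e)" using card_start_edges_ge[OF h none] .
  show "start_edges v e = {j \<in> {1..<n}. v j \<notin> g}"
    by (rule card_seteq[OF _ sub]) (use card ge n_le_2r three_le_r in auto)
  then show "card (start_edges v e) = r" using card ge n_le_2r three_le_r by auto
qed

text \<open>Otherwise every $v_i$ with $i$ in \<open>start_edges\<close> can be rotated to the start without changing the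
complement of \<open>g\<close>.\<close>

lemma ex_path_free_at_both_ends:
  assumes h: "ham_path v e" and g: "g \<in> free_edges e" "v n \<in> g"
  shows "\<exists>v e. ham_path v e \<and> (\<exists>f\<in>free_edges e. v 1 \<in> f) \<and> (\<exists>g\<in>free_edges e. v n \<in> g)"
proof (rule ccontr)
  assume no: "\<not> ?thesis"
  have complement: "start_edges v' e' = {j \<in> {1..<n}. v' j \<notin> g}" "card (start_edges v' e') = r"
    if "ham_path v' e'" "free_edges e' = free_edges e" "v' n = v n" for v' e'
  proof -
    have "\<forall>f\<in>free_edges e'. v' 1 \<notin> f" using no g that by metis
    then show "start_edges v' e' = {j \<in> {1..<n}. v' j \<notin> g}" "card (start_edges v' e') = r"
      using start_edges_eq_complement[of v' e' g] g that by auto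
  qed
  have "v i \<in> e j" if i: "i \<in> start_edges v e" and j: "j \<in> start_edges v e" and "i < j" for i j
  proof -
    have rot: "rotation i (e i) v e" using start_edges_rotation[OF h i] .
    note h' = ham_path_rotate[OF h rot] and free = free_edges_rotate_path_edge[OF h rot]
    have "j \<in> {1..<n}" "v j \<notin> g" using complement(1)[OF h] j by auto
    then have "j \<in> start_edges (rotate_verts i v) (rotate_edges i (e i) e)"
      using complement(1)[OF h' free rotation_end[OF rot]] \<open>i < j\<close> by (simp add: rotate_verts_gt)
    then show ?thesis
      using \<open>i < j\<close> rotation_index[OF rot]
      by (simp add: start_edges_def rotate_verts_start rotate_edges_gt)
  qed
  then have "card (start_edges v e) < r" by (rule card_linked_start_edges[OF h])
  then show False using complement(2)[OF h] by simp
qed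

lemma first_edge_reaches_spare:
  assumes h: "ham_path v e" and f: "f \<in> free_edges e" "v 1 \<in> f"
    and cover: "\<And>i. 1 \<le> i \<Longrightarrow> i < n \<Longrightarrow> i \<noteq> q \<Longrightarrow> i \<in> start_free v e \<union> end_free v e"
    and card: "card (start_free v e) = r - 1" and q: "q \<noteq> 1"
  shows "v 2 \<in> f \<and> v (Suc q) \<in> e 1 \<and> 1 \<le> q \<and> q < n"
proof -
  have n: "1 < n" using four_le_n by simp
  note f_mem = free_edge_mem[OF f(1)]
  have "{i \<in> {1..<n}. v (Suc i) \<in> f} \<subseteq> start_free v e" using f by (auto simp: start_free_def)
  then have indices: "{i \<in> {1..<n}. v (Suc i) \<in> f} = start_free v e"
    using start_edge_indices(2)[OF h f_mem f(2)] card by (metis card_subset_eq finite_index_sets(1))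
  have first: "1 \<in> start_free v e"
    using cover[of 1] start_edges_not_end_free[OF h one_in_start_edges[OF h]] q n by auto
  then have v2: "v (Suc 1) \<in> f" using indices by blast
  have rot: "rotation 1 f v e" using f v2 n by (simp add: rotation_def)
  have e1: "e 1 \<in> E" "v 1 \<in> e 1" using path_edge_mem[OF h _ n] path_edge_left[OF h _ n] by simp_all
  have "e 1 \<noteq> f" using path_edge_not_free[OF order_refl n] f(1) by blast
  then have "\<not> e 1 - {v 1} \<subseteq> f" using edge_eqI[OF e1(1) f_mem] f(2) by blast
  then obtain y where y: "y \<in> (\<lambda>i. v (Suc i)) ` {i \<in> {1..<n}. v (Suc i) \<in> e 1}" "y \<notin> f"
    unfolding start_edge_indices(1)[OF h e1] by blast
  then obtain l where l: "1 \<le> l" "l < n" "v (Suc l) \<in> e 1" "v (Suc l) \<notin> f" by auto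
  have "l \<notin> end_free v e"
  proof (cases "l = 1")
    case False
    then have "l \<in> start_free (rotate_verts 1 v) (rotate_edges 1 f e)"
      using start_free_rotateI[OF h rot, of "e 1" l] \<open>e 1 \<noteq> f\<close> e1(2) l by simp
    then show ?thesis
      using start_free_not_end_free[OF ham_path_rotate[OF h rot]] end_free_rotate_gt[OF h rot, of l]
        False l(1)
      by auto
  qed (use first start_free_not_end_free[OF h] in blast)
  moreover have "l \<notin> start_free v e" using indices l(4) by blast
  ultimately have "l = q" using cover l(1,2) by blast
  then show ?thesis using l v2 by (simp add: numeral_2_eq_2 One_nat_def)
qed

lemma last_edge_reaches_spare:
  assumes h: "ham_path v e" and g: "g \<in> free_edges e" "v n \<in> g"
    and cover: "\<And>i. 1 \<le> i \<Longrightarrow> i < n \<Longrightarrow> i \<noteq> q \<Longrightarrow> i \<in> start_free v e \<union> end_free v e"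
    and card: "card (end_free v e) = r - 1" and q: "q \<noteq> n - 1"
  shows "v (n - 1) \<in> g \<and> v q \<in> e (n - 1) \<and> 1 \<le> q \<and> q < n"
proof -
  let ?v = "reverse_verts v" and ?e = "reverse_edges e"
  have "?v 2 \<in> g \<and> ?v (Suc (n - q)) \<in> ?e 1 \<and> 1 \<le> n - q \<and> n - q < n"
  proof (rule first_edge_reaches_spare[OF ham_path_reverse[OF h]])
    show "g \<in> free_edges ?e" "?v 1 \<in> g" using g free_edges_reverse[OF h] by auto
    show "card (start_free ?v ?e) = r - 1" using card_start_free_reverse[OF h] card by simp
    show "n - q \<noteq> 1" using q by auto
    fix i assume "1 \<le> i" "i < n" "i \<noteq> n - q"
    then show "i \<in> start_free ?v ?e \<union> end_free ?v ?e"
      using cover[of "n - i"] start_free_reverse[OF h] end_free_reverse[OF h] by auto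
  qed
  moreover from this have "n + 1 - Suc (n - q) = q" "n + 1 - 2 = n - 1" by auto
  ultimately show ?thesis by (auto simp: reverse_verts_def reverse_edges_def)
qed

lemma no_crossing_relink:
  assumes h: "ham_path v e" and f: "f \<in> free_edges e" "v 1 \<in> f" "v 2 \<in> f"
    and g: "g \<in> free_edges e" "v n \<in> g" "v (n - 1) \<in> g"
    and q: "1 \<le> q" "q < n" "v (Suc q) \<in> e 1" "v q \<in> e (n - 1)"
  shows False
proof -
  have n: "1 < n" "1 < n - 1" "n - 1 < n" "Suc (n - 1) = n" using four_le_n by auto
  define d where "d = e(1 := f)"
  have d: "ham_path v d" "free_edges d = insert (e 1) (free_edges e) - {f}"
    using ham_path_replace_edge[OF h, of 1 f] f n(1) unfolding d_def by (simp_all add: Suc_1)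
  have "g \<noteq> f" using no_closing_edge[OF h f(1,2)] g(2) by blast
  then have "g \<in> free_edges d" using d(2) g(1) by blast
  moreover have "d (n - 1) = e (n - 1)" using n(2) by (simp add: d_def)
  ultimately have last: "ham_path v (d(n - 1 := g))"
    "free_edges (d(n - 1 := g)) = insert (e (n - 1)) (free_edges d) - {g}"
    using ham_path_replace_edge[OF d(1), of "n - 1" g] g n by simp_all
  have "e 1 \<notin> {f, g}" "e (n - 1) \<noteq> g"
    using f(1) g(1) path_edge_not_free[of 1 e] path_edge_not_free[of "n - 1" e] n by auto
  then have "e 1 \<in> free_edges (d(n - 1 := g))" "e (n - 1) \<in> free_edges (d(n - 1 := g))"
    unfolding last(2) d(2) by auto
  moreover have "v 1 \<in> e 1" "v n \<in> e (n - 1)"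
    using path_edge_left[OF h, of 1] path_edge_right[OF h, of "n - 1"] n by auto
  ultimately have "q \<in> start_free v (d(n - 1 := g))" "q \<in> end_free v (d(n - 1 := g))"
    using q by (auto simp: start_free_def end_free_def)
  then show False using start_free_not_end_free[OF last(1)] by blast
qed

lemma spare_index_false:
  assumes h: "ham_path v e" and f: "f \<in> free_edges e" "v 1 \<in> f" and g: "g \<in> free_edges e" "v n \<in> g"
    and cover: "\<And>i. 1 \<le> i \<Longrightarrow> i < n \<Longrightarrow> i \<noteq> q \<Longrightarrow> i \<in> start_free v e \<union> end_free v e"
    and card: "card (start_free v e) = r - 1" "card (end_free v e) = r - 1"
  shows False
proof -
  have n: "1 < n" "1 < n - 1" "n - 1 < n" "Suc (n - 1) = n" using four_le_n by auto
  have first: "q \<noteq> 1 \<Longrightarrow> v 2 \<in> f \<and> v (Suc q) \<in> e 1 \<and> 1 \<le> q \<and> q < n"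
    by (rule first_edge_reaches_spare[OF h f _ card(1)]) (use cover in auto)
  have last: "q \<noteq> n - 1 \<Longrightarrow> v (n - 1) \<in> g \<and> v q \<in> e (n - 1) \<and> 1 \<le> q \<and> q < n"
    by (rule last_edge_reaches_spare[OF h g _ card(2)]) (use cover in auto)
  consider "q = 1" | "q = n - 1" | "q \<noteq> 1" "q \<noteq> n - 1" by blast
  then show False
  proof cases
    case 1
    then have "n - 1 \<in> start_edges v e" "n - 1 \<in> end_free v e"
      using last g n by (auto simp: start_edges_def end_free_def)
    then show False using start_edges_not_end_free[OF h] by blast
  next
    case 2
    then have "1 \<in> end_edges v e" "1 \<in> start_free v e"
      using first f n by (auto simp: end_edges_def start_free_def Suc_1)
    then show False using start_free_not_end_edges[OF h] by blast
  next
    case 3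
    then show False using no_crossing_relink[OF h f _ g] first last by blast
  qed
qed

lemma no_full_cover:
  assumes h: "ham_path v e" and f: "f \<in> free_edges e" "v 1 \<in> f" and g: "g \<in> free_edges e" "v n \<in> g"
    and cover: "\<And>i. 1 \<le> i \<Longrightarrow> i < n \<Longrightarrow> i \<in> start_free v e \<union> end_free v e"
    and card: "card (start_free v e) = r - 1 \<or> card (end_free v e) = r - 1"
  shows False
  using card
proof
  assume "card (start_free v e) = r - 1"
  then have "1 \<le> (0::nat)" using first_edge_reaches_spare[OF h f, of 0] cover by simp
  then show False by simp
next
  assume "card (end_free v e) = r - 1"
  then have "1 \<le> (0::nat)" using last_edge_reaches_spare[OF h g, of 0] cover four_le_n by simp
  then show False by simp
qed

lemma no_ham_path: "\<not> ham_path v e"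
proof
  assume "ham_path v e"
  then obtain v e f g where h: "ham_path v e"
    and f: "f \<in> free_edges e" "v 1 \<in> f" and g: "g \<in> free_edges e" "v n \<in> g"
    using ex_path_free_at_end ex_path_free_at_both_ends by metis
  let ?S = "start_free v e" and ?T = "end_free v e"
  have "card {i \<in> {1..<n}. v (Suc i) \<in> f} \<le> card ?S" "card {i \<in> {1..<n}. v i \<in> g} \<le> card ?T"
    using f g by (auto simp: start_free_def end_free_def intro!: card_mono)
  then have ge: "r - 1 \<le> card ?S" "r - 1 \<le> card ?T"
    using start_edge_indices(2)[OF h free_edge_mem[OF f(1)] f(2)]
      card_end_edge_indices[OF h free_edge_mem[OF g(1)] g(2)] by simp_all
  have sub: "?S \<union> ?T \<subseteq> {1..<n}" using index_sets_subset by blast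
  have "?S \<inter> ?T = {}" using start_free_not_end_free[OF h] by blast
  then have sum: "card (?S \<union> ?T) = card ?S + card ?T" by (simp add: card_Un_disjoint)
  have missing: "card ({1..<n} - (?S \<union> ?T)) = n - 1 - (card ?S + card ?T)"
    using sub sum by (simp add: card_Diff_subset)
  have le: "card ?S + card ?T \<le> n - 1" using card_mono[OF _ sub] sum by simp
  show False
  proof (cases "card ?S + card ?T = n - 1")
    case True
    then have "{1..<n} - (?S \<union> ?T) = {}" using missing by simp
    then have cover: "i \<in> ?S \<union> ?T" if "1 \<le> i" "i < n" for i using that atLeastLessThan_iff by blast
    moreover have "card ?S = r - 1 \<or> card ?T = r - 1" using True ge n_le_2r by linarith
    ultimately show False using no_full_cover[OF h f g] by blast
  next
    case False
    then have card: "card ?S = r - 1" "card ?T = r - 1" and n: "n = 2 * r"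
      using ge le n_le_2r by linarith+
    then have "card ({1..<n} - (?S \<union> ?T)) = 1" using missing three_le_r by simp
    then obtain q where "{1..<n} - (?S \<union> ?T) = {q}" by (rule card_1_singletonE)
    then have "i \<in> ?S \<union> ?T" if "1 \<le> i" "i < n" "i \<noteq> q" for i
      using that atLeastLessThan_iff by blast
    then show False using spare_index_false[OF h f g _ card] by blast
  qed
qed

end

section \<open>Cycles missing one vertex\<close>

context uniform_hg
begin

abbreviation nxt :: "nat \<Rightarrow> nat" where
  "nxt \<equiv> cyc_succ (n - 1)"

abbreviation preds :: "nat set \<Rightarrow> nat set" where
  "preds \<equiv> cyc_preds (n - 1)"

abbreviation with_preds :: "nat set \<Rightarrow> nat set" where
  "with_preds \<equiv> pred_closure (n - 1)"

lemma nxt_less [simp]: "nxt i < n - 1"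
  using four_le_n by (intro cyc_succ_less) simp

text \<open>Unlike paths, near-cycles are indexed from 0, modulo $n - 1$.\<close>

definition near_cycle :: "'a \<Rightarrow> (nat \<Rightarrow> 'a) \<Rightarrow> (nat \<Rightarrow> 'a set) \<Rightarrow> bool" where
  "near_cycle w u c \<longleftrightarrow> w \<in> V \<and> bij_betw u {..<n - 1} (V - {w}) \<and> inj_on c {..<n - 1} \<and>
     c ` {..<n - 1} \<subseteq> E \<and> (\<forall>i<n - 1. u i \<in> c i \<and> u (nxt i) \<in> c i)"

definition off_cycle :: "(nat \<Rightarrow> 'a set) \<Rightarrow> 'a set set" where
  "off_cycle c = E - c ` {..<n - 1}"

definition positions :: "(nat \<Rightarrow> 'a) \<Rightarrow> 'a set \<Rightarrow> nat set" where
  "positions u f = {i \<in> {..<n - 1}. u i \<in> f}"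

definition nbr_positions :: "'a \<Rightarrow> (nat \<Rightarrow> 'a) \<Rightarrow> (nat \<Rightarrow> 'a set) \<Rightarrow> nat set" where
  "nbr_positions w u c = {i \<in> {..<n - 1}. \<exists>f\<in>off_cycle c. w \<in> f \<and> u i \<in> f}"

definition incident_edges :: "'a \<Rightarrow> (nat \<Rightarrow> 'a set) \<Rightarrow> nat set" where
  "incident_edges w c = {i \<in> {..<n - 1}. w \<in> c i}"

lemma near_cycle_vertex: "near_cycle w u c \<Longrightarrow> w \<in> V"
  and near_cycle_bij: "near_cycle w u c \<Longrightarrow> bij_betw u {..<n - 1} (V - {w})"
  and near_cycle_inj: "near_cycle w u c \<Longrightarrow> inj_on c {..<n - 1}"
  and near_cycle_edges_subset: "near_cycle w u c \<Longrightarrow> c ` {..<n - 1} \<subseteq> E"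
  and cycle_edge_left: "near_cycle w u c \<Longrightarrow> i < n - 1 \<Longrightarrow> u i \<in> c i"
  and cycle_edge_right: "near_cycle w u c \<Longrightarrow> i < n - 1 \<Longrightarrow> u (nxt i) \<in> c i"
  and cycle_edge_mem: "near_cycle w u c \<Longrightarrow> i < n - 1 \<Longrightarrow> c i \<in> E"
  by (auto simp: near_cycle_def)

lemma cycle_vertex_mem: "near_cycle w u c \<Longrightarrow> i < n - 1 \<Longrightarrow> u i \<in> V"
  and cycle_vertex_neq: "near_cycle w u c \<Longrightarrow> i < n - 1 \<Longrightarrow> u i \<noteq> w"
  using near_cycle_bij[of w u c] by (auto simp: bij_betw_def)

lemma cycle_vertex_inject:
  "near_cycle w u c \<Longrightarrow> i < n - 1 \<Longrightarrow> j < n - 1 \<Longrightarrow> u i = u j \<longleftrightarrow> i = j"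
  using near_cycle_bij[of w u c] by (auto simp: bij_betw_def inj_on_eq_iff)

lemma cycle_edge_inject:
  "near_cycle w u c \<Longrightarrow> i < n - 1 \<Longrightarrow> j < n - 1 \<Longrightarrow> c i = c j \<longleftrightarrow> i = j"
  using near_cycle_inj[of w u c] by (auto simp: inj_on_eq_iff)

lemma cycle_vertexE:
  assumes "near_cycle w u c" "x \<in> V" "x \<noteq> w"
  obtains i where "i < n - 1" "x = u i"
proof -
  have "x \<in> u ` {..<n - 1}" using near_cycle_bij[OF assms(1)] assms(2,3) by (simp add: bij_betw_def)
  then show thesis using that by auto
qed

lemma off_cycle_subset: "off_cycle c \<subseteq> E"
  by (auto simp: off_cycle_def)

lemma off_cycle_mem: "f \<in> off_cycle c \<Longrightarrow> f \<in> E"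
  by (simp add: off_cycle_def)

lemma finite_off_cycle [simp]: "finite (off_cycle c)"
  using finite_subset[OF off_cycle_subset finite_E] .

lemma cycle_edge_not_off: "i < n - 1 \<Longrightarrow> c i \<notin> off_cycle c"
  by (auto simp: off_cycle_def)

lemma cycle_edge_cases:
  assumes "f \<in> E"
  obtains "f \<in> off_cycle c" | i where "i < n - 1" "f = c i"
  using assms by (cases "f \<in> off_cycle c") (auto simp: off_cycle_def)

lemma positions_subset: "positions u f \<subseteq> {..<n - 1}"
  and nbr_positions_subset: "nbr_positions w u c \<subseteq> {..<n - 1}"
  and incident_edges_subset: "incident_edges w c \<subseteq> {..<n - 1}"
  by (auto simp: positions_def nbr_positions_def incident_edges_def)

lemma finite_positions [simp]: "finite (positions u f)"
  and finite_nbr_positions [simp]: "finite (nbr_positions w u c)"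
  and finite_incident_edges [simp]: "finite (incident_edges w c)"
  by (simp_all add: positions_def nbr_positions_def incident_edges_def)

lemma positions_subset_nbr: "f \<in> off_cycle c \<Longrightarrow> w \<in> f \<Longrightarrow> positions u f \<subseteq> nbr_positions w u c"
  by (auto simp: positions_def nbr_positions_def)

lemma nbr_positions_eq_UN:
  "nbr_positions w u c = (\<Union>f\<in>{f \<in> off_cycle c. w \<in> f}. positions u f)"
  by (auto simp: positions_def nbr_positions_def)

lemma card_position_image: "near_cycle w u c \<Longrightarrow> A \<subseteq> {..<n - 1} \<Longrightarrow> card (u ` A) = card A"
  using near_cycle_bij by (metis bij_betw_def card_image inj_on_subset)

lemma position_mem_image_iff:
  "near_cycle w u c \<Longrightarrow> i < n - 1 \<Longrightarrow> A \<subseteq> {..<n - 1} \<Longrightarrow> u i \<in> u ` A \<longleftrightarrow> i \<in> A"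
  by (rule inj_on_image_mem_iff[OF bij_betw_imp_inj_on[OF near_cycle_bij]]) auto

lemma image_positions: "near_cycle w u c \<Longrightarrow> f \<in> E \<Longrightarrow> u ` positions u f = f - {w}"
  and card_positions:
    "near_cycle w u c \<Longrightarrow> f \<in> E \<Longrightarrow> card (positions u f) = (if w \<in> f then r - 1 else r)"
  unfolding positions_def by (fact card_edge_indices[OF near_cycle_bij])+

lemma positions_inject:
  assumes "near_cycle w u c" "f \<in> E" "g \<in> E" "w \<in> f \<longleftrightarrow> w \<in> g" "positions u f = positions u g"
  shows "f = g"
proof -
  have "f - {w} = g - {w}"
    using image_positions[OF assms(1,2)] image_positions[OF assms(1,3)] assms(5) by simp
  then show ?thesis using assms(4) by blast
qed

lemma hdegree_eq_off_incident:
  "near_cycle w u c \<Longrightarrow> hdegree E x = hdegree (off_cycle c) x + card (incident_edges x c)"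
  unfolding off_cycle_def incident_edges_def
  by (intro hdegree_split near_cycle_inj near_cycle_edges_subset)

lemma card_off_cycle:
  assumes "near_cycle w u c"
  shows "card (off_cycle c) + (n - 1) = card E"
proof -
  have "card (c ` {..<n - 1}) = n - 1" using near_cycle_inj[OF assms] by (simp add: card_image)
  then show ?thesis
    using near_cycle_edges_subset[OF assms] finite_E unfolding off_cycle_def
    by (metis card_Diff_subset card_mono finite_imageI finite_lessThan le_add_diff_inverse2)
qed

lemma near_cycle_reindex:
  assumes h: "near_cycle w u c"
    and s: "bij_betw s {..<n - 1} {..<n - 1}" and s': "bij_betw s' {..<n - 1} {..<n - 1}"
    and ends: "\<And>i. i < n - 1 \<Longrightarrow> {s i, s (nxt i)} = {s' i, nxt (s' i)}"
  shows "near_cycle w (u \<circ> s) (c \<circ> s')" "off_cycle (c \<circ> s') = off_cycle c"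
proof -
  have image: "(c \<circ> s') ` {..<n - 1} = c ` {..<n - 1}"
    unfolding image_comp[symmetric] using s' by (simp add: bij_betw_def)
  then show "off_cycle (c \<circ> s') = off_cycle c" by (simp add: off_cycle_def)
  have "bij_betw (u \<circ> s) {..<n - 1} (V - {w})" by (rule bij_betw_trans[OF s near_cycle_bij[OF h]])
  moreover have "inj_on (c \<circ> s') {..<n - 1}"
    using s' near_cycle_inj[OF h] by (simp add: comp_inj_on bij_betw_def)
  moreover have "u (s i) \<in> c (s' i) \<and> u (s (nxt i)) \<in> c (s' i)" if i: "i < n - 1" for i
  proof -
    have "s' i < n - 1" using s' i by (auto simp: bij_betw_def)
    then have "u ` {s' i, nxt (s' i)} \<subseteq> c (s' i)"
      using cycle_edge_left[OF h] cycle_edge_right[OF h] by simp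
    then show ?thesis unfolding ends[OF i, symmetric] by simp
  qed
  ultimately show "near_cycle w (u \<circ> s) (c \<circ> s')"
    unfolding near_cycle_def using near_cycle_vertex[OF h] near_cycle_edges_subset[OF h] image by auto
qed

lemma near_cycle_swap:
  assumes h: "near_cycle w u c" and p: "p < n - 1" "w \<in> c p" "w \<in> c (nxt p)"
  shows "near_cycle (u (nxt p)) (u(nxt p := w)) c"
proof -
  let ?j = "nxt p" and ?u = "u(nxt p := w)"
  have u: "inj_on u {..<n - 1}" "u ` {..<n - 1} = V - {w}"
    using near_cycle_bij[OF h] by (auto simp: bij_betw_def)
  have "u ` ({..<n - 1} - {?j}) = V - {w} - {u ?j}"
    using inj_on_image_set_diff[OF u(1), of "{..<n - 1}" "{?j}"] u(2) by simp
  then have "?u ` {..<n - 1} = V - {u ?j}"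
    unfolding fun_upd_image using near_cycle_vertex[OF h] cycle_vertex_neq[OF h, of ?j] by auto
  moreover have "inj_on ?u {..<n - 1}" using u by (intro inj_on_fun_updI) auto
  moreover have "?u i \<in> c i \<and> ?u (nxt i) \<in> c i" if i: "i < n - 1" for i
  proof -
    have "nxt i = ?j \<Longrightarrow> i = p" using cyc_succ_inject[OF i p(1)] by simp
    then show ?thesis using cycle_edge_left[OF h i] cycle_edge_right[OF h i] p by auto
  qed
  ultimately show ?thesis
    unfolding near_cycle_def
    using near_cycle_inj[OF h] near_cycle_edges_subset[OF h] cycle_vertex_mem[OF h, of ?j]
    by (simp add: bij_betw_def)
qed

lemma path_near_cycle:
  assumes h: "ham_path v e" and f: "f \<in> insert (e 1) (free_edges e)" "v 2 \<in> f" "v n \<in> f"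
  shows "near_cycle (v 1) (\<lambda>i. v (i + 2)) (\<lambda>i. if i = n - 2 then f else e (i + 2))"
proof -
  let ?u = "\<lambda>i. v (i + 2)" and ?c = "\<lambda>i. if i = n - 2 then f else e (i + 2)"
  have n: "1 < n" "{..<n - 1} = insert (n - 2) {..<n - 2}" using four_le_n by auto
  have "bij_betw Suc {..<n - 1} {1..<n}"
    by (rule bij_betw_byWitness[where f' = "\<lambda>i. i - 1"]) (auto simp: One_nat_def)
  from bij_betw_trans[OF this bij_betw_after_start[OF h]]
  have "bij_betw ?u {..<n - 1} (V - {v 1})" by (simp add: comp_def)
  moreover have "inj_on ?c {..<n - 1}"
  proof -
    have "f \<noteq> e j" if "2 \<le> j" "j < n" for j
      using f(1) path_edge_not_free[of j e] path_edge_inject[OF h, of 1 j] that n by auto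
    then have "f \<noteq> e (i + 2)" if "i < n - 2" for i using that by simp
    moreover have "inj_on (\<lambda>i. e (i + 2)) {..<n - 2}"
      using path_edge_inject[OF h] by (auto simp: inj_on_def)
    ultimately show ?thesis unfolding n(2) by (auto simp: inj_on_def)
  qed
  moreover have "?c ` {..<n - 1} \<subseteq> E"
    using f(1) free_edge_mem path_edge_mem[OF h] n(1) by auto
  moreover have "?u i \<in> ?c i \<and> ?u (nxt i) \<in> ?c i" if i: "i < n - 1" for i
  proof (cases "i = n - 2")
    case True
    then have "nxt i = 0" "n - 2 + 2 = n" using i by (auto simp: cyc_succ_eq)
    then show ?thesis using True f by (simp add: numeral_2_eq_2)
  next
    case False
    then have "nxt i = Suc i" using i by (simp add: cyc_succ_eq)
    then show ?thesis using path_edge_left[OF h, of "i + 2"] path_edge_right[OF h, of "i + 2"] i False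
      by auto
  qed
  ultimately show ?thesis unfolding near_cycle_def using start_mem[OF h] by blast
qed

text \<open>Cutting the cycle edge at position \<open>i\<close> gives the path $w, u_{i+1}, u_{i+2}, \ldots, u_i$ whose
first edge is \<open>l\<close>.\<close>

definition cut_pos :: "nat \<Rightarrow> nat \<Rightarrow> nat" where
  "cut_pos i j = (i + (j - 1)) mod (n - 1)"

definition cut_verts :: "nat \<Rightarrow> 'a \<Rightarrow> (nat \<Rightarrow> 'a) \<Rightarrow> nat \<Rightarrow> 'a" where
  "cut_verts i w u = (\<lambda>j. if j = 1 then w else u (cut_pos i j))"

definition cut_edges :: "nat \<Rightarrow> 'a set \<Rightarrow> (nat \<Rightarrow> 'a set) \<Rightarrow> nat \<Rightarrow> 'a set" where
  "cut_edges i l c = (\<lambda>j. if j = 1 then l else c (cut_pos i j))"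

lemma bij_betw_cut_pos: "bij_betw (cut_pos i) {2..n} {..<n - 1}"
proof -
  have "bij_betw (\<lambda>j. j - 1) {2..n} {1..<1 + (n - 1)}"
    by (rule bij_betw_byWitness[where f' = Suc]) (use four_le_n in auto)
  from bij_betw_trans[OF this bij_betw_mod_shift] show ?thesis
    using four_le_n by (simp add: comp_def cut_pos_def[abs_def])
qed

lemma cut_pos_less: "cut_pos i j < n - 1"
  using four_le_n by (simp add: cut_pos_def)

lemma cut_pos_end: "i < n - 1 \<Longrightarrow> cut_pos i n = i"
  by (simp only: cut_pos_def mod_add_self2 mod_less)

lemma nxt_cut_pos: "1 \<le> j \<Longrightarrow> nxt (cut_pos i j) = cut_pos i (Suc j)"
  by (simp add: cut_pos_def cyc_succ_mod)

lemma cut_posE: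
  assumes "i < n - 1" "j < n - 1" "j \<noteq> i"
  obtains p where "2 \<le> p" "p < n" "cut_pos i p = j"
proof -
  have "j \<in> cut_pos i ` {2..n}" using bij_betw_cut_pos[of i] assms(2) by (simp add: bij_betw_def)
  then obtain p where p: "2 \<le> p" "p \<le> n" "cut_pos i p = j" by auto
  moreover have "p \<noteq> n" using p(3) assms cut_pos_end by auto
  ultimately show thesis using that by simp
qed

lemma cut_verts_simps:
  "cut_verts i w u 1 = w" "2 \<le> j \<Longrightarrow> cut_verts i w u j = u (cut_pos i j)"
  and cut_edges_simps:
  "cut_edges i l c 1 = l" "2 \<le> j \<Longrightarrow> cut_edges i l c j = c (cut_pos i j)"
  by (auto simp: cut_verts_def cut_edges_def)

lemma cut_verts_end: "i < n - 1 \<Longrightarrow> cut_verts i w u n = u i"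
  using four_le_n by (simp add: cut_verts_simps cut_pos_end)

lemma cut_edges_image:
  assumes "i < n - 1" "near_cycle w u c"
  shows "cut_edges i l c ` {1..<n} = insert l (c ` {..<n - 1} - {c i})"
proof -
  have n: "{1..<n} = insert 1 {2..<n}" "{2..<n} = {2..n} - {n}" using assms(1) by auto
  have "cut_edges i l c ` {2..<n} = c ` cut_pos i ` {2..<n}"
    unfolding image_image by (rule image_cong) (auto simp: cut_edges_simps)
  also have "cut_pos i ` {2..<n} = {..<n - 1} - {i}"
    unfolding n(2) using bij_betw_cut_pos[of i] cut_pos_end[OF assms(1)] assms(1)
    by (subst inj_on_image_set_diff[of _ "{2..n}"]) (auto simp: bij_betw_def)
  also have "c ` ({..<n - 1} - {i}) = c ` {..<n - 1} - {c i}"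
    using inj_on_image_set_diff[OF near_cycle_inj[OF assms(2)], of "{..<n - 1}" "{i}"] assms(1) by simp
  finally show ?thesis unfolding n(1) by (simp add: cut_edges_simps)
qed

lemma cut_verts_bij:
  assumes "near_cycle w u c"
  shows "bij_betw (cut_verts i w u) {1..n} V"
proof -
  have n: "{1..n} = insert 1 {2..n}" using four_le_n by auto
  have "cut_verts i w u ` {2..n} = u ` cut_pos i ` {2..n}"
    unfolding image_image by (rule image_cong) (auto simp: cut_verts_simps)
  also have "\<dots> = V - {w}"
    using bij_betw_cut_pos[of i] near_cycle_bij[OF assms] by (simp add: bij_betw_def)
  finally have "cut_verts i w u ` {1..n} = V"
    unfolding n image_insert cut_verts_simps(1) using near_cycle_vertex[OF assms] by auto
  then show ?thesis
    using eq_card_imp_inj_on[of "{1..n}" "cut_verts i w u"] card_V by (simp add: bij_betw_def)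
qed

lemma near_cycle_cut:
  assumes h: "near_cycle w u c" and i: "i < n - 1"
    and l: "l \<in> insert (c i) (off_cycle c)" "w \<in> l" "u (nxt i) \<in> l"
  shows "ham_path (cut_verts i w u) (cut_edges i l c)"
    "free_edges (cut_edges i l c) = insert (c i) (off_cycle c) - {l}"
proof -
  let ?v = "cut_verts i w u" and ?e = "cut_edges i l c"
  have l_new: "l \<notin> c ` {..<n - 1} - {c i}" and l_mem: "l \<in> E"
    using l(1) cycle_edge_mem[OF h i] by (auto simp: off_cycle_def)
  have image: "?e ` {1..<n} = insert l (c ` {..<n - 1} - {c i})" by (rule cut_edges_image[OF i h])
  have "card (?e ` {1..<n}) = n - 1"
    unfolding image using l_new i near_cycle_inj[OF h]
    by (simp add: card_Diff_singleton card_image)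
  then have inj: "inj_on ?e {1..<n}" by (intro eq_card_imp_inj_on) auto
  have "?v j \<in> ?e j \<and> ?v (Suc j) \<in> ?e j" if j: "1 \<le> j" "j < n" for j
  proof (cases "j = 1")
    case True
    have "cut_pos i 2 = nxt i" by (simp add: cut_pos_def cyc_succ_def One_nat_def)
    then show ?thesis
      using True l cut_verts_simps(2)[of 2] by (simp add: cut_verts_simps(1) cut_edges_simps)
  next
    case False
    then show ?thesis
      using cycle_edge_left[OF h cut_pos_less[of i j]] cycle_edge_right[OF h cut_pos_less[of i j]] j
      by (simp add: cut_verts_simps cut_edges_simps nxt_cut_pos)
  qed
  then show "ham_path ?v ?e"
    unfolding ham_path_def
    using cut_verts_bij[OF h] inj image l_mem near_cycle_edges_subset[OF h] by auto
  show "free_edges ?e = insert (c i) (off_cycle c) - {l}"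
    unfolding free_edges_def image off_cycle_def using cycle_edge_mem[OF h i] i by auto
qed

end

context nonhamiltonian_hg
begin

lemma no_insertion:
  assumes h: "near_cycle w u c" and i: "i < n - 1"
    and l: "l \<in> insert (c i) (off_cycle c)" "w \<in> l" "u (nxt i) \<in> l"
    and k: "k \<in> insert (c i) (off_cycle c)" "k \<noteq> l" "w \<in> k" "u i \<in> k"
  shows False
proof -
  have "k \<in> free_edges (cut_edges i l c)" using near_cycle_cut(2)[OF h i l] k(1,2) by simp
  from no_closing_edge[OF near_cycle_cut(1)[OF h i l] this] show False
    using k(3,4) cut_verts_end[OF i] by (simp add: cut_verts_simps)
qed

text \<open>The cycle opened by the links $w u_{i+1}$ and $w u_{j+1}$ is closed again by a chord $u_i u_j$.\<close>

lemma linked_succs_no_chord: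
  assumes h: "near_cycle w u c" and ij: "i < n - 1" "j < n - 1" "j \<noteq> i"
    and l: "l \<in> insert (c i) (off_cycle c)" "w \<in> l" "u (nxt i) \<in> l"
    and m: "m \<in> insert (c j) (off_cycle c)" "w \<in> m" "u (nxt j) \<in> m" "m \<noteq> l"
    and k: "k \<in> insert (c i) (insert (c j) (off_cycle c))" "k \<noteq> l" "k \<noteq> m" "u i \<in> k" "u j \<in> k"
  shows False
proof -
  let ?v = "cut_verts i w u" and ?e = "cut_edges i l c"
  note path = near_cycle_cut[OF h ij(1) l]
  obtain p where p: "2 \<le> p" "p < n" "cut_pos i p = j" using cut_posE[OF ij] .
  then have at_p: "?v p = u j" "?v (Suc p) = u (nxt j)" "?e p = c j"
    by (auto simp: cut_verts_simps cut_edges_simps simp flip: nxt_cut_pos)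
  have rot: "rotation p m ?v ?e"
    using m p at_p unfolding rotation_def path(2) by (auto simp: cut_verts_simps)
  have "k \<in> free_edges (rotate_edges p m ?e)"
    using k(1-3) unfolding free_edges_rotate[OF path(1) rot] path(2) at_p(3) by auto
  from no_closing_edge[OF ham_path_rotate[OF path(1) rot] this] show False
    using k(4,5) at_p(1) p(1) rotation_end[OF rot] cut_verts_end[OF ij(1)]
    by (simp add: rotate_verts_start)
qed

lemma linked_no_succs_chord:
  assumes h: "near_cycle w u c" and ij: "i < n - 1" "j < n - 1" "j \<noteq> i"
    and l: "l \<in> insert (c i) (off_cycle c)" "w \<in> l" "u i \<in> l"
    and m: "m \<in> insert (c j) (off_cycle c)" "w \<in> m" "u j \<in> m" "m \<noteq> l"
    and k: "k \<in> insert (c i) (insert (c j) (off_cycle c))" "k \<noteq> l" "k \<noteq> m"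
      "u (nxt i) \<in> k" "u (nxt j) \<in> k"
  shows False
proof -
  define s where "s = (\<lambda>i. if i = 0 then 0 else n - 1 - i)"
  define s' where "s' = (\<lambda>i. n - 2 - i)"
  have s: "s (nxt i) = s' i" "nxt (s' i) = s i" "s (s i) = i" "s' (s' i) = i" "s i < n - 1"
    "s' i < n - 1"
    if "i < n - 1" for i
    using that by (auto simp: s_def s'_def cyc_succ_eq)
  have bij: "bij_betw s {..<n - 1} {..<n - 1}" "bij_betw s' {..<n - 1} {..<n - 1}"
    by (rule bij_betw_byWitness[where f' = s], use s in auto)
       (rule bij_betw_byWitness[where f' = s'], use s in auto)
  have mirror: "near_cycle w (u \<circ> s) (c \<circ> s')" "off_cycle (c \<circ> s') = off_cycle c"
    by (rule near_cycle_reindex[OF h bij]; use s in auto)+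
  have at: "(u \<circ> s) (s' i) = u (nxt i)" "(u \<circ> s) (nxt (s' i)) = u i" "(c \<circ> s') (s' i) = c i"
    if "i < n - 1" for i
    using s[OF that] s(3)[of "nxt i"] by auto
  have "s' j \<noteq> s' i" using s(4) ij by metis
  from linked_succs_no_chord[OF mirror(1) s(6)[OF ij(1)] s(6)[OF ij(2)] this] show False
    unfolding mirror(2) at[OF ij(1)] at[OF ij(2)] using l m k by blast
qed

lemma incident_not_nbr:
  assumes h: "near_cycle w u c" and i: "i \<in> incident_edges w c"
  shows "i \<notin> nbr_positions w u c" "nxt i \<notin> nbr_positions w u c"
proof -
  have i': "i < n - 1" "w \<in> c i" using i by (auto simp: incident_edges_def)
  have ends: "u i \<in> c i" "u (nxt i) \<in> c i"
    using cycle_edge_left[OF h i'(1)] cycle_edge_right[OF h i'(1)] by simp_all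
  have new: "f \<noteq> c i" if "f \<in> off_cycle c" for f using that cycle_edge_not_off[OF i'(1)] by blast
  show "i \<notin> nbr_positions w u c" "nxt i \<notin> nbr_positions w u c"
    using no_insertion[OF h i'(1), of "c i"] no_insertion[OF h i'(1) _ _ _, of _ "c i"] new ends i'(2)
    by (fastforce simp: nbr_positions_def)+
qed

lemma incident_disjoint_with_preds:
  "near_cycle w u c \<Longrightarrow> A \<subseteq> nbr_positions w u c \<Longrightarrow> incident_edges w c \<inter> with_preds A = {}"
  using incident_not_nbr[of w u c] by (auto simp: pred_closure_def cyc_preds_def)

lemma off_cycle_separated:
  assumes "near_cycle w u c" "f \<in> off_cycle c" "w \<in> f" "g \<in> off_cycle c" "w \<in> g" "f \<noteq> g"
    and "i \<in> positions u f"
  shows "nxt i \<notin> positions u g"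
  using no_insertion[OF assms(1), of i g f] assms(2-7) by (auto simp: positions_def)

lemma card_positions_Int_incident_le:
  assumes h: "near_cycle w u c" and k: "k \<in> off_cycle c" "w \<notin> k"
  shows "card (positions u k \<inter> incident_edges w c) \<le> 1"
    "card (positions u k \<inter> nxt ` incident_edges w c) \<le> 1"
proof -
  have "c i = c j \<Longrightarrow> i = j" if "i \<in> incident_edges w c" "j \<in> incident_edges w c" for i j
    using cycle_edge_inject[OF h, of i j] that by (simp add: incident_edges_def)
  then have unique: "i = j" if "i \<in> incident_edges w c" "j \<in> incident_edges w c"
      "u i \<in> k \<and> u j \<in> k \<or> u (nxt i) \<in> k \<and> u (nxt j) \<in> k" for i j
    using linked_succs_no_chord[OF h, of i j "c i" "c j" k]
      linked_no_succs_chord[OF h, of i j "c i" "c j" k] that k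
      cycle_edge_left[OF h] cycle_edge_right[OF h] by (auto simp: incident_edges_def)
  show "card (positions u k \<inter> incident_edges w c) \<le> 1"
    by (rule card_le_1I) (use unique in \<open>auto simp: positions_def\<close>)
  show "card (positions u k \<inter> nxt ` incident_edges w c) \<le> 1"
    by (rule card_le_1I) (use unique in \<open>auto simp: positions_def\<close>)
qed

lemma positions_incident_nbr:
  assumes h: "near_cycle w u c" and f: "f \<in> off_cycle c" "w \<in> f" and k: "k \<in> off_cycle c" "w \<notin> k"
    and i: "i \<in> incident_edges w c"
  shows "i \<in> positions u k \<Longrightarrow> positions u k \<inter> preds (positions u f) = {}"
    "nxt i \<in> positions u k \<Longrightarrow> positions u k \<inter> nxt ` positions u f = {}"
proof -
  have i': "i < n - 1" "w \<in> c i" using i by (auto simp: incident_edges_def)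
  have ne: "f \<noteq> c i" "k \<noteq> c i" "k \<noteq> f" using f k i' cycle_edge_not_off[OF i'(1)] by auto
  note nbr = incident_not_nbr[OF h i] positions_subset_nbr[OF f]
  show "positions u k \<inter> preds (positions u f) = {}" if i_k: "i \<in> positions u k"
  proof -
    have "j \<notin> positions u k" if j: "j < n - 1" "nxt j \<in> positions u f" for j
    proof
      assume "j \<in> positions u k"
      moreover have "j \<noteq> i" using nbr j(2) by blast
      ultimately show False
        using linked_succs_no_chord[OF h i'(1) j(1), of "c i" f k] i_k j(2) i'(2) f k ne
          cycle_edge_right[OF h i'(1)] by (simp add: positions_def)
    qed
    then show ?thesis by (auto simp: cyc_preds_def)
  qed
  show "positions u k \<inter> nxt ` positions u f = {}" if i_k: "nxt i \<in> positions u k"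
  proof -
    have "nxt j \<notin> positions u k" if j: "j \<in> positions u f" for j
    proof
      assume "nxt j \<in> positions u k"
      moreover have "j \<noteq> i" using nbr j by blast
      ultimately show False
        using linked_no_succs_chord[OF h i'(1), of j "c i" f k] i_k j i'(2) f k ne
          cycle_edge_left[OF h i'(1)] by (simp add: positions_def)
    qed
    then show ?thesis by auto
  qed
qed

end

section \<open>A missed vertex on two off-cycle edges\<close>

locale dirac_hg = nonhamiltonian_hg +
  fixes t :: nat
  assumes r_le_t: "r \<le> t" and n_eq: "n = 2 * t + 1 \<or> n = 2 * t + 2"
    and degree_gt: "x \<in> V \<Longrightarrow> t choose (r - 1) < hdegree E x"
begin

lemma three_le_t: "3 \<le> t"
  using three_le_r r_le_t by simp

lemma n_bounds: "2 * t \<le> n - 1" "n - 1 \<le> 2 * t + 1"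
  using n_eq by auto

lemma t_le_binomial: "t \<le> t choose (r - 1)"
  using three_le_r r_le_t by (intro le_binomial) auto

lemma binomial_eq_t: "r = t \<Longrightarrow> t choose (r - 1) = t"
  using three_le_t binomial_Suc_n[of "t - 1"] by simp

lemma two_t_le_binomial: "r < t \<Longrightarrow> 2 * t \<le> (t choose (r - 1)) + 2"
  using three_le_r by (intro two_mult_le_binomial) auto

lemma binomial_add_le:
  assumes "r - 1 \<le> m" "m \<le> t"
  shows "(m choose (r - 1)) + (t - m) * m \<le> t choose (r - 1)"
proof -
  have r: "r - 1 = Suc (r - 2)" and "m \<le> m choose (r - 2)"
    using three_le_r assms(1) le_binomial[of "r - 2" m] by auto
  then show ?thesis
    using binomial_add_mult_le[OF assms(2), of "r - 2"] mult_le_mono2[of m "m choose (r - 2)" "t - m"]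
    unfolding r by linarith
qed

definition loose_edges :: "'a \<Rightarrow> (nat \<Rightarrow> 'a) \<Rightarrow> (nat \<Rightarrow> 'a set) \<Rightarrow> 'a set set" where
  "loose_edges w u c = {f \<in> off_cycle c. w \<in> f \<and> (\<forall>i\<in>positions u f. nxt i \<notin> positions u f)}"

definition clustered_edges :: "'a \<Rightarrow> (nat \<Rightarrow> 'a) \<Rightarrow> (nat \<Rightarrow> 'a set) \<Rightarrow> 'a set set" where
  "clustered_edges w u c = {f \<in> off_cycle c. w \<in> f \<and> (\<exists>i\<in>positions u f. nxt i \<in> positions u f)}"

lemma finite_loose_clustered [simp]:
  "finite (loose_edges w u c)" "finite (clustered_edges w u c)"
  by (simp_all add: loose_edges_def clustered_edges_def)

lemma hdegree_off_cycle_eq: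
  "hdegree (off_cycle c) w = card (loose_edges w u c) + card (clustered_edges w u c)"
proof -
  have "{f \<in> off_cycle c. w \<in> f} = loose_edges w u c \<union> clustered_edges w u c"
    by (auto simp: loose_edges_def clustered_edges_def)
  moreover have "loose_edges w u c \<inter> clustered_edges w u c = {}"
    by (auto simp: loose_edges_def clustered_edges_def)
  ultimately show ?thesis by (simp add: hdegree_def card_Un_disjoint)
qed

lemma card_incident_add_closure_le:
  assumes h: "near_cycle w u c" and H: "H \<subseteq> clustered_edges w u c"
    and K: "K \<subseteq> {f \<in> off_cycle c. w \<in> f}" "H \<inter> K = {}"
  shows "card (incident_edges w c) + (card (with_preds (\<Union>f\<in>K. positions u f)) + 3 * card H) \<le> n - 1"
proof -
  let ?N = "nbr_positions w u c"
  have "card (with_preds (\<Union>f\<in>K. positions u f)) + 3 * card H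
      \<le> card (with_preds (\<Union>f\<in>{f \<in> off_cycle c. w \<in> f}. positions u f))"
  proof (rule card_pred_closure_UN_ge)
    show "3 \<le> n - 1" using four_le_n by simp
    show "H \<subseteq> {f \<in> off_cycle c. w \<in> f}" "finite H"
      using H finite_subset[OF H] by (auto simp: clustered_edges_def)
    show "nxt i \<notin> positions u g"
      if "f \<in> {f \<in> off_cycle c. w \<in> f}" "g \<in> {f \<in> off_cycle c. w \<in> f}" "f \<noteq> g" "i \<in> positions u f"
        for f g i
      using off_cycle_separated[OF h] that by blast
  qed (use positions_subset K H in \<open>auto simp: clustered_edges_def\<close>)
  then have "card (with_preds (\<Union>f\<in>K. positions u f)) + 3 * card H \<le> card (with_preds ?N)"
    unfolding nbr_positions_eq_UN .
  moreover have "card (incident_edges w c \<union> with_preds ?N) \<le> card {..<n - 1}"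
    using incident_edges_subset pred_closure_subset[OF nbr_positions_subset] by (intro card_mono) auto
  moreover have "card (incident_edges w c \<union> with_preds ?N)
      = card (incident_edges w c) + card (with_preds ?N)"
    using incident_disjoint_with_preds[OF h order_refl] finite_pred_closure[OF nbr_positions_subset]
    by (intro card_Un_disjoint) auto
  ultimately show ?thesis by simp
qed

lemma loose_edges_nonempty:
  assumes h: "near_cycle w u c" and two: "2 \<le> hdegree (off_cycle c) w"
  shows "loose_edges w u c \<noteq> {}"
proof
  assume empty: "loose_edges w u c = {}"
  let ?G = "clustered_edges w u c"
  have G: "2 \<le> card ?G" "hdegree (off_cycle c) w = card ?G"
    using two empty by (simp_all add: hdegree_off_cycle_eq[of c w u])
  then have "?G \<noteq> {}" by auto
  then obtain f where f: "f \<in> ?G" by blast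
  then have fw: "f \<in> off_cycle c" "w \<in> f" by (auto simp: clustered_edges_def)
  have card_f: "card (positions u f) = r - 1"
    using card_positions[OF h off_cycle_mem[OF fw(1)]] fw(2) by simp
  then have "card (positions u f) \<noteq> 0" "card (positions u f) \<noteq> card {..<n - 1}"
    using three_le_r r_less_n by auto
  then have "positions u f \<noteq> {}" "positions u f \<noteq> {..<n - 1}" by (metis card.empty)+
  from card_pred_closure_gt[OF positions_subset this]
  have "r \<le> card (with_preds (positions u f))" using card_f by simp
  moreover have "card (incident_edges w c)
      + (card (with_preds (\<Union>f\<in>{f}. positions u f)) + 3 * card (?G - {f})) \<le> n - 1"
    by (rule card_incident_add_closure_le[OF h]) (use fw in auto)
  moreover have "card (?G - {f}) = card ?G - 1" using f by (simp add: card_Diff_singleton)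
  moreover have "t choose (r - 1) < card ?G + card (incident_edges w c)"
    using degree_gt[OF near_cycle_vertex[OF h]] G(2) by (simp add: hdegree_eq_off_incident[OF h])
  ultimately have "(t choose (r - 1)) + r < 2 * t" using G(1) n_bounds by simp
  then show False using binomial_eq_t two_t_le_binomial r_le_t three_le_r by (cases "r = t") simp_all
qed

lemma card_loose_le:
  assumes h: "near_cycle w u c"
  defines "L \<equiv> \<Union>f\<in>loose_edges w u c. positions u f"
  shows "card (loose_edges w u c) \<le> card L choose (r - 1)"
proof -
  have L: "L \<subseteq> {..<n - 1}" unfolding L_def using positions_subset by blast
  have "card (loose_edges w u c) = hdegree (loose_edges w u c) w"
    unfolding hdegree_def by (rule arg_cong[where f = card]) (auto simp: loose_edges_def)
  also have "\<dots> \<le> card (u ` L) choose (r - 1)"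
  proof (rule hdegree_le_binomial)
    show "finite (u ` L)" using L finite_subset by blast
    show "loose_edges w u c \<subseteq> E" using off_cycle_mem by (auto simp: loose_edges_def)
    show "f - {w} \<subseteq> u ` L" if "f \<in> loose_edges w u c" for f
    proof -
      have "f - {w} = u ` positions u f"
        using image_positions[OF h, of f] off_cycle_mem[of f c] that by (simp add: loose_edges_def)
      moreover have "positions u f \<subseteq> L" using that by (auto simp: L_def)
      ultimately show ?thesis by blast
    qed
  qed
  also have "card (u ` L) = card L" by (rule card_position_image[OF h L])
  finally show ?thesis .
qed

lemma card_with_preds_loose:
  assumes h: "near_cycle w u c"
  defines "L \<equiv> \<Union>f\<in>loose_edges w u c. positions u f"
  shows "\<And>i. i \<in> L \<Longrightarrow> nxt i \<notin> L" "card (with_preds L) = 2 * card L"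
proof -
  show separated: "nxt i \<notin> L" if i: "i \<in> L" for i
  proof
    assume "nxt i \<in> L"
    then obtain f g where fg: "f \<in> loose_edges w u c" "g \<in> loose_edges w u c" "i \<in> positions u f"
      "nxt i \<in> positions u g"
      using i by (auto simp: L_def)
    then show False
      using off_cycle_separated[OF h, of f g i] by (cases "f = g") (auto simp: loose_edges_def)
  qed
  have "L \<subseteq> {..<n - 1}" unfolding L_def using positions_subset by blast
  then show "card (with_preds L) = 2 * card L" using separated by (rule card_pred_closure_independent)
qed

lemma two_off_cycle_edges_tight:
  assumes h: "near_cycle w u c" and two: "2 \<le> hdegree (off_cycle c) w"
  shows "n = 2 * t + 2" "card (nbr_positions w u c) = t"
    "\<And>i. i \<in> nbr_positions w u c \<Longrightarrow> nxt i \<notin> nbr_positions w u c"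
    "card (incident_edges w c) = 1" "hdegree (off_cycle c) w = t choose (r - 1)"
proof -
  let ?L = "\<Union>f\<in>loose_edges w u c. positions u f" and ?G = "clustered_edges w u c"
  let ?b = "card (incident_edges w c)"
  have fin: "finite ?L" by simp
  obtain f where f: "f \<in> loose_edges w u c" using loose_edges_nonempty[OF assms] by blast
  then have "card (positions u f) = r - 1"
    using card_positions[OF h, of f] off_cycle_mem by (auto simp: loose_edges_def)
  then have L_ge: "r - 1 \<le> card ?L" using card_mono[OF fin, of "positions u f"] f by auto
  have count: "?b + (2 * card ?L + 3 * card ?G) \<le> n - 1"
    unfolding card_with_preds_loose(2)[OF h, symmetric]
    by (rule card_incident_add_closure_le[OF h]) (auto simp: loose_edges_def clustered_edges_def)
  have degree: "t choose (r - 1) < card (loose_edges w u c) + card ?G + ?b"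
    using degree_gt[OF near_cycle_vertex[OF h]]
    by (simp add: hdegree_eq_off_incident[OF h] hdegree_off_cycle_eq[of c w u])
  have loose: "card (loose_edges w u c) \<le> card ?L choose (r - 1)" by (rule card_loose_le[OF h])
  have L_le: "card ?L \<le> t" using count n_bounds by simp
  have gap: "(card ?L choose (r - 1)) + (t - card ?L) * card ?L \<le> t choose (r - 1)"
    by (rule binomial_add_le[OF L_ge L_le])
  have "(t - card ?L) * 2 \<le> (t - card ?L) * card ?L" using L_ge three_le_r by (intro mult_le_mono2) simp
  then have G_empty: "card ?G = 0" using gap loose degree count n_bounds L_le by linarith
  then have "2 \<le> card ?L choose (r - 1)" using two loose by (simp add: hdegree_off_cycle_eq[of c w u])
  then have "card ?L \<noteq> r - 1" by auto
  then have "(t - card ?L) * 3 \<le> (t - card ?L) * card ?L"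
    using L_ge three_le_r by (intro mult_le_mono2) simp
  then have L_eq: "card ?L = t" using gap loose degree count n_bounds L_le G_empty by linarith
  have "?G = {}" using G_empty by simp
  then have "{f \<in> off_cycle c. w \<in> f} = loose_edges w u c"
    by (auto simp: loose_edges_def clustered_edges_def)
  then have nbr: "nbr_positions w u c = ?L" by (simp add: nbr_positions_eq_UN)
  show "n = 2 * t + 2" "?b = 1" "hdegree (off_cycle c) w = t choose (r - 1)"
    using degree loose count G_empty L_eq n_eq by (auto simp: hdegree_off_cycle_eq[of c w u])
  show "card (nbr_positions w u c) = t" using nbr L_eq by simp
  show "\<And>i. i \<in> nbr_positions w u c \<Longrightarrow> nxt i \<notin> nbr_positions w u c"
    unfolding nbr by (rule card_with_preds_loose(1)[OF h])
qed

end

text \<open>The neighbours of \<open>w\<close> alternate along the cycle except at the single cycle edge \<open>\<beta>\<close> through \<open>w\<close>,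
and every set of $r - 1$ of them forms an edge with \<open>w\<close>. Hence no edge but $c_\beta$ contains two other
vertices, and one of these has too small a degree.\<close>

locale tight_near_cycle = dirac_hg +
  fixes w :: 'a and u :: "nat \<Rightarrow> 'a" and c :: "nat \<Rightarrow> 'a set" and \<beta> :: nat
  assumes near: "near_cycle w u c" and n_even: "n = 2 * t + 2"
    and card_nbr: "card (nbr_positions w u c) = t"
    and nbr_separated: "i \<in> nbr_positions w u c \<Longrightarrow> nxt i \<notin> nbr_positions w u c"
    and incident: "incident_edges w c = {\<beta>}"
    and degree_off: "hdegree (off_cycle c) w = t choose (r - 1)"
begin

abbreviation N :: "nat set" where
  "N \<equiv> nbr_positions w u c"

lemma \<beta>_less: "\<beta> < n - 1" and w_in_\<beta>: "w \<in> c \<beta>"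
  using incident by (auto simp: incident_edges_def)

lemma incident_iff: "i < n - 1 \<Longrightarrow> w \<in> c i \<longleftrightarrow> i = \<beta>"
  using incident by (auto simp: incident_edges_def)

lemma card_image_nbr: "card (u ` N) = t"
  using card_position_image[OF near nbr_positions_subset] card_nbr by simp

lemma with_preds_cover: "insert \<beta> (with_preds N) = {..<n - 1}"
proof (rule card_subset_eq)
  have "\<beta> \<notin> with_preds N" using incident_disjoint_with_preds[OF near order_refl] incident by auto
  then have "card (insert \<beta> (with_preds N)) = 2 * t + 1"
    using card_pred_closure_independent[OF nbr_positions_subset nbr_separated] card_nbr
      finite_pred_closure[OF nbr_positions_subset] by simp
  then show "card (insert \<beta> (with_preds N)) = card {..<n - 1}" using n_even by simp
  show "insert \<beta> (with_preds N) \<subseteq> {..<n - 1}"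
    using \<beta>_less pred_closure_subset[OF nbr_positions_subset] by simp
qed simp

lemma nxt_in_nbr: "i < n - 1 \<Longrightarrow> i \<notin> N \<Longrightarrow> i \<noteq> \<beta> \<Longrightarrow> nxt i \<in> N"
  using with_preds_cover by (auto simp: pred_closure_def cyc_preds_def)

lemma pred_in_nbr:
  assumes "i < n - 1" "i \<notin> N"
  obtains j where "j < n - 1" "nxt j = i" "j \<in> N \<or> j = \<beta>"
  using ex_cyc_pred[OF assms(1)] nxt_in_nbr assms(2) by metis

lemma ex_off_cycle_edge:
  assumes "p \<in> N"
  obtains f where "f \<in> off_cycle c" "w \<in> f" "u p \<in> f"
  using assms by (auto simp: nbr_positions_def)

lemma ex_off_cycle_edge_avoiding:
  assumes p: "p \<in> N" and q: "q \<in> N" "p \<noteq> q"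
  obtains f where "f \<in> off_cycle c" "w \<in> f" "u p \<in> f" "u q \<notin> f"
proof -
  have N: "N \<subseteq> {..<n - 1}" by (rule nbr_positions_subset)
  have "card (N - {p, q}) = t - 2" using p q card_nbr by (simp add: card_Diff_subset)
  then have "r - 2 \<le> card (N - {p, q})" using r_le_t by simp
  then obtain A where A: "A \<subseteq> N - {p, q}" "card A = r - 2" "finite A"
    by (rule obtain_subset_with_card_n)
  have "insert p A \<subseteq> {..<n - 1}" "p \<notin> A" using A p N by auto
  then have card: "card (u ` insert p A) = r - 1"
    using card_position_image[OF near \<open>insert p A \<subseteq> _\<close>] A three_le_r by simp
  have "insert w (u ` insert p A) \<in> off_cycle c"
  proof (rule star_complete[OF off_cycle_subset])
    show "card (u ` N) choose (r - 1) \<le> hdegree (off_cycle c) w"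
      using degree_off card_image_nbr by simp
    show "u ` insert p A \<subseteq> u ` N" using A p by blast
    show "f - {w} \<subseteq> u ` N" if "f \<in> off_cycle c" "w \<in> f" for f
      using image_positions[OF near off_cycle_mem[OF that(1)]] positions_subset_nbr[OF that] by blast
  qed (use card in auto)
  moreover have "u q \<notin> u ` insert p A"
    using position_mem_image_iff[OF near, of q "insert p A"] \<open>insert p A \<subseteq> {..<n - 1}\<close> A q N by auto
  moreover have "u q \<noteq> w" using cycle_vertex_neq[OF near, of q] q N by auto
  ultimately show thesis using that by simp
qed

lemma distinct_links:
  assumes "i < n - 1" "j < n - 1" "i \<noteq> j" "i' \<noteq> j'"
    and "if i = \<beta> then u i' \<in> c \<beta> else i' \<in> N" "if j = \<beta> then u j' \<in> c \<beta> else j' \<in> N"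
  obtains l m where "l \<in> insert (c i) (off_cycle c)" "w \<in> l" "u i' \<in> l"
    "m \<in> insert (c j) (off_cycle c)" "w \<in> m" "u j' \<in> m" "m \<noteq> l"
proof -
  have new: "f \<noteq> c \<beta>" if "f \<in> off_cycle c" for f using that cycle_edge_not_off[OF \<beta>_less] by blast
  consider "i = \<beta>" | "j = \<beta>" | "i \<noteq> \<beta>" "j \<noteq> \<beta>" by blast
  then show thesis
  proof cases
    case 1
    then have "j' \<in> N" "u i' \<in> c \<beta>" using assms(3,5,6) by auto
    then obtain m where "m \<in> off_cycle c" "w \<in> m" "u j' \<in> m" using ex_off_cycle_edge by blast
    then show thesis using that[of "c \<beta>" m] 1 new w_in_\<beta> \<open>u i' \<in> c \<beta>\<close> by auto
  next
    case 2
    then have "i' \<in> N" "u j' \<in> c \<beta>" using assms(3,5,6) by auto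
    then obtain l where "l \<in> off_cycle c" "w \<in> l" "u i' \<in> l" using ex_off_cycle_edge by blast
    then show thesis using that[of l "c \<beta>"] 2 new w_in_\<beta> \<open>u j' \<in> c \<beta>\<close> by auto
  next
    case 3
    then have N: "i' \<in> N" "j' \<in> N" using assms(5,6) by auto
    obtain l where "l \<in> off_cycle c" "w \<in> l" "u i' \<in> l" "u j' \<notin> l"
      using ex_off_cycle_edge_avoiding[OF N assms(4)] .
    moreover obtain m where "m \<in> off_cycle c" "w \<in> m" "u j' \<in> m" using ex_off_cycle_edge[OF N(2)] .
    ultimately show thesis using that[of l m] by auto
  qed
qed

lemma no_chord_outside_nbr:
  assumes ij: "i < n - 1" "j < n - 1" "i \<noteq> j" "i \<notin> N" "j \<notin> N"
    and k: "k \<in> insert (c i) (insert (c j) (off_cycle c))" "w \<notin> k" "u i \<in> k" "u j \<in> k"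
  shows False
proof -
  have "nxt i \<noteq> nxt j" using ij cyc_succ_inject by simp
  have link: "if x = \<beta> then u (nxt x) \<in> c \<beta> else nxt x \<in> N" if "x < n - 1" "x \<notin> N" for x
    using nxt_in_nbr that cycle_edge_right[OF near] by auto
  obtain l m where "l \<in> insert (c i) (off_cycle c)" "w \<in> l" "u (nxt i) \<in> l"
    "m \<in> insert (c j) (off_cycle c)" "w \<in> m" "u (nxt j) \<in> m" "m \<noteq> l"
    using distinct_links[OF ij(1-3) \<open>nxt i \<noteq> nxt j\<close> link[OF ij(1,4)] link[OF ij(2,5)]] .
  then show False using linked_succs_no_chord[OF near ij(1,2), of l m k] ij(3) k by blast
qed

text \<open>The cycle edge at a position of \<open>N\<close> is covered by the mirror image of the previous lemma, since its
right end is the one outside \<open>N\<close>.\<close>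

lemma edge_meets_outside_once:
  assumes ij: "i < n - 1" "j < n - 1" "i \<noteq> j" "i \<notin> N" "j \<notin> N"
    and k: "k \<in> E" "k \<noteq> c \<beta>" "u i \<in> k" "u j \<in> k"
  shows False
  using k(1)
proof (cases rule: cycle_edge_cases[where c = c])
  case 1
  have "w \<notin> k" using 1 k(3) ij(1,4) by (auto simp: nbr_positions_def)
  then show False using no_chord_outside_nbr[OF ij] 1 k(3,4) by blast
next
  case (2 a)
  then have "a \<noteq> \<beta>" "w \<notin> k" using k(2) incident_iff by auto
  show False
  proof (cases "a \<in> N")
    case False
    obtain x where "x < n - 1" "x \<notin> N" "x \<noteq> a" "u x \<in> k" using ij k(3,4) by metis
    then show False
      using no_chord_outside_nbr[of a x k] 2 False \<open>w \<notin> k\<close> cycle_edge_left[OF near] by simp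
  next
    case True
    obtain x where x: "x < n - 1" "x \<notin> N" "x \<noteq> nxt a" "u x \<in> k" using ij k(3,4) by metis
    obtain p where p: "p < n - 1" "nxt p = x" "p \<in> N \<or> p = \<beta>" using pred_in_nbr[OF x(1,2)] .
    have "a \<noteq> p" using x(3) p(2) by auto
    have link: "if p = \<beta> then u p \<in> c \<beta> else p \<in> N" using p(3) cycle_edge_left[OF near \<beta>_less] by auto
    have "if a = \<beta> then u a \<in> c \<beta> else a \<in> N" using True \<open>a \<noteq> \<beta>\<close> by simp
    with link obtain l m where "l \<in> insert (c a) (off_cycle c)" "w \<in> l" "u a \<in> l"
      "m \<in> insert (c p) (off_cycle c)" "w \<in> m" "u p \<in> m" "m \<noteq> l"
      using distinct_links[OF 2(1) p(1) \<open>a \<noteq> p\<close> \<open>a \<noteq> p\<close>] by blast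
    moreover have "u (nxt a) \<in> k" using 2 cycle_edge_right[OF near] by simp
    ultimately show False
      using linked_no_succs_chord[OF near 2(1) p(1), of l m k] \<open>a \<noteq> p\<close> x p 2 \<open>w \<notin> k\<close> by blast
  qed
qed

lemma contradiction: False
proof -
  let ?R = "insert w (u ` ({..<n - 1} - N))"
  have "card ({..<n - 1} - N) = n - 1 - card N"
    using nbr_positions_subset by (simp add: card_Diff_subset)
  then have "card (u ` ({..<n - 1} - N)) = t + 1"
    unfolding card_position_image[OF near Diff_subset] using card_nbr n_even by linarith
  moreover have "w \<notin> u ` ({..<n - 1} - N)" using cycle_vertex_neq[OF near] by auto
  ultimately have "card ?R = t + 2" by simp
  moreover have "card (c \<beta>) = r" "finite (c \<beta>)"
    using card_edge finite_edge cycle_edge_mem[OF near \<beta>_less] by auto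
  ultimately have "\<not> ?R \<subseteq> c \<beta>" using card_mono[of "c \<beta>" ?R] r_le_t by auto
  then obtain i where i: "i < n - 1" "i \<notin> N" "u i \<notin> c \<beta>" using w_in_\<beta> by auto
  have "hdegree E (u i) \<le> card (u ` N) choose (r - 1)"
  proof (rule hdegree_le_binomial[OF order_refl])
    fix k assume k: "k \<in> E" "u i \<in> k"
    then have "k \<noteq> c \<beta>" using i(3) by blast
    have "w \<notin> k"
      using k(1)
    proof (cases rule: cycle_edge_cases[where c = c])
      case 1
      then show ?thesis using k(2) i(1,2) by (auto simp: nbr_positions_def)
    next
      case (2 a)
      then show ?thesis using incident_iff \<open>k \<noteq> c \<beta>\<close> by auto
    qed
    show "k - {u i} \<subseteq> u ` N"
    proof
      fix y assume y: "y \<in> k - {u i}"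
      then have "y \<in> V" "y \<noteq> w" using edge_subset[OF k(1)] \<open>w \<notin> k\<close> by auto
      then obtain j where j: "j < n - 1" "y = u j" using cycle_vertexE[OF near] by blast
      then show "y \<in> u ` N"
        using edge_meets_outside_once[OF i(1) j(1) _ i(2) _ k(1) \<open>k \<noteq> c \<beta>\<close> k(2)] y by auto
    qed
  qed simp
  then show False using degree_gt[OF cycle_vertex_mem[OF near i(1)]] card_image_nbr by simp
qed

end

context dirac_hg
begin

lemma hdegree_off_cycle_le_1:
  assumes "near_cycle w u c"
  shows "hdegree (off_cycle c) w \<le> 1"
proof (rule ccontr)
  assume "\<not> ?thesis"
  then have "2 \<le> hdegree (off_cycle c) w" by simp
  note tight = two_off_cycle_edges_tight[OF assms this]
  obtain \<beta> where \<beta>: "incident_edges w c = {\<beta>}" using card_1_singletonE[OF tight(4)] .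
  interpret tight_near_cycle V E n r t w u c \<beta>
    by unfold_locales (fact assms tight(1,2,3,5) \<beta>)+
  show False by (rule contradiction)
qed

end

section \<open>A missed vertex on at most one off-cycle edge\<close>

lemma card_add_le_card_Int:
  assumes "finite U" "A \<subseteq> U" "B \<subseteq> U"
  shows "card A + card B \<le> card U + card (A \<inter> B)"
proof -
  have "card A + card B = card (A \<union> B) + card (A \<inter> B)"
    using assms by (intro card_Un_Int) (auto intro: finite_subset)
  moreover have "card (A \<union> B) \<le> card U" using assms by (intro card_mono) auto
  ultimately show ?thesis by simp
qed

lemma Diff_subset_if_small_Int:
  assumes "finite U" "A \<subseteq> U" "S \<subseteq> U" "card U < card A + card S" "card (A \<inter> S) \<le> 1"
  shows "U - S \<subseteq> A"
proof -
  have "card A + card S = card (A \<union> S) + card (A \<inter> S)"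
    using assms(1-3) by (intro card_Un_Int) (auto intro: finite_subset)
  then have "A \<union> S = U" using assms by (intro card_seteq) auto
  then show ?thesis by blast
qed

context dirac_hg
begin

lemma card_E_gt: "n < card E"
  and card_E_ge: "r = t \<Longrightarrow> n + 3 \<le> card E"
proof -
  have "n * (t + 1) \<le> n * Suc (t choose (r - 1))" using t_le_binomial by (intro mult_le_mono2) simp
  also have "\<dots> \<le> (\<Sum>x\<in>V. hdegree E x)"
    using sum_bounded_below[of V "Suc (t choose (r - 1))" "hdegree E"] degree_gt card_V
    by (simp add: Suc_leI)
  also have "\<dots> = r * card E" by (rule sum_hdegree) simp
  also have "\<dots> \<le> t * card E" using r_le_t by simp
  finally have le: "n * (t + 1) \<le> t * card E" .
  have "t * n < n * (t + 1)" using four_le_n by (simp add: algebra_simps)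
  with le have "t * n < t * card E" by linarith
  then show "n < card E" by simp
  have "t * (n + 2) < n * (t + 1)" using n_eq by (auto simp: algebra_simps)
  with le have "t * (n + 2) < t * card E" by linarith
  then have "n + 2 < card E" by (rule mult_left_less_imp_less) simp
  then show "n + 3 \<le> card E" by simp
qed

lemma two_le_card_off_cycle: "near_cycle w u c \<Longrightarrow> 2 \<le> card (off_cycle c)"
  using card_off_cycle[of w u c] card_E_gt four_le_n by linarith

lemma four_le_card_off_cycle: "near_cycle w u c \<Longrightarrow> r = t \<Longrightarrow> 4 \<le> card (off_cycle c)"
  using card_off_cycle[of w u c] card_E_ge four_le_n by linarith

lemma isolated_iff: "hdegree (off_cycle c) w = 0 \<longleftrightarrow> (\<forall>k\<in>off_cycle c. w \<notin> k)"
  using hdegree_pos_iff[OF off_cycle_subset, of c w] by auto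

text \<open>Otherwise the positions of every off-cycle edge contain the complements of \<open>?B\<close> and of its
shift, and by counting they consist of these, so there is only one off-cycle edge.\<close>

lemma isolated_room:
  assumes h: "near_cycle w u c" and isolated: "hdegree (off_cycle c) w = 0"
  shows "card (incident_edges w c) + r \<le> n - 1"
proof (rule ccontr)
  let ?B = "incident_edges w c" and ?Z = "{..<n - 1}"
  let ?D = "?Z - (?B \<inter> nxt ` ?B)"
  assume "\<not> ?thesis"
  then have tight: "card ?Z < r + card ?B" by simp
  have B: "?B \<subseteq> ?Z" "nxt ` ?B \<subseteq> ?Z" "card (nxt ` ?B) = card ?B"
    using incident_edges_subset cyc_succ_image_subset card_cyc_succ_image by auto
  have off: "w \<notin> k" "k \<in> E" if "k \<in> off_cycle c" for k
    using isolated that off_cycle_mem by (auto simp: isolated_iff)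
  have J: "card (positions u k) = r" if "k \<in> off_cycle c" for k
    using card_positions[OF h off(2)[OF that]] off(1)[OF that] by simp
  have complement: "?D \<subseteq> positions u k" if k: "k \<in> off_cycle c" for k
  proof -
    note small = card_positions_Int_incident_le[OF h k off(1)[OF k]]
    have "?Z - ?B \<subseteq> positions u k"
      by (rule Diff_subset_if_small_Int[OF _ positions_subset B(1) _ small(1)])
        (use J[OF k] tight in simp_all)
    moreover have "?Z - nxt ` ?B \<subseteq> positions u k"
      by (rule Diff_subset_if_small_Int[OF _ positions_subset B(2) _ small(2)])
        (use J[OF k] B(3) tight in simp_all)
    ultimately show ?thesis by blast
  qed
  obtain k where k: "k \<in> off_cycle c" using two_le_card_off_cycle[OF h] by fastforce
  have le: "card ?B + r \<le> n"
    using card_add_le_card_Int[of ?Z ?B "positions u k"] B(1) positions_subset J[OF k]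
      card_positions_Int_incident_le(1)[OF h k off(1)[OF k]] four_le_n by (simp add: Int_commute)
  have "card ?B \<noteq> 0" "card ?B \<noteq> card ?Z" using tight le r_less_n three_le_r by auto
  then have "?B \<noteq> {}" "?B \<noteq> ?Z" by (metis card.empty)+
  then have "card (?B \<inter> nxt ` ?B) < card ?B" by (rule card_cyc_succ_image_Int_less[OF B(1)])
  moreover have "card ?D = n - 1 - card (?B \<inter> nxt ` ?B)" using B(1) by (subst card_Diff_subset) auto
  ultimately have "r \<le> card ?D" using le by linarith
  then have eq: "positions u k = ?D" if "k \<in> off_cycle c" for k
    using J[OF that] by (intro card_seteq[symmetric] complement[OF that]) simp_all
  have "k = k'" if "k \<in> off_cycle c" "k' \<in> off_cycle c" for k k'
    using positions_inject[OF h, of k k'] off eq that by simp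
  then have "card (off_cycle c) \<le> 1" by (intro card_le_1I) auto
  then show False using two_le_card_off_cycle[OF h] by simp
qed

lemma isolated_tight:
  assumes h: "near_cycle w u c" and isolated: "hdegree (off_cycle c) w = 0"
  shows "r = t" "n = 2 * t + 2" "card (incident_edges w c) = t + 1"
proof -
  have room: "card (incident_edges w c) + r \<le> n - 1" by (rule isolated_room[OF assms])
  have degree: "t choose (r - 1) < card (incident_edges w c)"
    using degree_gt[OF near_cycle_vertex[OF h]] isolated by (simp add: hdegree_eq_off_incident[OF h])
  show "r = t"
  proof (rule ccontr)
    assume "r \<noteq> t"
    then show False using two_t_le_binomial room degree n_bounds r_le_t three_le_r by linarith
  qed
  then show "n = 2 * t + 2" "card (incident_edges w c) = t + 1"
    using room degree binomial_eq_t n_eq by auto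
qed

lemma touching_incident_bound:
  assumes h: "near_cycle w u c" and f: "f \<in> off_cycle c" "w \<in> f" and k: "k \<in> off_cycle c" "w \<notin> k"
    and touch: "positions u k \<inter> (incident_edges w c \<union> nxt ` incident_edges w c) \<noteq> {}"
  shows "card (incident_edges w c) + 2 * r \<le> n + 1"
proof -
  let ?B = "incident_edges w c" and ?J = "positions u f" and ?Z = "{..<n - 1}"
  have card_J: "card ?J = r - 1" "card (positions u k) = r"
    using card_positions[OF h off_cycle_mem] f k by auto
  have bound: ?thesis
    if "S \<subseteq> ?Z" "card S = card ?B + card ?J" "card (positions u k \<inter> S) \<le> 1" for S
    using card_add_le_card_Int[of ?Z "positions u k" S] positions_subset that card_J four_le_n by simp
  have disjoint: "?B \<inter> preds ?J = {}" "?B \<inter> ?J = {}"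
    using incident_not_nbr[OF h] positions_subset_nbr[OF f] by (auto simp: cyc_preds_def)
  have B: "?B \<subseteq> ?Z" and J: "?J \<subseteq> ?Z" by (rule incident_edges_subset positions_subset)+
  consider i where "i \<in> ?B" "i \<in> positions u k" | i where "i \<in> ?B" "nxt i \<in> positions u k"
    using touch by blast
  then show ?thesis
  proof cases
    case 1
    show ?thesis
    proof (rule bound)
      show "?B \<union> preds ?J \<subseteq> ?Z" using B cyc_preds_subset by blast
      show "card (?B \<union> preds ?J) = card ?B + card ?J"
        using disjoint(1) card_cyc_preds[OF J] by (simp add: card_Un_disjoint)
      show "card (positions u k \<inter> (?B \<union> preds ?J)) \<le> 1"
        using positions_incident_nbr(1)[OF h f k 1] card_positions_Int_incident_le(1)[OF h k]
        by (simp add: Int_Un_distrib)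
    qed
  next
    case 2
    show ?thesis
    proof (rule bound)
      show "nxt ` (?B \<union> ?J) \<subseteq> ?Z" using B J by (intro cyc_succ_image_subset) simp
      show "card (nxt ` (?B \<union> ?J)) = card ?B + card ?J"
        using card_cyc_succ_image[of "?B \<union> ?J" "n - 1"] B J disjoint(2) by (simp add: card_Un_disjoint)
      show "card (positions u k \<inter> nxt ` (?B \<union> ?J)) \<le> 1"
        using positions_incident_nbr(2)[OF h f k 2] card_positions_Int_incident_le(2)[OF h k]
        by (simp add: Int_Un_distrib image_Un)
    qed
  qed
qed

lemma card_incident_ge: "near_cycle w u c \<Longrightarrow> t choose (r - 1) \<le> card (incident_edges w c)"
  using degree_gt[OF near_cycle_vertex, of w u c] hdegree_off_cycle_le_1[of w u c]
  by (simp add: hdegree_eq_off_incident)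

lemma other_off_cycle_avoids:
  "near_cycle w u c \<Longrightarrow> f \<in> off_cycle c \<Longrightarrow> w \<in> f \<Longrightarrow> k \<in> off_cycle c \<Longrightarrow> k \<noteq> f \<Longrightarrow> w \<notin> k"
  using hdegree_le_1_unique[OF off_cycle_subset hdegree_off_cycle_le_1, of w u c f k] by blast

lemma card_untouched:
  assumes h: "near_cycle w u c" and f: "f \<in> off_cycle c" "w \<in> f"
  shows "card ({..<n - 1} - (incident_edges w c \<union> nxt ` incident_edges w c)) + card (incident_edges w c) < n - 1"
proof -
  let ?B = "incident_edges w c" and ?Z = "{..<n - 1}"
  have B: "?B \<subseteq> ?Z" "nxt ` ?B \<subseteq> ?Z" using incident_edges_subset cyc_succ_image_subset by auto
  have "positions u f \<noteq> {}" using card_positions[OF h off_cycle_mem[OF f(1)]] f(2) three_le_r by auto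
  then have "?B \<noteq> ?Z"
    using incident_not_nbr(1)[OF h] positions_subset_nbr[OF f] positions_subset[of u f] by blast
  moreover have "0 < card ?B" using card_incident_ge[OF h] t_le_binomial three_le_t by linarith
  then have "?B \<noteq> {}" by auto
  ultimately have "card ?B < card (?B \<union> nxt ` ?B)" by (intro card_cyc_succ_image_Un_gt[OF B(1)])
  moreover have "card (?B \<union> nxt ` ?B) \<le> n - 1" using card_mono[of ?Z "?B \<union> nxt ` ?B"] B by simp
  moreover have "card (?Z - (?B \<union> nxt ` ?B)) = n - 1 - card (?B \<union> nxt ` ?B)"
    using B by (subst card_Diff_subset) auto
  ultimately show ?thesis by linarith
qed

lemma some_edge_touches_incident:
  assumes h: "near_cycle w u c" and f: "f \<in> off_cycle c" "w \<in> f"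
  obtains k where "k \<in> off_cycle c" "w \<notin> k"
    "positions u k \<inter> (incident_edges w c \<union> nxt ` incident_edges w c) \<noteq> {}"
proof -
  let ?B = "incident_edges w c"
  let ?C = "{..<n - 1} - (?B \<union> nxt ` ?B)"
  have "\<exists>k\<in>off_cycle c - {f}. positions u k \<inter> (?B \<union> nxt ` ?B) \<noteq> {}"
  proof (rule ccontr)
    assume no: "\<not> ?thesis"
    have off: "w \<notin> k" "k \<in> E" "card (positions u k) = r" "positions u k \<subseteq> ?C"
      if k: "k \<in> off_cycle c - {f}" for k
    proof -
      show "w \<notin> k" using other_off_cycle_avoids[OF h f] k by blast
      then show "k \<in> E" "card (positions u k) = r" "positions u k \<subseteq> ?C"
        using card_positions[OF h, of k] off_cycle_mem[of k c] k no positions_subset[of u k] by auto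
    qed
    have "\<not> off_cycle c \<subseteq> {f}"
      using two_le_card_off_cycle[OF h] card_mono[of "{f}" "off_cycle c"] by auto
    then obtain k where k: "k \<in> off_cycle c - {f}" by blast
    have "r \<le> card ?C" using card_mono[OF _ off(4)[OF k]] off(3)[OF k] by simp
    then have room: "card ?B + r < n - 1" using card_untouched[OF assms] by linarith
    have "r = t"
    proof (rule ccontr)
      assume "r \<noteq> t"
      then show False
        using two_t_le_binomial room card_incident_ge[OF h] n_bounds r_le_t three_le_r by linarith
    qed
    then have "card ?C \<le> r"
      using card_untouched[OF assms] card_incident_ge[OF h] binomial_eq_t n_bounds by linarith
    then have "positions u k = ?C" if "k \<in> off_cycle c - {f}" for k
      using off(3,4)[OF that] by (intro card_seteq) auto
    then have "x = k" if "x \<in> off_cycle c - {f}" for x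
      using positions_inject[OF h off(2)[OF that] off(2)[OF k]] off(1) that k by simp
    then have "card (off_cycle c) \<le> card {f, k}" by (intro card_mono) auto
    also have "\<dots> \<le> 2" by (simp add: card_insert_if)
    finally show False using four_le_card_off_cycle[OF h \<open>r = t\<close>] by simp
  qed
  then obtain k where "k \<in> off_cycle c - {f}" "positions u k \<inter> (?B \<union> nxt ` ?B) \<noteq> {}" by blast
  then show thesis using that other_off_cycle_avoids[OF h f] by blast
qed

lemma on_off_cycle_edge_tight:
  assumes h: "near_cycle w u c" and f: "f \<in> off_cycle c" "w \<in> f"
  shows "r = 3" "t = 3" "n = 8" "card (incident_edges w c) = 3"
proof -
  obtain k where "k \<in> off_cycle c" "w \<notin> k"
    "positions u k \<inter> (incident_edges w c \<union> nxt ` incident_edges w c) \<noteq> {}"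
    using some_edge_touches_incident[OF assms] .
  then have le: "card (incident_edges w c) + 2 * r \<le> n + 1" by (rule touching_incident_bound[OF assms])
  have "r = t"
  proof (rule ccontr)
    assume "r \<noteq> t"
    then show False
      using two_t_le_binomial le card_incident_ge[OF h] n_bounds r_le_t three_le_r by linarith
  qed
  then show "r = 3" "t = 3" "n = 8" "card (incident_edges w c) = 3"
    using le card_incident_ge[OF h] binomial_eq_t n_bounds three_le_t n_eq by auto
qed

end

lemma card_3_subset_eq: "card A = 3 \<Longrightarrow> A \<subseteq> {x, y, z} \<Longrightarrow> A = {x, y, z}"
  by (rule card_seteq) (simp_all add: card_insert_if)

lemma card_3_not_subset: "card A = 3 \<Longrightarrow> \<not> A \<subseteq> {x, y}"
  using card_mono[of "{x, y}" A] by (auto simp: card_insert_if split: if_splits)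

lemma seven_cycle_low_positions:
  fixes A B :: "nat set"
  assumes B: "B = {3, 4, 5} \<or> B = {2, 4, 5} \<or> B = {2, 3, 5} \<or> B = {2, 3, 4}"
    and A: "A \<subseteq> {1, 2, 3, 4, 5} - Suc ` B" "card A = 3" and le: "card (A \<inter> B) \<le> 1"
  shows "A = {1, 2, 3} \<and> 2 \<notin> B"
proof -
  note eq = card_3_subset_eq[OF A(2)]
  from B A(1) consider "B = {3, 4, 5}" "A \<subseteq> {1, 2, 3}" | "B = {2, 4, 5}" "A \<subseteq> {1, 2, 4}"
    | "B = {2, 3, 5}" "A \<subseteq> {1, 2, 5}" | "A \<subseteq> {1, 2}" by (elim disjE) auto
  then show ?thesis
  proof cases
    case 1
    then show ?thesis using eq by simp
  next
    case 2
    have "A \<inter> B = {2, 4}" unfolding eq[OF 2(2)] 2(1) by auto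
    then show ?thesis using le by simp
  next
    case 3
    have "A \<inter> B = {2, 5}" unfolding eq[OF 3(2)] 3(1) by auto
    then show ?thesis using le by simp
  qed (use card_3_not_subset[OF A(2)] in blast)
qed

lemma seven_cycle_high_positions:
  fixes A B :: "nat set"
  assumes B: "B = {3, 4, 5} \<or> B = {2, 4, 5} \<or> B = {2, 3, 5} \<or> B = {2, 3, 4}"
    and A: "A \<subseteq> {0, 3, 4, 5, 6} - B" "card A = 3" and le: "card (A \<inter> Suc ` B) \<le> 1"
  shows "A = {0, 5, 6} \<and> 2 \<in> B"
proof -
  note eq = card_3_subset_eq[OF A(2)]
  from B A(1) consider "A \<subseteq> {0, 6}" | "B = {2, 4, 5}" "A \<subseteq> {0, 3, 6}"
    | "B = {2, 3, 5}" "A \<subseteq> {0, 4, 6}" | "B = {2, 3, 4}" "A \<subseteq> {0, 5, 6}" by (elim disjE) auto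
  then show ?thesis
  proof cases
    case 2
    have "A \<inter> Suc ` B = {3, 6}" unfolding eq[OF 2(2)] 2(1) by auto
    then show ?thesis using le by simp
  next
    case 3
    have "A \<inter> Suc ` B = {4, 6}" unfolding eq[OF 3(2)] 3(1) by auto
    then show ?thesis using le by simp
  next
    case 4
    then show ?thesis using eq by simp
  qed (use card_3_not_subset[OF A(2)] in blast)
qed

lemma seven_cycle_positions:
  fixes A B :: "nat set"
  assumes B: "B \<subseteq> {2, 3, 4, 5}" "card B = 3" and A: "A \<subseteq> {..<7}" "card A = 3"
    and le: "card (A \<inter> B) \<le> 1" "card (A \<inter> Suc ` B) \<le> 1"
    and low: "A \<inter> B \<noteq> {} \<Longrightarrow> A \<inter> {0, 6} = {}" and high: "A \<inter> Suc ` B \<noteq> {} \<Longrightarrow> A \<inter> {1, 2} = {}"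
  shows "A = {..<7} - (B \<union> Suc ` B) \<or> A = (if 2 \<in> B then {0, 5, 6} else {1, 2, 3})"
proof -
  have A7: "A \<subseteq> {0, 1, 2, 3, 4, 5, 6}" using A(1) by (auto simp: lessThan_nat_numeral lessThan_Suc)
  have "card ({2, 3, 4, 5} - B) = 1" using B by (subst card_Diff_subset) (auto simp: finite_subset)
  then obtain x where "{2, 3, 4, 5} - B = {x}" by (rule card_1_singletonE)
  then have B_eq: "B = {2, 3, 4, 5} - {x}" and "x \<in> {2, 3, 4, 5}" using B(1) by auto
  then have B_cases: "B = {3, 4, 5} \<or> B = {2, 4, 5} \<or> B = {2, 3, 5} \<or> B = {2, 3, 4}"
    unfolding B_eq by (elim insertE emptyE) (simp_all add: insert_Diff_if)
  consider "A \<inter> B = {}" "A \<inter> Suc ` B = {}" | "A \<inter> B \<noteq> {}" "A \<inter> Suc ` B = {}"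
    | "A \<inter> B = {}" "A \<inter> Suc ` B \<noteq> {}" | "A \<inter> B \<noteq> {}" "A \<inter> Suc ` B \<noteq> {}" by blast
  then show ?thesis
  proof cases
    case 1
    have "4 \<le> card (B \<union> Suc ` B)" using B_cases by (elim disjE) (simp_all add: card_insert_if)
    then have "card ({..<7} - (B \<union> Suc ` B)) \<le> card A"
      using B A(2) by (subst card_Diff_subset) (auto intro: finite_subset)
    then have "A = {..<7} - (B \<union> Suc ` B)" using 1 A(1) by (intro card_seteq) auto
    then show ?thesis ..
  next
    case 2
    then have "A \<subseteq> {1, 2, 3, 4, 5} - Suc ` B" using A7 low by auto
    then show ?thesis using seven_cycle_low_positions[OF B_cases _ A(2) le(1)] by simp
  next
    case 3
    then have "A \<subseteq> {0, 3, 4, 5, 6} - B" using A7 high by auto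
    then show ?thesis using seven_cycle_high_positions[OF B_cases _ A(2) le(2)] by simp
  next
    case 4
    then have "A \<subseteq> {3, 4, 5}" using A7 low high by auto
    then have "A = {3, 4, 5}" by (rule card_3_subset_eq[OF A(2)])
    then have "card ({3, 4, 5} \<inter> B) \<le> 1" using le(1) by simp
    with B_cases show ?thesis by (elim disjE) simp_all
  qed
qed

context dirac_hg
begin

lemma first_pair_incident_edges:
  assumes h: "near_cycle w u c" and f: "f \<in> off_cycle c" "w \<in> f" and pair: "{0, 1} \<subseteq> positions u f"
  shows "preds (positions u f) = {6, 0}" "nxt ` positions u f = {1, 2}"
    "incident_edges w c \<subseteq> {2, 3, 4, 5}" "nxt ` incident_edges w c = Suc ` incident_edges w c"
proof -
  note tight = on_off_cycle_edge_tight[OF h f]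
  have n: "n - 1 = 7" using tight(3) by simp
  have nxt: "nxt i = (if i = 6 then 0 else Suc i)" if "i < 7" for i
    using that by (simp add: cyc_succ_eq n)
  have "card (positions u f) = 2"
    using card_positions[OF h off_cycle_mem[OF f(1)]] f(2) tight(1) by simp
  then have J_f: "positions u f = {0, 1}" using card_subset_eq[OF finite_positions pair] by simp
  show preds: "preds (positions u f) = {6, 0}"
    using nxt by (auto simp: cyc_preds_def J_f n split: if_splits)
  show "nxt ` positions u f = {1, 2}"
    using nxt[of 0] nxt[of 1] by (simp add: J_f numeral_2_eq_2 One_nat_def)
  have "incident_edges w c \<inter> {6, 0, 1} = {}"
    using incident_disjoint_with_preds[OF h positions_subset_nbr[OF f]] preds
    by (auto simp: pred_closure_def J_f)
  then show B: "incident_edges w c \<subseteq> {2, 3, 4, 5}"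
    using incident_edges_subset[of w c] by (auto simp: n lessThan_nat_numeral lessThan_Suc)
  show "nxt ` incident_edges w c = Suc ` incident_edges w c" using B nxt by (intro image_cong) auto
qed

lemma zero_one_not_positions:
  assumes h: "near_cycle w u c" and f: "f \<in> off_cycle c" "w \<in> f"
  shows "\<not> {0, 1} \<subseteq> positions u f"
proof
  let ?B = "incident_edges w c"
  assume pair: "{0, 1} \<subseteq> positions u f"
  note tight = on_off_cycle_edge_tight[OF h f] and B = first_pair_incident_edges[OF h f pair]
  let ?choices = "{{..<7} - (?B \<union> Suc ` ?B), if 2 \<in> ?B then {0, 5, 6} else {1, 2, 3}}"
  have off: "w \<notin> k" "k \<in> E" "positions u k \<in> ?choices" if k: "k \<in> off_cycle c - {f}" for k
  proof -
    show "w \<notin> k" using other_off_cycle_avoids[OF h f] k by blast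
    then have k': "k \<in> off_cycle c" "w \<notin> k" using k by auto
    show "k \<in> E" by (rule off_cycle_mem[OF k'(1)])
    have "positions u k = {..<7} - (?B \<union> Suc ` ?B) \<or>
        positions u k = (if 2 \<in> ?B then {0, 5, 6} else {1, 2, 3})"
    proof (rule seven_cycle_positions[OF B(3) tight(4)])
      show "positions u k \<subseteq> {..<7}" using positions_subset[of u k] tight(3) by simp
      show "card (positions u k) = 3" using card_positions[OF h \<open>k \<in> E\<close>] k'(2) tight(1) by simp
      show "card (positions u k \<inter> ?B) \<le> 1" "card (positions u k \<inter> Suc ` ?B) \<le> 1"
        using card_positions_Int_incident_le[OF h k'] by (simp_all add: B(4))
      show "positions u k \<inter> {0, 6} = {}" if "positions u k \<inter> ?B \<noteq> {}"
        using positions_incident_nbr(1)[OF h f k'] that unfolding B(1) by blast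
      show "positions u k \<inter> {1, 2} = {}" if "positions u k \<inter> Suc ` ?B \<noteq> {}"
        using positions_incident_nbr(2)[OF h f k'] that unfolding B(2) B(4)[symmetric] by blast
    qed
    then show "positions u k \<in> ?choices" by simp
  qed
  then have "inj_on (positions u) (off_cycle c - {f})"
    using positions_inject[OF h] by (intro inj_onI) simp
  then have "card (off_cycle c - {f}) = card (positions u ` (off_cycle c - {f}))"
    by (simp add: card_image)
  also have "\<dots> \<le> card ?choices" by (intro card_mono image_subsetI off(3)) simp
  also have "\<dots> \<le> 2" by (simp add: card_insert_if)
  finally have "card (off_cycle c) \<le> 3" using f(1) by (simp add: card_Diff_singleton)
  then show False using four_le_card_off_cycle[OF h] tight by simp
qed

lemma off_cycle_not_clustered:
  assumes h: "near_cycle w u c" and f: "f \<in> off_cycle c" "w \<in> f" and a: "a \<in> positions u f"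
  shows "nxt a \<notin> positions u f"
proof
  assume nxt_a: "nxt a \<in> positions u f"
  have n: "1 < n - 1" using four_le_n by simp
  define s where "s i = (a + i) mod (n - 1)" for i
  have s: "bij_betw s {..<n - 1} {..<n - 1}"
    using bij_betw_mod_shift[of "n - 1" a 0] n by (simp add: s_def[abs_def] lessThan_atLeast0)
  have "s (nxt i) = nxt (s i)" for i by (simp add: s_def cyc_succ_def mod_simps)
  then have shift: "near_cycle w (u \<circ> s) (c \<circ> s)" "off_cycle (c \<circ> s) = off_cycle c"
    using near_cycle_reindex[OF h s s] by auto
  have "s 0 = a" "s 1 = nxt a" using a by (auto simp: s_def cyc_succ_def positions_def One_nat_def)
  then have "{0, 1} \<subseteq> positions (u \<circ> s) f" using a nxt_a n by (auto simp: positions_def)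
  then show False using zero_one_not_positions[OF shift(1)] f unfolding shift(2) by blast
qed

end

text \<open>Without off-cycle edges at \<open>w\<close>, the $t + 1$ cycle edges through \<open>w\<close> form at most two runs, and an
inner vertex of a run can be exchanged for \<open>w\<close>. All exchanged vertices lie on the same cycle
edges as \<open>w\<close>, so the first edge of a run has too many vertices.\<close>

locale isolated_near_cycle = dirac_hg +
  fixes w :: 'a and u :: "nat \<Rightarrow> 'a" and c :: "nat \<Rightarrow> 'a set"
  assumes near: "near_cycle w u c" and isolated: "hdegree (off_cycle c) w = 0"
begin

abbreviation B :: "nat set" where
  "B \<equiv> incident_edges w c"

definition inner :: "nat set" where "inner = B \<inter> nxt ` B"
definition starts :: "nat set" where "starts = B - nxt ` B"
definition stops :: "nat set" where "stops = nxt ` B - B"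
definition outer :: "nat set" where "outer = {..<n - 1} - (B \<union> nxt ` B)"

definition transversal :: "nat set \<Rightarrow> bool" where
  "transversal A \<longleftrightarrow> A \<subseteq> {..<n - 1} \<and> card A = t + 1 \<and>
     (\<forall>k\<in>off_cycle c. card (positions u k \<inter> A) \<le> 1)"

lemma r_eq_t: "r = t" and n_minus_1: "n - 1 = 2 * t + 1" and card_B: "card B = t + 1"
  using isolated_tight[OF near isolated] by auto

lemma B_subset: "B \<subseteq> {..<n - 1}" "nxt ` B \<subseteq> {..<n - 1}"
  using incident_edges_subset cyc_succ_image_subset by auto

lemma card_nxt_B: "card (nxt ` B) = t + 1"
  using card_cyc_succ_image[OF B_subset(1)] card_B by simp

lemma finite_parts [simp]: "finite inner" "finite starts" "finite stops" "finite outer"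
  by (simp_all add: inner_def starts_def stops_def outer_def)

lemma inner_subset: "inner \<subseteq> {..<n - 1}"
  using B_subset by (auto simp: inner_def)

lemma card_starts: "card inner + card starts = t + 1"
  using card_Int_Diff[of B "nxt ` B"] card_B by (simp add: inner_def starts_def)

lemma card_stops: "card stops = card starts"
  using card_Int_Diff[of "nxt ` B" B] card_nxt_B card_starts
  by (simp add: inner_def stops_def Int_commute)

lemma card_outer: "card outer + card starts = t"
proof -
  define U where "U = B \<union> nxt ` B"
  have "card U + card inner = 2 * t + 2"
    using card_Un_Int[of B "nxt ` B"] card_B card_nxt_B by (simp add: U_def inner_def)
  moreover have "card outer + card U = card {..<n - 1}"
    using B_subset card_mono[of "{..<n - 1}" U] by (simp add: U_def outer_def card_Diff_subset)
  then have "card outer + card U = 2 * t + 1" unfolding card_lessThan n_minus_1 .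
  ultimately show ?thesis using card_starts by linarith
qed

lemma B_nonempty: "B \<noteq> {}"
  using card_B by auto

lemma B_not_fixed: "nxt ` B \<noteq> B"
proof
  assume "nxt ` B = B"
  then have "B = {..<n - 1}" by (rule cyc_succ_image_fixed[OF B_subset(1) B_nonempty])
  then have "t + 1 = 2 * t + 1" using card_B n_minus_1 by simp
  then show False using three_le_t by simp
qed

lemma card_starts_pos: "1 \<le> card starts"
proof (rule ccontr)
  assume "\<not> 1 \<le> card starts"
  then have "card starts = 0" by linarith
  then have "starts = {}" by simp
  then have "B = nxt ` B" using card_B card_nxt_B by (intro card_subset_eq) (auto simp: starts_def)
  then show False using B_not_fixed by simp
qed

lemma off_cycle_avoids: "k \<in> off_cycle c \<Longrightarrow> w \<notin> k"
  using isolated by (simp add: isolated_iff)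

lemma card_off_positions: "k \<in> off_cycle c \<Longrightarrow> card (positions u k) = t"
  using card_positions[OF near off_cycle_mem] off_cycle_avoids r_eq_t by simp

lemma inj_positions: "inj_on (positions u) (off_cycle c)"
  using positions_inject[OF near off_cycle_mem off_cycle_mem] off_cycle_avoids by (intro inj_onI) simp

lemma transversal_B: "transversal B" and transversal_nxt_B: "transversal (nxt ` B)"
  using card_positions_Int_incident_le[OF near _ off_cycle_avoids] B_subset card_B card_nxt_B
  by (auto simp: transversal_def)

lemma transversal_unique:
  assumes "transversal A" "k \<in> off_cycle c" "x \<in> positions u k" "x \<in> A" "y \<in> positions u k" "y \<in> A"
  shows "x = y"
proof -
  have "card (positions u k \<inter> A) \<le> 1" using assms(1,2) by (simp add: transversal_def)
  then show ?thesis using assms(3-) unfolding One_nat_def by (subst (asm) card_le_Suc0_iff_eq) auto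
qed

lemma swap_near_cycle:
  assumes "j \<in> inner"
  shows "near_cycle (u j) (u(j := w)) c"
  using assms near_cycle_swap[OF near] by (auto simp: inner_def incident_edges_def)

lemma off_cycle_avoids_inner:
  assumes k: "k \<in> off_cycle c" and j: "j \<in> inner"
  shows "u j \<notin> k"
proof
  assume j_k: "u j \<in> k"
  note swap = swap_near_cycle[OF j]
  have t3: "t = 3" by (rule on_off_cycle_edge_tight(2)[OF swap k j_k])
  have j_pos: "j \<in> positions u k" using j j_k inner_subset by (auto simp: positions_def)
  have "j \<in> B" "j \<in> nxt ` B" using j by (auto simp: inner_def)
  then have sub: "positions u k - {j} \<subseteq> outer"
    using transversal_unique[OF transversal_B k _ _ j_pos]
      transversal_unique[OF transversal_nxt_B k _ _ j_pos]
      positions_subset[of u k] by (auto simp: outer_def)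
  moreover have card_2: "card (positions u k - {j}) = 2" using card_off_positions[OF k] j_pos t3 by simp
  ultimately have outer: "positions u k - {j} = outer"
    using card_outer card_starts_pos t3 by (intro card_seteq) auto
  then have card: "card outer = 2" "card starts = 1" using card_2 card_outer t3 by auto
  have "nxt a \<in> starts" if a: "a \<in> outer" for a
  proof -
    have a': "a < n - 1" "a \<notin> B" using a by (auto simp: outer_def)
    have pos: "outer \<subseteq> positions (u(j := w)) k" unfolding outer[symmetric] by (auto simp: positions_def)
    have "nxt a \<notin> outer" using off_cycle_not_clustered[OF swap k j_k, of a] pos a by blast
    moreover have "nxt a \<notin> nxt ` B" using cyc_succ_inject[OF a'(1)] a'(2) B_subset(1) by auto
    ultimately show ?thesis by (auto simp: outer_def starts_def)
  qed
  then have "card (nxt ` outer) \<le> card starts" by (intro card_mono) auto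
  moreover have "card (nxt ` outer) = card outer" by (rule card_cyc_succ_image) (auto simp: outer_def)
  ultimately show False using card by simp
qed

lemma positions_subset_parts:
  assumes "k \<in> off_cycle c"
  shows "positions u k \<subseteq> starts \<union> stops \<union> outer"
proof
  fix x assume "x \<in> positions u k"
  then have "x < n - 1" "x \<notin> inner" using off_cycle_avoids_inner[OF assms] by (auto simp: positions_def)
  then show "x \<in> starts \<union> stops \<union> outer" by (auto simp: starts_def stops_def outer_def inner_def)
qed

lemma card_positions_parts:
  assumes k: "k \<in> off_cycle c"
  shows "card (positions u k \<inter> starts) \<le> 1" "card (positions u k \<inter> stops) \<le> 1"
    "t = card (positions u k \<inter> starts) + card (positions u k \<inter> stops) + card (positions u k \<inter> outer)"
proof -
  let ?J = "positions u k"
  show "card (?J \<inter> starts) \<le> 1" "card (?J \<inter> stops) \<le> 1"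
    by (rule card_le_1I, simp, rule transversal_unique[OF transversal_B k]; simp add: starts_def)
       (rule card_le_1I, simp, rule transversal_unique[OF transversal_nxt_B k]; simp add: stops_def)
  have "?J = (?J \<inter> starts) \<union> (?J \<inter> stops) \<union> (?J \<inter> outer)" using positions_subset_parts[OF k] by blast
  also have "card \<dots> = card ((?J \<inter> starts) \<union> (?J \<inter> stops)) + card (?J \<inter> outer)"
    by (rule card_Un_disjoint) (auto simp: starts_def stops_def outer_def)
  also have "card ((?J \<inter> starts) \<union> (?J \<inter> stops)) = card (?J \<inter> starts) + card (?J \<inter> stops)"
    by (rule card_Un_disjoint) (auto simp: starts_def stops_def)
  finally show "t = card (?J \<inter> starts) + card (?J \<inter> stops) + card (?J \<inter> outer)"
    using card_off_positions[OF k] by simp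
qed

lemma card_starts_le: "card starts \<le> 2"
proof -
  obtain k where k: "k \<in> off_cycle c" using two_le_card_off_cycle[OF near] by fastforce
  have "card (positions u k \<inter> outer) \<le> card outer" by (intro card_mono) auto
  then show ?thesis using card_positions_parts[OF k] card_outer by simp
qed

lemma swap_transversal:
  assumes j: "j \<in> inner"
  shows "transversal (incident_edges (u j) c)" "transversal (nxt ` incident_edges (u j) c)"
proof -
  note swap = swap_near_cycle[OF j]
  let ?A = "incident_edges (u j) c"
  have "hdegree (off_cycle c) (u j) = 0"
    using off_cycle_avoids_inner[OF _ j] by (simp add: isolated_iff)
  then have "card ?A = t + 1" by (rule isolated_tight(3)[OF swap])
  moreover from this have "card (nxt ` ?A) = t + 1"
    using card_cyc_succ_image[OF incident_edges_subset] by simp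
  moreover have "positions (u(j := w)) k = positions u k" if "k \<in> off_cycle c" for k
    using off_cycle_avoids[OF that] off_cycle_avoids_inner[OF that j] by (auto simp: positions_def)
  then have "card (positions u k \<inter> ?A) \<le> 1" "card (positions u k \<inter> nxt ` ?A) \<le> 1"
    if "k \<in> off_cycle c" for k
    using card_positions_Int_incident_le[OF swap that off_cycle_avoids_inner[OF that j]] that by auto
  ultimately show "transversal ?A" "transversal (nxt ` ?A)"
    using incident_edges_subset cyc_succ_image_subset by (auto simp: transversal_def)
qed

lemma single_run_covers_pair:
  assumes run: "card starts = 1" and x: "x \<in> starts \<union> stops \<union> outer" and y: "y \<in> starts \<union> stops \<union> outer"
  shows "\<exists>k\<in>off_cycle c. x \<in> positions u k \<and> y \<in> positions u k"
proof (rule ccontr)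
  assume no: "\<not> ?thesis"
  let ?W = "starts \<union> stops \<union> outer"
  have "card ?W \<le> card starts + card stops + card outer"
    using card_Un_le[of "starts \<union> stops" outer] card_Un_le[of starts stops] by linarith
  then have card_W: "card ?W \<le> t + 1" using run card_stops card_outer by linarith
  have missing: "positions u k = ?W - {z}" if "k \<in> off_cycle c" "z \<in> ?W" "z \<notin> positions u k" for k z
  proof (rule card_seteq)
    show "positions u k \<subseteq> ?W - {z}" using positions_subset_parts that(1,3) by blast
    show "card (?W - {z}) \<le> card (positions u k)"
      using card_W that(2) card_off_positions[OF that(1)] by (simp add: card_Diff_singleton)
  qed simp
  have "positions u ` off_cycle c \<subseteq> {?W - {x}, ?W - {y}}"
    using no missing[OF _ x] missing[OF _ y] by blast
  then have "card (positions u ` off_cycle c) \<le> card {?W - {x}, ?W - {y}}" by (intro card_mono) auto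
  also have "\<dots> \<le> 2" by (simp add: card_insert_if)
  finally show False using card_image[OF inj_positions] four_le_card_off_cycle[OF near r_eq_t] by simp
qed

lemma single_run_transversal:
  assumes run: "card starts = 1" and A: "transversal A"
  shows "inner \<subseteq> A"
proof -
  have A': "A \<subseteq> {..<n - 1}" "card A = t + 1" using A by (auto simp: transversal_def)
  then have fin: "finite A" using finite_subset by blast
  have "x = y" if "x \<in> A - inner" "y \<in> A - inner" for x y
  proof -
    have "x \<in> starts \<union> stops \<union> outer" "y \<in> starts \<union> stops \<union> outer"
      using that A'(1) by (auto simp: starts_def stops_def outer_def inner_def)
    then show ?thesis using single_run_covers_pair[OF run] transversal_unique[OF A] that by blast
  qed
  then have "card (A - inner) \<le> 1" using fin by (intro card_le_1I) auto
  then have "card inner \<le> card (A \<inter> inner)"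
    using card_Int_Diff[OF fin, of inner] A'(2) card_starts run by simp
  then have "A \<inter> inner = inner" by (intro card_seteq) auto
  then show ?thesis by blast
qed

lemma single_run_determined:
  assumes run: "card starts = 1" and j: "j \<in> inner"
    and A: "transversal A" "transversal (nxt ` A)"
  shows "A = with_preds inner"
proof (rule card_seteq[symmetric])
  have A': "A \<subseteq> {..<n - 1}" "card A = t + 1" using A(1) by (auto simp: transversal_def)
  then show "finite A" using finite_subset by blast
  have "card inner \<noteq> card {..<n - 1}" using card_starts run n_minus_1 three_le_t by simp
  then have "inner \<noteq> {..<n - 1}" by metis
  then have "card inner < card (with_preds inner)"
    using card_pred_closure_gt[OF inner_subset] j by blast
  then show "card A \<le> card (with_preds inner)" using A'(2) card_starts run by simp
  show "with_preds inner \<subseteq> A"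
  proof
    fix i assume "i \<in> with_preds inner"
    then consider "i \<in> inner" | "i < n - 1" "nxt i \<in> inner"
      by (auto simp: pred_closure_def cyc_preds_def)
    then show "i \<in> A"
    proof cases
      case 1
      then show ?thesis using single_run_transversal[OF run A(1)] by blast
    next
      case 2
      then obtain z where "z \<in> A" "nxt i = nxt z" using single_run_transversal[OF run A(2)] by blast
      then show ?thesis using cyc_succ_inject[OF 2(1), of z] A'(1) by auto
    qed
  qed
qed

lemma double_run_positions:
  assumes runs: "card starts = 2"
  shows "positions u ` off_cycle c = (\<lambda>(x, y). outer \<union> {x, y}) ` (starts \<times> stops)"
proof (rule card_seteq)
  have "card ((\<lambda>(x, y). outer \<union> {x, y}) ` (starts \<times> stops)) \<le> card (starts \<times> stops)"
    by (intro card_image_le) simp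
  then show "card ((\<lambda>(x, y). outer \<union> {x, y}) ` (starts \<times> stops)) \<le> card (positions u ` off_cycle c)"
    using runs card_stops card_image[OF inj_positions] four_le_card_off_cycle[OF near r_eq_t]
    by (simp add: card_cartesian_product)
  show "positions u ` off_cycle c \<subseteq> (\<lambda>(x, y). outer \<union> {x, y}) ` (starts \<times> stops)"
  proof
    fix J assume "J \<in> positions u ` off_cycle c"
    then obtain k where k: "k \<in> off_cycle c" "J = positions u k" by blast
    have "card (J \<inter> outer) \<le> card outer" by (intro card_mono) auto
    then have card: "card (J \<inter> starts) = 1" "card (J \<inter> stops) = 1" "card (J \<inter> outer) = card outer"
      using card_positions_parts[OF k(1)] card_outer runs k(2) by auto
    obtain x y where xy: "J \<inter> starts = {x}" "J \<inter> stops = {y}"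
      using card(1,2) by (meson card_1_singletonE)
    have "J \<inter> outer = outer" using card(3) by (intro card_subset_eq) auto
    then have "J = outer \<union> {x, y}" using positions_subset_parts[OF k(1)] xy k(2) by blast
    then show "J \<in> (\<lambda>(x, y). outer \<union> {x, y}) ` (starts \<times> stops)" using xy by auto
  qed
qed simp

lemma double_run_transversal:
  assumes runs: "card starts = 2" and A: "transversal A"
  shows "A = B \<or> A = nxt ` B"
proof -
  have A': "A \<subseteq> {..<n - 1}" "card A = t + 1" using A by (auto simp: transversal_def)
  then have fin: "finite A" using finite_subset by blast
  have pair: "\<not> (x \<in> A \<and> y \<in> A)"
    if "s \<in> starts" "z \<in> stops" "x \<in> outer \<union> {s, z}" "y \<in> outer \<union> {s, z}" "x \<noteq> y" for s z x y
  proof -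
    have "outer \<union> {s, z} \<in> positions u ` off_cycle c"
      unfolding double_run_positions[OF runs] using that by auto
    then show ?thesis using transversal_unique[OF A, of _ x y] that(3-5) by auto
  qed
  have parts: "A - inner \<subseteq> starts \<union> stops \<union> outer"
    using A'(1) by (auto simp: starts_def stops_def outer_def inner_def)
  have "starts \<noteq> {}" "stops \<noteq> {}" using runs card_stops by auto
  then obtain s z where sz: "s \<in> starts" "z \<in> stops" by blast
  have two: "2 \<le> card (A - inner)"
    using card_Int_Diff[OF fin, of inner] card_mono[of inner "A \<inter> inner"] A'(2) card_starts runs by simp
  have "A \<inter> outer = {}"
  proof (rule ccontr)
    assume "A \<inter> outer \<noteq> {}"
    then obtain o' where o': "o' \<in> A" "o' \<in> outer" by blast
    have "\<not> A - inner \<subseteq> {o'}" using two card_mono[of "{o'}" "A - inner"] by auto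
    then obtain x where "x \<in> A" "x \<noteq> o'" "x \<in> starts \<union> stops \<union> outer" using parts by blast
    then show False using pair[of x z x o'] pair[of s x x o'] pair[of s z x o'] o' sz by blast
  qed
  moreover have "A \<inter> starts = {} \<or> A \<inter> stops = {}"
  proof (rule ccontr)
    assume "\<not> ?thesis"
    then obtain x y where "x \<in> A" "x \<in> starts" "y \<in> A" "y \<in> stops" by blast
    moreover from this have "x \<noteq> y" by (auto simp: starts_def stops_def)
    ultimately show False using pair[of x y x y] by blast
  qed
  ultimately have "A \<subseteq> B \<or> A \<subseteq> nxt ` B" using parts unfolding starts_def stops_def inner_def by blast
  then show ?thesis
    using card_subset_eq[of B A] card_subset_eq[of "nxt ` B" A] A'(2) card_B card_nxt_B by auto
qed

lemma double_run_determined: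
  assumes runs: "card starts = 2" and A: "transversal A" "transversal (nxt ` A)"
  shows "A = B"
proof (rule ccontr)
  assume "A \<noteq> B"
  then have A_eq: "A = nxt ` B" using double_run_transversal[OF runs A(1)] by blast
  have "A \<subseteq> {..<n - 1}" using A(1) by (simp add: transversal_def)
  then have "nxt ` A \<noteq> nxt ` B"
    using \<open>A \<noteq> B\<close> inj_on_image_eq_iff[OF bij_betw_imp_inj_on[OF bij_betw_cyc_succ]] B_subset(1) by blast
  then have "nxt ` nxt ` B = B" using double_run_transversal[OF runs A(2)] A_eq by simp
  then have "nxt ` (B \<union> nxt ` B) = B \<union> nxt ` B" by (simp add: image_Un Un_commute)
  then have "B \<union> nxt ` B = {..<n - 1}"
    using B_subset B_nonempty by (intro cyc_succ_image_fixed) auto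
  then have "outer = {}" by (simp add: outer_def)
  then show False using card_outer runs three_le_t by simp
qed

lemma incident_edges_inner:
  assumes j: "j \<in> inner"
  shows "incident_edges (u j) c = B"
proof -
  note A = swap_transversal[OF j]
  have "card starts = 1 \<or> card starts = 2" using card_starts_pos card_starts_le by linarith
  then show ?thesis
  proof
    assume run: "card starts = 1"
    show ?thesis
      using single_run_determined[OF run j A]
        single_run_determined[OF run j transversal_B transversal_nxt_B]
      by simp
  qed (use double_run_determined[OF _ A] in blast)
qed

lemma contradiction: False
proof -
  have "starts \<noteq> {}" using card_starts_pos by auto
  then obtain s where "s \<in> starts" by blast
  then have s: "s < n - 1" "s \<in> B" "s \<notin> inner" using B_subset by (auto simp: starts_def inner_def)
  then have "insert w (u ` insert s inner) \<subseteq> c s"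
    using incident_edges_inner cycle_edge_left[OF near s(1)] by (auto simp: incident_edges_def)
  moreover have sub: "insert s inner \<subseteq> {..<n - 1}" using s(1) inner_subset by simp
  then have "w \<notin> u ` insert s inner" using cycle_vertex_neq[OF near] by auto
  then have "card (insert w (u ` insert s inner)) = card inner + 2"
    using card_position_image[OF near sub] s(3) by simp
  moreover have "card (c s) = t" "finite (c s)"
    using card_edge finite_edge cycle_edge_mem[OF near s(1)] r_eq_t by auto
  ultimately have "card inner + 2 \<le> t" by (metis card_mono)
  then show False using card_starts card_starts_le by linarith
qed

end

context dirac_hg
begin

lemma not_isolated:
  assumes "near_cycle w u c"
  obtains f where "f \<in> off_cycle c" "w \<in> f"
proof -
  have "hdegree (off_cycle c) w \<noteq> 0"
  proof
    assume "hdegree (off_cycle c) w = 0"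
    then interpret isolated_near_cycle V E n r t w u c using assms by unfold_locales
    show False by (rule contradiction)
  qed
  then show thesis using that by (auto simp: isolated_iff)
qed

lemma incident_edges_eq_complement:
  assumes h: "near_cycle w u c" and f: "f \<in> off_cycle c" "w \<in> f"
  shows "incident_edges w c = {..<n - 1} - with_preds (positions u f)"
proof -
  note tight = on_off_cycle_edge_tight[OF h f]
  have "card (with_preds (positions u f)) = 4"
    using card_pred_closure_independent[OF positions_subset off_cycle_not_clustered[OF h f]]
      card_positions[OF h off_cycle_mem[OF f(1)]] f(2) tight(1) by simp
  then have "card ({..<n - 1} - with_preds (positions u f)) = 3"
    using pred_closure_subset[OF positions_subset] finite_pred_closure[OF positions_subset] tight(3)
    by (subst card_Diff_subset) auto
  then show ?thesis
    using incident_disjoint_with_preds[OF h positions_subset_nbr[OF f]] incident_edges_subset[of w c]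
      tight(4)
    by (intro card_subset_eq) auto
qed

lemma consecutive_incident_edges:
  assumes h: "near_cycle w u c" and f: "f \<in> off_cycle c" "w \<in> f"
  obtains p where "p \<in> incident_edges w c" "nxt p \<in> incident_edges w c"
proof -
  let ?B = "incident_edges w c"
  note tight = on_off_cycle_edge_tight[OF h f]
  have B: "?B \<subseteq> {..<n - 1}" by (rule incident_edges_subset)
  have "(?B \<union> nxt ` ?B) \<inter> positions u f = {}"
    using incident_not_nbr[OF h] positions_subset_nbr[OF f] by blast
  then have "card (?B \<union> nxt ` ?B) + card (positions u f) = card (?B \<union> nxt ` ?B \<union> positions u f)"
    by (simp add: card_Un_disjoint)
  also have "\<dots> \<le> card {..<n - 1}"
    using B cyc_succ_image_subset[OF B] positions_subset by (intro card_mono) auto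
  finally have "card (?B \<union> nxt ` ?B) < card ?B + card (nxt ` ?B)"
    using card_cyc_succ_image[OF B] card_positions[OF h off_cycle_mem[OF f(1)]] f(2) tight by simp
  then have "?B \<inter> nxt ` ?B \<noteq> {}" using card_Un_disjoint[of ?B "nxt ` ?B"] by fastforce
  then show thesis using that by blast
qed

lemma swap_incident_edges_eq:
  assumes h: "near_cycle w u c" and f: "f \<in> off_cycle c" "w \<in> f"
    and p: "p \<in> incident_edges w c" "nxt p \<in> incident_edges w c"
  shows "incident_edges (u (nxt p)) c = incident_edges w c"
proof -
  let ?B = "incident_edges w c" and ?j = "nxt p"
  have p': "p < n - 1" "w \<in> c p" "w \<in> c ?j" using p by (auto simp: incident_edges_def)
  note swap = near_cycle_swap[OF h p'] and B_eq = incident_edges_eq_complement[OF h f]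
  obtain k where k: "k \<in> off_cycle c" "u ?j \<in> k" using not_isolated[OF swap] .
  have "?j \<notin> positions u f" using incident_not_nbr(1)[OF h p(2)] positions_subset_nbr[OF f] by blast
  then have "k \<noteq> f" using k(2) by (auto simp: positions_def)
  then have w_k: "w \<notin> k" by (rule other_off_cycle_avoids[OF h f k(1)])
  have j_k: "?j \<in> positions u k" using k(2) by (simp add: positions_def)
  have "positions u k - {?j} = positions u f"
  proof (rule card_subset_eq)
    have "positions u k \<inter> ?B = {?j}"
      using card_positions_Int_incident_le(1)[OF h k(1) w_k] j_k p(2)
      by (intro card_seteq[symmetric]) auto
    then show "positions u k - {?j} \<subseteq> positions u f"
      using positions_incident_nbr(1)[OF h f k(1) w_k p(2) j_k] positions_subset[of u k] B_eq
      by (auto simp: pred_closure_def)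
    show "card (positions u k - {?j}) = card (positions u f)"
      using card_positions[OF h off_cycle_mem] f k(1) w_k j_k by simp
  qed simp
  then have "positions (u(?j := w)) k = positions u f" using w_k by (auto simp: positions_def)
  then show ?thesis using incident_edges_eq_complement[OF swap k] B_eq by simp
qed

text \<open>A third cycle edge through \<open>w\<close> also contains the vertex that can be exchanged for \<open>w\<close>, hence
four vertices, but $r = 3$.\<close>

lemma no_near_cycle: "\<not> near_cycle w u c"
proof
  assume h: "near_cycle w u c"
  let ?B = "incident_edges w c"
  obtain f where f: "f \<in> off_cycle c" "w \<in> f" using not_isolated[OF h] .
  note tight = on_off_cycle_edge_tight[OF h f]
  obtain p where p: "p \<in> ?B" "nxt p \<in> ?B" using consecutive_incident_edges[OF h f] .
  let ?j = "nxt p"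
  have p': "p < n - 1" using p(1) by (simp add: incident_edges_def)
  have "card {p, ?j} \<le> 2" by (simp add: card_insert_if)
  then have "\<not> ?B \<subseteq> {p, ?j}" using card_mono[of "{p, ?j}" ?B] tight(4) by auto
  then obtain i where i: "i \<in> ?B" "i \<noteq> p" "i \<noteq> ?j" by blast
  then have i': "i < n - 1" "w \<in> c i" "u ?j \<in> c i"
    using swap_incident_edges_eq[OF h f p] by (auto simp: incident_edges_def)
  have "nxt i \<noteq> ?j" "nxt i \<noteq> i"
    using cyc_succ_inject[OF i'(1) p'] cyc_succ_neq[OF i'(1)] i(2) tight(3) by auto
  then have "card {w, u ?j, u i, u (nxt i)} = 4"
    using cycle_vertex_neq[OF h i'(1)] cycle_vertex_neq[OF h nxt_less[of p]]
      cycle_vertex_neq[OF h nxt_less[of i]]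
      cycle_vertex_inject[OF h] i'(1) i(3) by (auto simp: card_insert_if)
  moreover have "{w, u ?j, u i, u (nxt i)} \<subseteq> c i"
    using i' cycle_edge_left[OF h i'(1)] cycle_edge_right[OF h i'(1)] by simp
  ultimately have "4 \<le> card (c i)"
    using card_mono[OF finite_edge[OF cycle_edge_mem[OF h i'(1)]]] by metis
  then show False using card_edge[OF cycle_edge_mem[OF h i'(1)]] tight(1) by simp
qed

end

section \<open>Pivots of the two ends\<close>

context dirac_hg
begin

lemma no_second_closing_edge:
  "ham_path v e \<Longrightarrow> f \<in> insert (e 1) (free_edges e) \<Longrightarrow> v 2 \<in> f \<Longrightarrow> v n \<notin> f"
  using path_near_cycle no_near_cycle by blast

lemma start_pivot_pred_not_end_pivot:
  assumes h: "ham_path v e" and i: "i \<in> start_pivots v e"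
  shows "i - 1 \<notin> end_pivots v e"
proof
  assume pivot: "i - 1 \<in> end_pivots v e"
  then have i1: "1 \<le> i - 1" "i - 1 < n" using index_sets_subset(6)[of v e] by auto
  then have swap: "i + 1 - 2 = i - 1" "1 < i" by auto
  obtain f where rot: "rotation i f v e" using start_pivots_iff[OF h] i by blast
  note h' = ham_path_rotate[OF h rot]
  have at: "rotate_verts i v 2 = v (i - 1)" "rotate_edges i f e 1 = e (i - 1)"
    using swap by (simp_all add: rotate_verts_le rotate_edges_lt)
  from pivot consider g where "g \<in> free_edges e" "v n \<in> g" "v (i - 1) \<in> g" | "v n \<in> e (i - 1)"
    by (auto simp: end_pivots_def end_free_def end_edges_def)
  then show False
  proof cases
    case 1
    then show False
      using no_second_closing_edge[OF h', of g] free_end_edge_rotate[OF h rot] rotation_end[OF rot]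
      by (simp add: at)
  next
    case 2
    then show False
      using no_second_closing_edge[OF h', of "e (i - 1)"] path_edge_left[OF h i1] rotation_end[OF rot]
      by (simp add: at)
  qed
qed

lemma start_edges_avoid_end_free:
  assumes "ham_path v e" "i \<in> start_edges v e"
  shows "i \<notin> end_free v e" "i - 1 \<notin> end_free v e"
  using start_edges_not_end_free[OF assms] start_pivot_pred_not_end_pivot[OF assms(1), of i] assms(2)
  by (auto simp: start_pivots_def end_pivots_def)

lemma end_edges_avoid_start_free:
  assumes "ham_path v e" "i \<in> end_edges v e"
  shows "i \<notin> start_free v e" "i + 1 \<notin> start_free v e"
  using start_free_not_end_edges[OF assms(1)] start_pivot_pred_not_end_pivot[OF assms(1), of "i + 1"]
    assms(2)
  by (auto simp: start_pivots_def end_pivots_def)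

lemma binomial_pascal: "t choose (r - 1) = (t - 1 choose (r - 2)) + (t - 1 choose (r - 1))"
proof -
  have "t = Suc (t - 1)" "r - 1 = Suc (r - 2)" using three_le_t three_le_r by auto
  then show ?thesis by (metis binomial_Suc_Suc)
qed

lemma t_le_Suc_binomial: "t \<le> Suc (t - 1 choose (r - 2))"
proof -
  have "1 \<le> r - 2" "r - 2 < t - 1" using three_le_r r_le_t by linarith+
  then show ?thesis using le_binomial[of "r - 2" "t - 1"] by linarith
qed

lemma few_free_start_edges:
  assumes h: "ham_path v e" and few: "card (start_free v e) < t"
  shows "Suc (t - 1 choose (r - 2)) \<le> card (start_edges v e)"
proof -
  have "hdegree (free_edges e) (v 1) \<le> card (start_free v e) choose (r - 1)"
    by (rule hdegree_free_start_le[OF h])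
  also have "\<dots> \<le> t - 1 choose (r - 1)" using few by (intro binomial_right_mono) simp
  finally show ?thesis
    using hdegree_start[OF h] degree_gt[OF start_mem[OF h]] binomial_pascal by simp
qed

lemma few_free_t_le_start_edges:
  "ham_path v e \<Longrightarrow> card (start_free v e) < t \<Longrightarrow> t \<le> card (start_edges v e)"
  using few_free_start_edges[of v e] t_le_Suc_binomial by linarith

lemma t_le_card_start_pivots:
  assumes "ham_path v e"
  shows "t \<le> card (start_pivots v e)"
proof (cases "card (start_free v e) < t")
  case True
  then have "t \<le> card (start_edges v e)" by (rule few_free_t_le_start_edges[OF assms])
  also have "\<dots> \<le> card (start_pivots v e)" by (intro card_mono) (auto simp: start_pivots_def)
  finally show ?thesis .
next
  case False
  then have "t \<le> card (start_free v e)" by simp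
  also have "\<dots> \<le> card (start_pivots v e)" by (intro card_mono) (auto simp: start_pivots_def)
  finally show ?thesis .
qed

lemma t_le_card_end_pivots: "ham_path v e \<Longrightarrow> t \<le> card (end_pivots v e)"
  using t_le_card_start_pivots[OF ham_path_reverse] card_start_pivots_reverse by metis

lemma freed_edge_not_end_pivot:
  assumes h: "ham_path v e" and rot: "rotation i f v e"
    and k: "k \<in> insert (e i) (free_edges e)" "k \<noteq> f" "v i \<in> k"
    and l: "i < l" "l < n" "v (Suc l) \<in> k"
  shows "l \<notin> end_pivots v e" "i < l - 1 \<Longrightarrow> l - 1 \<notin> end_pivots v e"
proof -
  have free: "l \<in> start_free (rotate_verts i v) (rotate_edges i f e)"
    by (rule start_free_rotateI[OF h rot k l])
  then show "l \<notin> end_pivots v e"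
    using start_free_not_end_pivots[OF ham_path_rotate[OF h rot]] end_pivots_rotate_gt[OF h rot _ l(1)]
    by blast
  show "l - 1 \<notin> end_pivots v e" if "i < l - 1"
    using start_pivot_pred_not_end_pivot[OF ham_path_rotate[OF h rot], of l] free
      end_pivots_rotate_gt[OF h rot _ that] by (auto simp: start_pivots_def)
qed

lemma start_free_edge_not_end_pivot:
  assumes h: "ham_path v e" and i: "i \<in> start_free v e" and l: "i < l" "l < n" "v (Suc l) \<in> e i"
  shows "l \<notin> end_pivots v e" "i < l - 1 \<Longrightarrow> l - 1 \<notin> end_pivots v e"
proof -
  obtain f where f: "f \<in> free_edges e" and rot: "rotation i f v e"
    using start_free_rotation[OF i] by blast
  have i': "1 \<le> i" "i < n" using rotation_index[OF rot] .
  have "e i \<noteq> f" using path_edge_not_free[OF i'] f by blast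
  note freed = freed_edge_not_end_pivot[OF h rot insertI1 this path_edge_left[OF h i'] l]
  show "l \<notin> end_pivots v e" "i < l - 1 \<Longrightarrow> l - 1 \<notin> end_pivots v e" using freed .
qed

lemma end_free_edge_not_start_pivot:
  assumes h: "ham_path v e" and m: "m \<in> end_free v e" and l: "1 \<le> l" "l < m" "v l \<in> e m"
  shows "l \<notin> start_pivots v e"
proof -
  have m': "1 \<le> n - m" "n - m < n" "n - (n - m) = m"
    and l': "1 \<le> n - l" "n - m < n - l" "n - l < n" "n - (n - l) = l"
    using m l index_sets_subset(3)[of v e] by auto
  have "n - m \<in> start_free (reverse_verts v) (reverse_edges e)"
    using start_free_reverse[OF h m'(1,2)] m m'(3) by simp
  moreover have "reverse_verts v (Suc (n - l)) \<in> reverse_edges e (n - m)"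
    using l l' m'(3) by (simp add: reverse_verts_def reverse_edges_def)
  ultimately have "n - l \<notin> end_pivots (reverse_verts v) (reverse_edges e)"
    using start_free_edge_not_end_pivot(1)[OF ham_path_reverse[OF h] _ l'(2,3)] by blast
  then show ?thesis using end_pivots_reverse[OF h l'(1,3)] l'(4) by simp
qed

text \<open>Rotating at $i$ frees $e_i$, so each $e_i$ through $v_1$ leads to free neighbours only; thus all
edges at $v_1$ live on the $t$ free neighbours.\<close>

lemma no_full_start:
  assumes h: "ham_path v e" and card: "card (start_free v e) = t"
    and full: "\<And>l. 1 \<le> l \<Longrightarrow> l < n \<Longrightarrow> l \<notin> end_free v e \<Longrightarrow> l - 1 \<notin> end_free v e \<Longrightarrow> l \<in> start_free v e"
    and down: "\<And>i. i \<in> start_edges v e \<Longrightarrow> {1..i} \<subseteq> start_free v e"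
  shows False
proof -
  have "hdegree E (v 1) \<le> card (start_free v e) choose (r - 1)"
  proof (rule hdegree_start_le_binomial[OF h order_refl])
    fix f l assume f: "f \<in> E" "v 1 \<in> f" and l: "1 \<le> l" "l < n" "v (Suc l) \<in> f"
    from f(1) show "l \<in> start_free v e"
    proof (cases rule: edge_cases[where e = e])
      case 1
      then show ?thesis using f(2) l by (auto simp: start_free_def)
    next
      case (2 i)
      then have i: "{1..i} \<subseteq> start_free v e" using down f(2) by (simp add: start_edges_def)
      show ?thesis
      proof (cases "l \<le> i")
        case False
        then have "i < l" by simp
        have free: "i \<in> start_free v e" using i 2(1) by auto
        have "v (Suc l) \<in> e i" using l(3) 2(3) by simp
        note avoid = start_free_edge_not_end_pivot[OF h free \<open>i < l\<close> l(2) this]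
        have "l \<notin> end_free v e" using avoid(1) by (simp add: end_pivots_def)
        moreover have "l - 1 \<notin> end_free v e"
        proof (cases "l - 1 = i")
          case True
          then show ?thesis using start_free_not_end_free[OF h free] by simp
        next
          case False
          then show ?thesis using avoid(2) \<open>i < l\<close> by (simp add: end_pivots_def)
        qed
        ultimately show ?thesis using full l by blast
      qed (use i l(1) in auto)
    qed
  qed simp
  then show False using degree_gt[OF start_mem[OF h]] card by simp
qed

lemma no_full_end:
  assumes h: "ham_path v e" and card: "card (end_free v e) = t"
    and full: "\<And>l. 1 \<le> l \<Longrightarrow> l < n \<Longrightarrow> l \<notin> start_free v e \<Longrightarrow> l + 1 \<notin> start_free v e \<Longrightarrow> l \<in> end_free v e"
    and up: "\<And>i. i \<in> end_edges v e \<Longrightarrow> {i..<n} \<subseteq> end_free v e"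
  shows False
proof (rule no_full_start[OF ham_path_reverse[OF h]])
  let ?v = "reverse_verts v" and ?e = "reverse_edges e"
  note free = start_free_reverse[OF h] end_free_reverse[OF h]
  show "card (start_free ?v ?e) = t" using card_start_free_reverse[OF h] card by simp
  show "l \<in> start_free ?v ?e"
    if l: "1 \<le> l" "l < n" "l \<notin> end_free ?v ?e" "l - 1 \<notin> end_free ?v ?e" for l
  proof -
    have "n - l \<notin> start_free v e" using free(2)[OF l(1,2)] l(3) by simp
    moreover have "n - l + 1 \<notin> start_free v e"
    proof
      assume next_free: "n - l + 1 \<in> start_free v e"
      then have "n - l + 1 < n" using index_sets_subset(1)[of v e] by auto
      then have "1 \<le> l - 1" "l - 1 < n" "n - (l - 1) = n - l + 1" using l(1,2) by linarith+
      then show False using free(2)[of "l - 1"] next_free l(4) by simp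
    qed
    ultimately show ?thesis using full[of "n - l"] free(1)[OF l(1,2)] l(1,2) by simp
  qed
  show "{1..i} \<subseteq> start_free ?v ?e" if i: "i \<in> start_edges ?v ?e" for i
  proof
    fix l assume l: "l \<in> {1..i}"
    have i': "1 \<le> i" "i < n" using i by (auto simp: start_edges_def)
    then have "n - l \<in> end_free v e" using up[of "n - i"] start_edges_reverse[OF h i'] i l by auto
    then show "l \<in> start_free ?v ?e" using free(1)[of l] l i' by simp
  qed
qed

end

section \<open>Paths whose ends have many free neighbours\<close>

lemma no_descent_split_gap:
  fixes A B :: "nat set"
  assumes un: "A \<union> B = {1..<n} - {z}" and z: "z \<in> {1..<n}" and disj: "A \<inter> B = {}"
    and desc: "\<forall>i\<in>A. i - 1 \<notin> B"
  obtains k s where "k < z" "z < s" "s \<le> n" "card A = k + (s - Suc z)"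
    "A = {1..<Suc k} \<union> {Suc z..<s}" "B = {Suc k..<z} \<union> {s..<n}"
proof -
  define k s where "k = card (A \<inter> {1..<z})" and "s = Suc z + card (A \<inter> {Suc z..<n})"
  have halves: "(A \<inter> {1..<z}) \<union> (B \<inter> {1..<z}) = {1..<z}"
    "(A \<inter> {Suc z..<n}) \<union> (B \<inter> {Suc z..<n}) = {Suc z..<n}"
    unfolding Int_Un_distrib2[symmetric] un using z by auto
  have low: "A \<inter> {1..<z} = {1..<Suc k}" "B \<inter> {1..<z} = {Suc k..<z}"
    unfolding k_def Suc_eq_plus1_left
    by (rule no_descent_split[OF halves(1)], use disj desc in blast, use desc in blast)+
  have high: "A \<inter> {Suc z..<n} = {Suc z..<s}" "B \<inter> {Suc z..<n} = {s..<n}"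
    unfolding s_def
    by (rule no_descent_split[OF halves(2)], use disj desc in blast, use desc in blast)+
  have "card (A \<inter> {1..<z}) \<le> card {1..<z}" "card (A \<inter> {Suc z..<n}) \<le> card {Suc z..<n}"
    by (intro card_mono; simp)+
  then have bounds: "k < z" "z < s" "s \<le> n" using z by (auto simp: k_def s_def)
  have "{1..<n} - {z} \<subseteq> {1..<z} \<union> {Suc z..<n}" by auto
  then have split: "X = (X \<inter> {1..<z}) \<union> (X \<inter> {Suc z..<n})" if "X \<subseteq> A \<union> B" for X
    using that un by blast
  have AB: "A = {1..<Suc k} \<union> {Suc z..<s}" "B = {Suc k..<z} \<union> {s..<n}"
    using split[of A] split[of B] unfolding low high by simp_all
  moreover have "card A = k + (s - Suc z)"
    unfolding AB(1) using bounds by (subst card_Un_disjoint) auto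
  ultimately show thesis using that[OF bounds] by blast
qed

lemma two_letter_word:
  fixes A B :: "nat set"
  assumes sub: "A \<subseteq> {1..<n}" "B \<subseteq> {1..<n}" and disj: "A \<inter> B = {}"
    and desc: "\<forall>i\<in>A. i - 1 \<notin> B"
    and card: "n = 2 * t + 2" "t \<le> card A" "t \<le> card B"
  obtains (full) a where "a = t \<or> a = t + 1" "A = {1..<Suc a}" "B = {Suc a..<n}"
  | (gap) k z s where "k < z" "z < s" "s \<le> n" "k + (s - Suc z) = t"
      "A = {1..<Suc k} \<union> {Suc z..<s}" "B = {Suc k..<z} \<union> {s..<n}"
proof -
  have fin: "finite A" "finite B" using sub finite_subset by blast+
  have sum: "card (A \<union> B) = card A + card B" by (rule card_Un_disjoint[OF fin disj])
  show thesis
  proof (cases "A \<union> B = {1..<n}")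
    case True
    have "A = {1..<Suc (card A)}" "B = {Suc (card A)..<n}"
      unfolding Suc_eq_plus1_left by (rule no_descent_split[OF True disj], use desc in blast)+
    moreover have "card A = t \<or> card A = t + 1" using True sum card by auto
    ultimately show thesis using full[of "card A"] by blast
  next
    case False
    then obtain z where z: "z \<in> {1..<n}" "z \<notin> A" "z \<notin> B" using sub by blast
    have le: "A \<union> B \<subseteq> {1..<n} - {z}" using sub z by auto
    then have "card A + card B \<le> 2 * t" using card_mono[OF _ le] sum z(1) card(1) by simp
    then have "card A = t" using card by simp
    have "A \<union> B = {1..<n} - {z}"
      using \<open>card A + card B \<le> 2 * t\<close> sum z(1) card by (intro card_seteq[OF _ le]) auto
    then obtain k s where "k < z" "z < s" "s \<le> n" "card A = k + (s - Suc z)"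
      "A = {1..<Suc k} \<union> {Suc z..<s}" "B = {Suc k..<z} \<union> {s..<n}"
      using no_descent_split_gap[OF _ z(1) disj desc] by blast
    then show thesis using gap \<open>card A = t\<close> by metis
  qed
qed

context dirac_hg
begin

definition gap_word :: "(nat \<Rightarrow> 'a) \<Rightarrow> (nat \<Rightarrow> 'a set) \<Rightarrow> nat \<Rightarrow> nat \<Rightarrow> nat \<Rightarrow> bool" where
  "gap_word v e k z s \<longleftrightarrow> k < z \<and> z < s \<and> s \<le> n \<and> k + (s - Suc z) = t \<and>
     start_free v e = {1..<Suc k} \<union> {Suc z..<s} \<and> end_free v e = {Suc k..<z} \<union> {s..<n}"

lemma gap_word_card_start: "gap_word v e k z s \<Longrightarrow> card (start_free v e) = t"
  by (auto simp: gap_word_def card_Un_disjoint)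

lemma gap_word_card_end: "gap_word v e k z s \<Longrightarrow> n = 2 * t + 2 \<Longrightarrow> card (end_free v e) = t"
proof -
  assume gap: "gap_word v e k z s" and n: "n = 2 * t + 2"
  from gap have "end_free v e = {Suc k..<z} \<union> {s..<n}"
    and order: "k < z" "z < s" "s \<le> n" "k + (s - Suc z) = t"
    by (simp_all add: gap_word_def)
  moreover have "{Suc k..<z} \<inter> {s..<n} = {}" using order by auto
  ultimately have "card (end_free v e) = (z - Suc k) + (n - s)" by (simp add: card_Un_disjoint)
  then show ?thesis using order n by linarith
qed

lemma gap_word_start_full:
  assumes "gap_word v e k z s" "Suc k < z" "1 \<le> l" "l < n" "l \<notin> end_free v e" "l - 1 \<notin> end_free v e"
  shows "l \<in> start_free v e"
proof -
  have "l \<noteq> z" using assms by (auto simp: gap_word_def)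
  then show ?thesis using assms by (auto simp: gap_word_def)
qed

lemma gap_word_end_full:
  assumes "gap_word v e k z s" "Suc z < s" "1 \<le> l" "l < n" "l \<notin> start_free v e" "l + 1 \<notin> start_free v e"
  shows "l \<in> end_free v e"
proof -
  have "l \<noteq> z" using assms by (auto simp: gap_word_def)
  then show ?thesis using assms by (auto simp: gap_word_def)
qed

lemma gap_word_start_edges:
  assumes "ham_path v e" "gap_word v e k z s" "Suc k < z"
  shows "start_edges v e \<subseteq> start_free v e"
proof
  fix l assume l: "l \<in> start_edges v e"
  then have "1 \<le> l" "l < n" by (simp_all add: start_edges_def)
  then show "l \<in> start_free v e"
    using gap_word_start_full[OF assms(2,3)] start_edges_avoid_end_free[OF assms(1) l] by simp
qed

lemma gap_word_end_edges:
  assumes "ham_path v e" "gap_word v e k z s" "Suc z < s"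
  shows "end_edges v e \<subseteq> end_free v e"
proof
  fix l assume l: "l \<in> end_edges v e"
  then have "1 \<le> l" "l < n" by (simp_all add: end_edges_def)
  then show "l \<in> end_free v e"
    using gap_word_end_full[OF assms(2,3)] end_edges_avoid_start_free[OF assms(1) l] by simp
qed

lemma gap_word_low_start_edges_false:
  assumes h: "ham_path v e" and gap: "gap_word v e k z s" and "Suc k < z"
    and low: "\<And>i. i \<in> start_edges v e \<Longrightarrow> i \<le> z"
  shows False
proof (rule no_full_start[OF h gap_word_card_start[OF gap] gap_word_start_full[OF gap \<open>Suc k < z\<close>]])
  show "{1..i} \<subseteq> start_free v e" if "i \<in> start_edges v e" for i
    using low[OF that] gap_word_start_edges[OF h gap \<open>Suc k < z\<close>] that gap by (auto simp: gap_word_def)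
qed

lemma gap_word_high_end_edges_false:
  assumes h: "ham_path v e" and n: "n = 2 * t + 2" and gap: "gap_word v e k z s"
    and z: "z = Suc k" "Suc z < s"
  shows False
proof (rule no_full_end[OF h gap_word_card_end[OF gap n] gap_word_end_full[OF gap z(2)]])
  show "{i..<n} \<subseteq> end_free v e" if "i \<in> end_edges v e" for i
    using gap_word_end_edges[OF h gap z(2)] that gap z(1) by (auto simp: gap_word_def)
qed

end

text \<open>With $k \ge 3$, rotating at $z + 1$ shows that $v_{z+1}$ meets too few edges.\<close>

locale wide_gap = dirac_hg +
  fixes v :: "nat \<Rightarrow> 'a" and e :: "nat \<Rightarrow> 'a set" and k z s :: nat and f :: "'a set"
  assumes path: "ham_path v e" and gap: "gap_word v e k z s"
    and room: "Suc k < z" "Suc z < s" and three_le_k: "3 \<le> k"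
    and f_free: "f \<in> free_edges e" and rot: "rotation (Suc z) f v e"
begin

abbreviation v' :: "nat \<Rightarrow> 'a" where "v' \<equiv> rotate_verts (Suc z) v"
abbreviation e' :: "nat \<Rightarrow> 'a set" where "e' \<equiv> rotate_edges (Suc z) f e"

lemma rotated_path: "ham_path v' e'"
  by (rule ham_path_rotate[OF path rot])

lemma word: "start_free v e = {1..<Suc k} \<union> {Suc z..<s}" "end_free v e = {Suc k..<z} \<union> {s..<n}"
  and order: "k < z" "z < s" "s \<le> n" "k + (s - Suc z) = t"
  using gap by (auto simp: gap_word_def)

lemma start'_eq: "v' 1 = v (Suc z)"
  by (simp add: rotate_verts_start)

lemma free_edge_avoids: "g \<in> free_edges e \<Longrightarrow> v 1 \<in> g \<Longrightarrow> v (Suc z) \<notin> g"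
proof
  assume "g \<in> free_edges e" "v 1 \<in> g" "v (Suc z) \<in> g"
  then have "z \<in> start_free v e" using order by (auto simp: start_free_def)
  then show False using word order by auto
qed

lemma low_edge_avoids:
  assumes j: "1 \<le> j" "j \<le> k" and g: "g \<in> insert (e j) (free_edges e)" "v j \<in> g"
  shows "v (Suc z) \<notin> g"
proof
  assume z_g: "v (Suc z) \<in> g"
  have "j \<in> start_free v e" using word j by auto
  then obtain d where d: "d \<in> free_edges e" and rot_j: "rotation j d v e"
    using start_free_rotation by blast
  have "v (Suc z) \<notin> d" using free_edge_avoids[OF d] rot_j by (simp add: rotation_def)
  then have "g \<noteq> d" using z_g by blast
  then have "z - 1 \<notin> end_pivots v e"
    using freed_edge_not_end_pivot(2)[OF path rot_j g(1) _ g(2), of z] z_g j room order by simp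
  moreover have "z - 1 \<in> end_free v e" using word room by auto
  ultimately show False by (simp add: end_pivots_def)
qed

lemma mid_end_free: "k < j \<Longrightarrow> j < z - 1 \<Longrightarrow> Suc z - j \<in> end_free v' e'"
proof -
  assume j: "k < j" "j < z - 1"
  then have "j + 1 \<in> end_free v e" "j + 1 \<le> Suc z" using word by auto
  from end_free_rotate_le[OF path rot this] show ?thesis by (simp only: Suc_eq_plus1 diff_cancel2)
qed

lemma high_end_free: "s \<le> j \<Longrightarrow> j < n \<Longrightarrow> j \<in> end_free v' e'"
  using end_free_rotate_gt[OF path rot, of j] word room by simp

lemma free_edge_inside:
  assumes g: "g \<in> free_edges e" "v (Suc z) \<in> g"
  shows "g - {v (Suc z)} \<subseteq> v ` ({z - 1, z} \<union> {Suc (Suc z)..s})"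
proof
  fix x assume x: "x \<in> g - {v (Suc z)}"
  then obtain j where j: "1 \<le> j" "j \<le> n" "x = v j"
    using path_vertexE[OF path, of x] edge_subset[OF free_edge_mem[OF g(1)]] by blast
  have "g \<noteq> f" using free_edge_avoids[OF f_free] g(2) rot by (auto simp: rotation_def)
  then have g': "g \<in> free_edges e'" using free_edges_rotate[OF path rot] g(1) by simp
  have "\<not> j \<le> k" using low_edge_avoids[of j g] j g x by auto
  moreover have "\<not> (k < j \<and> j < z - 1)"
  proof
    assume kj: "k < j \<and> j < z - 1"
    have "v' (Suc (Suc z - j)) = v j" "1 \<le> Suc z - j" "Suc z - j < n"
      using kj j order by (auto simp: rotate_verts_le)
    then have "Suc z - j \<in> start_free v' e'"
      using g' g(2) x j(3) start'_eq by (auto simp: start_free_def)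
    then show False using start_free_not_end_free[OF rotated_path] mid_end_free kj by blast
  qed
  moreover have "\<not> s < j"
  proof
    assume sj: "s < j"
    then have j1: "s \<le> j - 1" "j - 1 < n" "Suc (j - 1) = j" using j by auto
    then have "j - 1 \<in> start_free v' e'"
      using start_free_rotateI[OF path rot _ \<open>g \<noteq> f\<close> g(2), of "j - 1"] g(1) x j room by simp
    then show False using start_free_not_end_free[OF rotated_path] high_end_free j1 by blast
  qed
  moreover have "j \<noteq> Suc z" using x j by auto
  ultimately have "j \<in> {z - 1, z} \<union> {Suc (Suc z)..s}" by auto
  then show "x \<in> v ` ({z - 1, z} \<union> {Suc (Suc z)..s})" using j by blast
qed

lemma path_edge_inside:
  assumes j: "1 \<le> j" "j < n" "v (Suc z) \<in> e j"
  shows "j \<in> {z - 1, z} \<union> {Suc z..<s}"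
proof -
  have "\<not> j \<le> k" using low_edge_avoids[of j "e j"] j path_edge_left[OF path] by auto
  moreover have "\<not> (k < j \<and> j < z - 1)"
  proof
    assume kj: "k < j \<and> j < z - 1"
    then have "e' (Suc z - j) = e j" "1 \<le> Suc z - j" "Suc z - j < n"
      using j order by (auto simp: rotate_edges_lt)
    then have "Suc z - j \<in> start_edges v' e'" using j(3) start'_eq by (simp add: start_edges_def)
    then show False using start_edges_not_end_free[OF rotated_path] mid_end_free kj by blast
  qed
  moreover have "\<not> s \<le> j"
  proof
    assume sj: "s \<le> j"
    then have "j \<in> start_edges v' e'"
      using j start'_eq room by (simp add: start_edges_def rotate_edges_gt)
    then show False using start_edges_not_end_free[OF rotated_path] high_end_free sj j by blast
  qed
  ultimately show ?thesis by auto
qed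

lemma contradiction: False
proof -
  define a where "a = s - Suc z + 2"
  have z: "z - 1 \<noteq> z" using room by simp
  have "card {z - 1, z} = 2" using z by simp
  have a_le: "a \<le> t - 1" using order(4) three_le_k by (simp add: a_def)
  let ?I = "{z - 1, z} \<union> {Suc (Suc z)..s}"
  have "card ?I \<le> a"
    using card_Un_le[of "{z - 1, z}" "{Suc (Suc z)..s}"] \<open>card {z - 1, z} = 2\<close> by (simp add: a_def)
  then have card_I: "card (v ` ?I) \<le> t - 1" using card_image_le[of ?I v] a_le by simp
  have "hdegree (free_edges e) (v (Suc z)) \<le> card (v ` ?I) choose (r - 1)"
    by (rule hdegree_le_binomial[OF free_edges_subset]) (use free_edge_inside in auto)
  also have "\<dots> \<le> t - 1 choose (r - 1)" by (rule binomial_right_mono[OF card_I])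
  finally have free: "hdegree (free_edges e) (v (Suc z)) \<le> t - 1 choose (r - 1)" .
  have "path_degree e (v (Suc z)) \<le> card ({z - 1, z} \<union> {Suc z..<s})"
    unfolding path_degree_def by (intro card_mono subsetI) (use path_edge_inside in auto)
  also have "\<dots> \<le> a"
    using card_Un_le[of "{z - 1, z}" "{Suc z..<s}"] \<open>card {z - 1, z} = 2\<close> by (simp add: a_def)
  finally have "path_degree e (v (Suc z)) \<le> t - 1" using a_le by simp
  then have "hdegree E (v (Suc z)) \<le> t choose (r - 1)"
    using hdegree_eq_free_path[OF path, of "v (Suc z)"] free binomial_pascal t_le_Suc_binomial
    by linarith
  moreover have "v (Suc z) \<in> V" using path_vertex_mem[OF path] order by simp
  ultimately show False using degree_gt by fastforce
qed

end

context dirac_hg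
begin

lemma no_wide_gap:
  assumes "ham_path v e" "gap_word v e k z s" "Suc k < z" "Suc z < s" "3 \<le> k"
  shows False
proof -
  have "Suc z \<in> start_free v e" using assms(2,4) by (auto simp: gap_word_def)
  then obtain f where "f \<in> free_edges e" "rotation (Suc z) f v e" using start_free_rotation by blast
  then interpret wide_gap V E n r t v e k z s f using assms by unfold_locales
  show False by (rule contradiction)
qed

lemma narrow_gap_start_edges_low:
  assumes h: "ham_path v e" and gap: "gap_word v e k z s" and room: "Suc k < z"
    and k: "k = 1 \<or> k = 2" and i: "i \<in> start_edges v e"
  shows "i \<le> z"
proof (rule ccontr)
  assume "\<not> i \<le> z"
  then have zi: "z < i" by simp
  have i': "1 \<le> i" "i < n" "v 1 \<in> e i" using i by (auto simp: start_edges_def)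
  have "i \<in> start_free v e" using gap_word_start_edges[OF h gap room] i by blast
  then obtain f where f: "f \<in> free_edges e" and rot: "rotation i f v e"
    using start_free_rotation by blast
  let ?v = "rotate_verts i v" and ?e = "rotate_edges i f e"
  note h' = ham_path_rotate[OF h rot]
  have "e i \<noteq> f" using path_edge_not_free[OF i'(1,2)] f by blast
  then have "e i \<in> free_edges ?e" using free_edges_rotate[OF h rot] by simp
  moreover have "?v 1 = v i" "?v (Suc (i - 1)) = v 1"
    using i'(1) by (simp_all add: rotate_verts_start rotate_verts_le)
  ultimately have free: "i - 1 \<in> start_free ?v ?e"
    using i' path_edge_left[OF h i'(1,2)] zi room by (auto simp: start_free_def)
  have "Suc k \<in> end_free v e" using gap room by (auto simp: gap_word_def)
  then have "i + 1 - Suc k \<in> end_free ?v ?e"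
    using end_free_rotate_le[OF h rot, of "Suc k"] zi room by simp
  moreover have "i + 1 - Suc k = (if k = 1 then i - 1 else i - 1 - 1)" using k by auto
  ultimately have "i - 1 \<in> end_free ?v ?e \<or> i - 1 - 1 \<in> end_pivots ?v ?e"
    by (auto simp: end_pivots_def split: if_splits)
  then show False
    using start_free_not_end_free[OF h' free] start_pivot_pred_not_end_pivot[OF h', of "i - 1"] free
    by (auto simp: start_pivots_def)
qed

lemma gap_word_tight:
  assumes h: "ham_path v e" and n: "n = 2 * t + 2" and gap: "gap_word v e k z s"
  shows "z = Suc k" "s = Suc z"
proof -
  note start_edges = gap_word_start_edges[OF h gap]
  show z: "z = Suc k"
  proof (rule ccontr)
    assume "z \<noteq> Suc k"
    then have room: "Suc k < z" using gap by (simp add: gap_word_def)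
    show False
    proof (cases "s = Suc z")
      case True
      then have "i \<le> z" if "i \<in> start_edges v e" for i
        using start_edges[OF room] that gap by (auto simp: gap_word_def)
      then show False by (rule gap_word_low_start_edges_false[OF h gap room])
    next
      case False
      then have s: "Suc z < s" using gap by (simp add: gap_word_def)
      have "1 \<in> start_free v e" using start_edges[OF room] one_in_start_edges[OF h] by blast
      then have "1 \<le> k" using gap room by (auto simp: gap_word_def)
      then consider "3 \<le> k" | "k = 1 \<or> k = 2" by linarith
      then show False
      proof cases
        case 1
        then show False by (rule no_wide_gap[OF h gap room s])
      next
        case 2
        show False
          using gap_word_low_start_edges_false[OF h gap room]
            narrow_gap_start_edges_low[OF h gap room 2]
          by blast
      qed
    qed
  qed
  show "s = Suc z"
  proof (rule ccontr)
    assume "s \<noteq> Suc z"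
    then have "Suc z < s" using gap by (simp add: gap_word_def)
    then show False by (rule gap_word_high_end_edges_false[OF h n gap z])
  qed
qed

lemma no_full_word:
  assumes h: "ham_path v e" and n: "n = 2 * t + 2" and a: "a = t \<or> a = t + 1"
    and word: "start_free v e = {1..<Suc a}" "end_free v e = {Suc a..<n}"
  shows False
  using a
proof
  assume a: "a = t"
  show False
  proof (rule no_full_start[OF h])
    show "{1..i} \<subseteq> start_free v e" if "i \<in> start_edges v e" for i
      using start_edges_avoid_end_free[OF h that] index_sets_subset(2)[of v e] that word by auto
  qed (use word a in auto)
next
  assume a: "a = t + 1"
  show False
  proof (rule no_full_end[OF h])
    show "{i..<n} \<subseteq> end_free v e" if "i \<in> end_edges v e" for i
      using end_edges_avoid_start_free[OF h that] index_sets_subset(4)[of v e] that word by auto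
  qed (use word a n in auto)
qed

lemma free_index_sets_eq:
  assumes h: "ham_path v e" and n: "n = 2 * t + 2"
    and card: "t \<le> card (start_free v e)" "t \<le> card (end_free v e)"
  shows "start_free v e = {1..<Suc t}" "end_free v e = {Suc (Suc t)..<n}"
proof -
  have desc: "\<forall>i\<in>start_free v e. i - 1 \<notin> end_free v e"
    using start_pivot_pred_not_end_pivot[OF h] by (auto simp: start_pivots_def end_pivots_def)
  have disj: "start_free v e \<inter> end_free v e = {}" using start_free_not_end_free[OF h] by blast
  have "start_free v e = {1..<Suc t} \<and> end_free v e = {Suc (Suc t)..<n}"
  proof (rule two_letter_word[OF index_sets_subset(1,3) disj desc n card])
    fix a
    assume full: "a = t \<or> a = t + 1" "start_free v e = {1..<Suc a}" "end_free v e = {Suc a..<n}"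
    then show ?thesis using no_full_word[OF h n] by blast
  next
    fix k z s
    assume gap: "k < z" "z < s" "s \<le> n" "k + (s - Suc z) = t"
      "start_free v e = {1..<Suc k} \<union> {Suc z..<s}" "end_free v e = {Suc k..<z} \<union> {s..<n}"
    then have "gap_word v e k z s" by (simp add: gap_word_def)
    note tight = gap_word_tight[OF h n this]
    have "k = t" using gap(4) tight(2) by simp
    then show ?thesis using gap(5,6) tight by auto
  qed
  then show "start_free v e = {1..<Suc t}" "end_free v e = {Suc (Suc t)..<n}" by simp_all
qed

end

section \<open>Complete blocks at the start of a path\<close>

context dirac_hg
begin

definition start_block :: "(nat \<Rightarrow> 'a) \<Rightarrow> (nat \<Rightarrow> 'a set) \<Rightarrow> bool" where
  "start_block v e \<longleftrightarrow> ham_path v e \<and> {Suc (Suc t)..<n} \<subseteq> end_pivots v e \<and>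
     (Suc t \<in> end_pivots v e \<or> Suc (Suc t) \<in> end_free v e)"

definition crossed :: "(nat \<Rightarrow> 'a) \<Rightarrow> (nat \<Rightarrow> 'a set) \<Rightarrow> bool" where
  "crossed v e \<longleftrightarrow> (\<exists>i\<in>start_edges v e. i \<le> t \<and> v (Suc (Suc t)) \<in> e i)"

lemma two_past_t_less_n: "Suc (Suc t) < n"
  using n_bounds three_le_t by linarith

lemma start_block_ham_path: "start_block v e \<Longrightarrow> ham_path v e"
  by (simp add: start_block_def)

lemma start_block_rotate:
  assumes block: "start_block v e" and rot: "rotation i f v e" and i: "i \<le> t"
  shows "start_block (rotate_verts i v) (rotate_edges i f e)"
proof -
  have h: "ham_path v e" using block by (rule start_block_ham_path)
  have pivots: "l \<in> end_pivots (rotate_verts i v) (rotate_edges i f e)"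
    if "l \<in> end_pivots v e" "t < l" for l
    using end_pivots_rotate_gt[OF h rot that(1)] i that(2) by simp
  have "Suc (Suc t) \<in> end_free v e \<Longrightarrow> Suc (Suc t) \<in> end_free (rotate_verts i v) (rotate_edges i f e)"
    using end_free_rotate_gt[OF h rot] i by simp
  then show ?thesis
    using block ham_path_rotate[OF h rot] pivots pivots[of "Suc t"]
    unfolding start_block_def by (auto intro!: pivots)
qed

lemma start_block_start_edges_le:
  assumes block: "start_block v e" and i: "i \<in> start_edges v e"
  shows "i \<le> Suc t"
proof (rule ccontr)
  assume big: "\<not> i \<le> Suc t"
  have "ham_path v e" "i \<in> start_pivots v e"
    using block i by (auto simp: start_block_def start_pivots_def)
  note avoid = start_pivot_pred_not_end_pivot[OF this] start_pivots_not_end_free[OF this]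
  show False
  proof (cases "i = Suc (Suc t)")
    case True
    then show False using avoid block by (auto simp: start_block_def)
  next
    case False
    then have "i - 1 \<in> {Suc (Suc t)..<n}" using big i by (auto simp: start_edges_def)
    then show False using avoid(1) block by (auto simp: start_block_def)
  qed
qed

lemma uncrossed_edge_index:
  assumes block: "start_block v e" and free: "start_free v e = {1..<Suc t}" and "\<not> crossed v e"
    and f: "f \<in> E" "f \<noteq> e (Suc t)" "v 1 \<in> f" and l: "1 \<le> l" "l < n" "v (Suc l) \<in> f"
  shows "l \<in> start_free v e"
  using f(1)
proof (cases rule: edge_cases[where e = e])
  case 1
  then show ?thesis using f(3) l by (auto simp: start_free_def)
next
  case (2 i)
  have h: "ham_path v e" using block by (rule start_block_ham_path)
  have edge: "i \<in> start_edges v e" using 2 f(3) by (simp add: start_edges_def)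
  then have i: "i \<le> t"
    using start_block_start_edges_le[OF block edge] f(2) 2(3) by (cases "i = Suc t") auto
  then have i_free: "i \<in> start_free v e" using free 2(1) by simp
  have "l \<notin> {Suc (Suc t)..<n}"
  proof
    assume far: "l \<in> {Suc (Suc t)..<n}"
    then have "i < l" using i by simp
    then have "l \<notin> end_pivots v e"
      using start_free_edge_not_end_pivot(1)[OF h i_free _ l(2)] l(3) 2(3) by simp
    then show False using block far by (auto simp: start_block_def)
  qed
  moreover have "l \<noteq> Suc t" using \<open>\<not> crossed v e\<close> edge i l(3) 2(3) by (auto simp: crossed_def)
  ultimately show ?thesis using free l(1,2) by auto
qed

lemma hdegree_remove_edge_ge: "hdegree E x \<le> Suc (hdegree (E - {f}) x)"
proof -
  have "{g \<in> E. x \<in> g} \<subseteq> insert f {g \<in> E - {f}. x \<in> g}" by auto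
  then have "hdegree E x \<le> card (insert f {g \<in> E - {f}. x \<in> g})"
    unfolding hdegree_def using finite_E by (intro card_mono) auto
  also have "\<dots> = Suc (hdegree (E - {f}) x)" using finite_E by (simp add: hdegree_def)
  finally show ?thesis .
qed

lemma uncrossed_last_edge:
  assumes block: "start_block v e" and free: "start_free v e = {1..<Suc t}"
    and uncrossed: "\<not> crossed v e"
  shows "Suc t \<in> start_edges v e"
proof (rule ccontr)
  assume "Suc t \<notin> start_edges v e"
  then have "v 1 \<notin> e (Suc t)" using two_past_t_less_n by (simp add: start_edges_def)
  then have "hdegree E (v 1) \<le> card (start_free v e) choose (r - 1)"
    using block uncrossed_edge_index[OF block free uncrossed]
    by (intro hdegree_start_le_binomial) (auto simp: start_block_def)
  then show False using degree_gt[OF start_mem[OF start_block_ham_path[OF block]]] free by simp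
qed

lemma uncrossed_complete:
  assumes block: "start_block v e" and free: "start_free v e = {1..<Suc t}"
    and uncrossed: "\<not> crossed v e"
    and B: "B \<subseteq> v ` {2..<Suc (Suc t)}" "card B = r - 1"
  shows "insert (v 1) B \<in> E"
proof -
  have h: "ham_path v e" using block by (rule start_block_ham_path)
  let ?F = "E - {e (Suc t)}" and ?A = "v ` {2..<Suc (Suc t)}"
  have A: "?A = (\<lambda>i. v (Suc i)) ` {1..<Suc t}"
    by (simp add: image_image[of v Suc, symmetric] One_nat_def numeral_2_eq_2)
  have "f - {v 1} \<subseteq> ?A" if "f \<in> ?F" "v 1 \<in> f" for f
    unfolding A free[symmetric]
    using that
    by (intro start_edge_minus_subset[OF h] uncrossed_edge_index[OF block free uncrossed]) auto
  moreover have "card ?A choose (r - 1) \<le> t choose (r - 1)"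
    using card_image_le[of "{2..<Suc (Suc t)}" v] by (intro binomial_right_mono) auto
  then have "card ?A choose (r - 1) \<le> hdegree ?F (v 1)"
    using degree_gt[OF start_mem[OF h]] hdegree_remove_edge_ge[of "v 1" "e (Suc t)"] by linarith
  ultimately have "insert (v 1) B \<in> ?F"
    using B by (intro star_complete[where A = ?A]) auto
  then show ?thesis by blast
qed

end

locale uncrossed_block = dirac_hg +
  fixes v :: "nat \<Rightarrow> 'a" and e :: "nat \<Rightarrow> 'a set"
  assumes block: "start_block v e" and free: "start_free v e = {1..<Suc t}"
    and uncrossed: "\<not> crossed v e"
    and rotated: "f \<in> free_edges e \<Longrightarrow> rotation i f v e \<Longrightarrow> i \<le> t \<Longrightarrow>
      t \<le> card (start_free (rotate_verts i v) (rotate_edges i f e)) \<Longrightarrow>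
      start_free (rotate_verts i v) (rotate_edges i f e) = {1..<Suc t} \<and>
      \<not> crossed (rotate_verts i v) (rotate_edges i f e)"
begin

lemma path: "ham_path v e"
  using block by (rule start_block_ham_path)

lemma last_edge: "e (Suc t) \<in> E" "v 1 \<in> e (Suc t)" "v (Suc t) \<in> e (Suc t)" "v (Suc (Suc t)) \<in> e (Suc t)"
  using uncrossed_last_edge[OF block free uncrossed] path_edge_mem[OF path, of "Suc t"]
    path_edge_left[OF path, of "Suc t"] path_edge_right[OF path, of "Suc t"] two_past_t_less_n
  by (auto simp: start_edges_def)

lemma missing_vertex: "\<exists>i\<in>{2..t}. v i \<notin> e (Suc t)"
proof (rule ccontr)
  assume all: "\<not> ?thesis"
  have "v ` {1..Suc t} \<subseteq> e (Suc t)"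
  proof
    fix x assume "x \<in> v ` {1..Suc t}"
    then obtain j where j: "1 \<le> j" "j \<le> Suc t" "x = v j" by auto
    then consider "j = 1" | "j = Suc t" | "j \<in> {2..t}" by fastforce
    then show "x \<in> e (Suc t)" using all last_edge j by cases auto
  qed
  moreover have "card (v ` {1..Suc t}) = Suc t"
    using card_vertex_image[OF path, of "{1..Suc t}"] two_past_t_less_n by auto
  ultimately have "Suc t \<le> r"
    using card_mono[OF finite_edge[OF last_edge(1)]] card_edge[OF last_edge(1)] by metis
  then show False using r_le_t by simp
qed

lemma rotated_start_edges:
  assumes i: "i \<in> {2..t}" "v i \<notin> e (Suc t)" and f: "f \<in> free_edges e" and rot: "rotation i f v e"
  shows "start_edges (rotate_verts i v) (rotate_edges i f e) = {1..t}"
proof -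
  let ?v = "rotate_verts i v" and ?e = "rotate_edges i f e"
  have i1: "1 \<le> i" "i \<le> t" using i(1) by auto
  have block': "start_block ?v ?e" by (rule start_block_rotate[OF block rot i1(2)])
  note rotated_path = start_block_ham_path[OF block']
  have last: "Suc t \<notin> start_edges ?v ?e"
    using i i1 by (simp add: start_edges_def rotate_verts_start rotate_edges_gt)
  have "card (start_free ?v ?e) < t"
  proof (rule ccontr)
    assume "\<not> card (start_free ?v ?e) < t"
    then have "start_free ?v ?e = {1..<Suc t}" "\<not> crossed ?v ?e" using rotated[OF f rot i1(2)] by auto
    then show False using uncrossed_last_edge[OF block'] last by blast
  qed
  then have "t \<le> card (start_edges ?v ?e)" by (rule few_free_t_le_start_edges[OF rotated_path])
  moreover have "start_edges ?v ?e \<subseteq> {1..t}"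
  proof
    fix l assume l: "l \<in> start_edges ?v ?e"
    then have "l \<le> Suc t" "l \<noteq> Suc t" using start_block_start_edges_le[OF block'] last by auto
    then show "l \<in> {1..t}" using l by (auto simp: start_edges_def)
  qed
  ultimately show ?thesis by (intro card_seteq) auto
qed

lemma missing_vertex_in_low_edges:
  assumes i: "i \<in> {2..t}" "v i \<notin> e (Suc t)" and l: "l \<in> {1..t}"
  shows "v i \<in> e l"
proof -
  have "i \<in> start_free v e" using free i(1) by auto
  then obtain f where f: "f \<in> free_edges e" "rotation i f v e" using start_free_rotation by blast
  note all = rotated_start_edges[OF i f]
  have start: "rotate_verts i v 1 = v i" using i(1) by (simp add: rotate_verts_start)
  consider "l = i" | "i < l" | "l < i" by linarith
  then show ?thesis
  proof cases
    case 1
    then show ?thesis using path_edge_left[OF path, of i] i(1) two_past_t_less_n by simp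
  next
    case 2
    have "l \<in> start_edges (rotate_verts i v) (rotate_edges i f e)" using all l by simp
    then show ?thesis using 2 start by (simp add: start_edges_def rotate_edges_gt)
  next
    case 3
    then have il: "i - l \<in> {1..t}" "i - l < i" "i - (i - l) = l" using i(1) l by auto
    then have "i - l \<in> start_edges (rotate_verts i v) (rotate_edges i f e)" using all by simp
    then show ?thesis using il(2,3) start by (simp add: start_edges_def rotate_edges_lt)
  qed
qed

lemma ex_block_edge_missing:
  assumes i: "i \<in> {2..t}"
  shows "\<exists>g\<in>E. v 1 \<in> g \<and> v (Suc i) \<in> g \<and> v i \<notin> g \<and> g \<subseteq> v ` {1..Suc t}"
proof -
  let ?W = "v ` {2..<Suc (Suc t)}"
  have "{2..<Suc (Suc t)} \<subseteq> {1..n}" using two_past_t_less_n by auto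
  then have "card ?W = t" using card_vertex_image[OF path] by simp
  moreover have "card ?W - card {v i, v (Suc i)} \<le> card (?W - {v i, v (Suc i)})"
    by (rule diff_card_le_card_Diff) simp
  moreover have "card {v i, v (Suc i)} \<le> 2" by (simp add: card_insert_if)
  ultimately have "r - 2 \<le> card (?W - {v i, v (Suc i)})" using r_le_t by linarith
  then obtain B where B: "B \<subseteq> ?W - {v i, v (Suc i)}" "card B = r - 2" "finite B"
    by (rule obtain_subset_with_card_n)
  let ?g = "insert (v 1) (insert (v (Suc i)) B)"
  have "v (Suc i) \<notin> B" using B(1) by blast
  then have "card (insert (v (Suc i)) B) = r - 1" using B(2,3) three_le_r by simp
  moreover have "v (Suc i) \<in> ?W" using i by (intro imageI) simp
  then have in_W: "insert (v (Suc i)) B \<subseteq> ?W" using B(1) by blast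
  ultimately have "?g \<in> E" by (intro uncrossed_complete[OF block free uncrossed])
  moreover have "v i \<noteq> v 1" "v i \<noteq> v (Suc i)"
    using path_vertex_inject[OF path, of i 1] path_vertex_inject[OF path, of i "Suc i"] i
      two_past_t_less_n
    by auto
  then have "v i \<notin> ?g" using B(1) by blast
  moreover have "?W \<subseteq> v ` {1..Suc t}" "v 1 \<in> v ` {1..Suc t}" by (auto intro!: image_mono)
  then have "?g \<subseteq> v ` {1..Suc t}" using in_W by blast
  ultimately show ?thesis by (intro bexI[where x = ?g]) simp_all
qed

text \<open>An edge through $v_1$ and $v_{i+1}$ inside the block that misses $v_i$ is free, and rotating with
it makes it an edge at the new start $v_i$.\<close>

lemma contradiction: False
proof -
  obtain i where i: "i \<in> {2..t}" "v i \<notin> e (Suc t)" using missing_vertex by blast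
  obtain g where g: "g \<in> E" "v 1 \<in> g" "v (Suc i) \<in> g" "v i \<notin> g" "g \<subseteq> v ` {1..Suc t}"
    using ex_block_edge_missing[OF i(1)] by blast
  have "v (Suc (Suc t)) \<notin> v ` {1..Suc t}"
    by (subst vertex_mem_image_iff[OF path]) (use two_past_t_less_n in auto)
  then have g_ne: "g \<noteq> e (Suc t)" using last_edge(4) g(5) by blast
  have "g \<in> free_edges e"
    using g(1)
  proof (cases rule: edge_cases[where e = e])
    case (2 l)
    then have "l \<in> start_edges v e" using g(2) by (simp add: start_edges_def)
    then have "l \<le> Suc t" by (rule start_block_start_edges_le[OF block])
    then have "l \<in> {1..t}" using 2(1,3) g_ne by (cases "l = Suc t") auto
    then show ?thesis using missing_vertex_in_low_edges[OF i] g(4) 2(3) by blast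
  qed
  moreover from this have rot: "rotation i g v e"
    using i(1) g(2,3) two_past_t_less_n by (auto simp: rotation_def)
  ultimately have "i \<in> start_edges (rotate_verts i v) (rotate_edges i g e)"
    using rotated_start_edges[OF i] i(1) by simp
  then show False
    using i(1) g(4) by (simp add: start_edges_def rotate_edges_pivot rotate_verts_start)
qed

end

context dirac_hg
begin

lemma end_pivots_from_not_crossed:
  assumes h: "ham_path v e" and far: "{Suc t..<n} \<subseteq> end_pivots v e"
    and many: "t \<le> card (start_free v e)"
  shows "start_free v e = {1..<Suc t} \<and> \<not> crossed v e"
proof
  have "start_free v e \<subseteq> {1..<Suc t}"
  proof
    fix i assume i: "i \<in> start_free v e"
    then have "i \<notin> {Suc t..<n}" using start_free_not_end_pivots[OF h] far by blast
    then show "i \<in> {1..<Suc t}" using i by (auto simp: start_free_def)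
  qed
  then show eq: "start_free v e = {1..<Suc t}" using many by (intro card_seteq) auto
  show "\<not> crossed v e"
  proof
    assume "crossed v e"
    then obtain i where i: "1 \<le> i" "i \<le> t" "v (Suc (Suc t)) \<in> e i"
      by (auto simp: crossed_def start_edges_def)
    then have "Suc t \<notin> end_pivots v e"
      using start_free_edge_not_end_pivot(1)[OF h, of i "Suc t"] eq two_past_t_less_n by auto
    then show False using subsetD[OF far, of "Suc t"] two_past_t_less_n by simp
  qed
qed

lemma no_end_pivots_from:
  assumes h: "ham_path v e" and far: "{Suc t..<n} \<subseteq> end_pivots v e"
    and many: "t \<le> card (start_free v e)"
  shows False
proof -
  note tight = end_pivots_from_not_crossed[OF assms]
  have "start_block v e" using h far two_past_t_less_n by (auto simp: start_block_def)
  moreover have "start_free (rotate_verts i v) (rotate_edges i f e) = {1..<Suc t} \<and>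
      \<not> crossed (rotate_verts i v) (rotate_edges i f e)"
    if rot: "rotation i f v e" "i \<le> t"
      and "t \<le> card (start_free (rotate_verts i v) (rotate_edges i f e))" for i f
  proof (rule end_pivots_from_not_crossed[OF ham_path_rotate[OF h rot(1)]])
    show "{Suc t..<n} \<subseteq> end_pivots (rotate_verts i v) (rotate_edges i f e)"
    proof
      fix l assume "l \<in> {Suc t..<n}"
      then show "l \<in> end_pivots (rotate_verts i v) (rotate_edges i f e)"
        using end_pivots_rotate_gt[OF h rot(1)] far rot(2) by auto
    qed
  qed (rule that(3))
  ultimately interpret uncrossed_block V E n r t v e using tight by unfold_locales auto
  show False by (rule contradiction)
qed

lemma odd_order_few_start_free:
  assumes h: "ham_path v e" and n: "n = 2 * t + 1"
  shows "card (start_free v e) < t"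
proof (rule ccontr)
  assume "\<not> card (start_free v e) < t"
  then have many: "t \<le> card (start_free v e)" by simp
  have disj: "start_free v e \<inter> end_pivots v e = {}" using start_free_not_end_pivots[OF h] by blast
  have sub: "start_free v e \<union> end_pivots v e \<subseteq> {1..<n}" using index_sets_subset by blast
  have sum: "card (start_free v e \<union> end_pivots v e) = card (start_free v e) + card (end_pivots v e)"
    by (rule card_Un_disjoint[OF finite_index_sets(1,6) disj])
  moreover have "card (start_free v e \<union> end_pivots v e) \<le> 2 * t" using card_mono[OF _ sub] n by simp
  ultimately have card: "card (start_free v e) = t"
    "card {1..<n} \<le> card (start_free v e \<union> end_pivots v e)"
    using many t_le_card_end_pivots[OF h] n by auto
  have un: "start_free v e \<union> end_pivots v e = {1..<n}" by (rule card_seteq[OF _ sub card(2)]) simp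
  have "end_pivots v e = {1 + card (start_free v e)..<n}"
  proof (rule no_descent_split(2)[OF un disj])
    show "i - 1 \<notin> end_pivots v e" if "i \<in> start_free v e" for i
      using start_pivot_pred_not_end_pivot[OF h] that by (simp add: start_pivots_def)
  qed
  then have "{Suc t..<n} \<subseteq> end_pivots v e" unfolding card(1) Suc_eq_plus1_left by simp
  then show False using no_end_pivots_from[OF h _ many] by blast
qed

lemma even_order_crossed:
  assumes h: "ham_path v e" and n: "n = 2 * t + 2"
    and many: "t \<le> card (start_free v e)" "t \<le> card (end_free v e)"
  shows "\<exists>w d. ham_path w d \<and> t \<le> card (start_free w d) \<and> t \<le> card (end_free w d) \<and> crossed w d \<and>
    (\<forall>j>t. w j = v j \<and> d j = e j)"
proof (rule ccontr)
  assume none: "\<not> ?thesis"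
  note free = free_index_sets_eq[OF h n many]
  have "start_block v e"
    using h free(2) two_past_t_less_n by (auto simp: start_block_def end_pivots_def)
  moreover have "start_free (rotate_verts i v) (rotate_edges i f e) = {1..<Suc t} \<and>
      \<not> crossed (rotate_verts i v) (rotate_edges i f e)"
    if rot: "rotation i f v e" and i: "i \<le> t"
      and start: "t \<le> card (start_free (rotate_verts i v) (rotate_edges i f e))" for i f
  proof -
    note h' = ham_path_rotate[OF h rot]
    have "t \<le> card (end_free (rotate_verts i v) (rotate_edges i f e))"
      using card_end_free_rotate[OF h rot] many(2) by simp
    moreover have "\<forall>j>t. rotate_verts i v j = v j \<and> rotate_edges i f e j = e j"
      using i by (simp add: rotate_verts_gt rotate_edges_gt)
    ultimately show ?thesis using none h' start free_index_sets_eq(1)[OF h' n start] by blast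
  qed
  moreover have "\<not> crossed v e" using none h many by blast
  ultimately interpret uncrossed_block V E n r t v e using free(1) by unfold_locales auto
  show False by (rule contradiction)
qed

lemma no_double_crossing:
  assumes h: "ham_path v e" and "i \<in> start_free v e" "m \<in> end_free v e"
    and l: "i < l" "l < m" "v (Suc l) \<in> e i" "v l \<in> e m"
  shows False
proof -
  obtain f where f: "f \<in> free_edges e" and rot: "rotation i f v e"
    using start_free_rotation[OF assms(2)] by blast
  have i: "1 \<le> i" "i < n" using rotation_index[OF rot] .
  have "l < n" using l(2) assms(3) by (auto simp: end_free_def)
  have "e i \<noteq> f" using path_edge_not_free[OF i] f by blast
  then have "l \<in> start_pivots (rotate_verts i v) (rotate_edges i f e)"
    using start_free_rotateI[OF h rot insertI1 _ path_edge_left[OF h i] l(1) \<open>l < n\<close> l(3)]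
    by (simp add: start_pivots_def)
  moreover have "m \<in> end_free (rotate_verts i v) (rotate_edges i f e)"
    using end_free_rotate_gt[OF h rot assms(3)] l by simp
  moreover have "rotate_verts i v l \<in> rotate_edges i f e m"
    using l by (simp add: rotate_verts_gt rotate_edges_gt)
  ultimately show False using end_free_edge_not_start_pivot[OF ham_path_rotate[OF h rot]] l i by auto
qed

lemma even_order_not_many_free_at_both_ends:
  assumes h: "ham_path v e" and n: "n = 2 * t + 2"
    and many: "t \<le> card (start_free v e)" "t \<le> card (end_free v e)"
  shows False
proof -
  obtain u c where u: "ham_path u c" "t \<le> card (start_free u c)" "t \<le> card (end_free u c)" "crossed u c"
    using even_order_crossed[OF h n many] by blast
  let ?u = "reverse_verts u" and ?c = "reverse_edges c"
  have "t \<le> card (start_free ?u ?c)" "t \<le> card (end_free ?u ?c)"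
    using u card_start_free_reverse card_end_free_reverse by simp_all
  then obtain w d where w: "ham_path w d" "t \<le> card (start_free w d)" "t \<le> card (end_free w d)"
    "crossed w d"
    and same: "\<And>j. t < j \<Longrightarrow> w j = ?u j \<and> d j = ?c j"
    using even_order_crossed[OF ham_path_reverse[OF u(1)] n] by blast
  note free = free_index_sets_eq[OF w(1) n w(2,3)]
  obtain i where i: "1 \<le> i" "i \<le> t" "u 1 \<in> c i" "u (Suc (Suc t)) \<in> c i"
    using u(4) by (auto simp: crossed_def start_edges_def)
  obtain j where j: "1 \<le> j" "j \<le> t" "w (Suc (Suc t)) \<in> d j"
    using w(4) by (auto simp: crossed_def start_edges_def)
  have m: "Suc t < n - i" "n - i < n" "t < n - i" "n - (n - i) = i" "n + 1 - Suc t = Suc (Suc t)"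
    using n i by linarith+
  have "w (Suc t) = u (Suc (Suc t))" using same[of "Suc t"] m(5) by (simp add: reverse_verts_def)
  moreover have "d (n - i) = c i" using same[OF m(3)] m(4) by (simp add: reverse_edges_def)
  ultimately have "w (Suc t) \<in> d (n - i)" using i(4) by simp
  moreover have "j \<in> start_free w d" using free(1) j by simp
  moreover have "n - i \<in> end_free w d" using free(2) m by simp
  moreover have "j < Suc t" using j by simp
  ultimately show False using no_double_crossing[OF w(1) _ _ _ m(1) j(3)] by blast
qed

end

section \<open>Even order: paths whose end has many free neighbours\<close>

locale even_order_hg = dirac_hg +
  assumes n_even: "n = 2 * t + 2"
begin

definition end_rich :: "(nat \<Rightarrow> 'a) \<Rightarrow> (nat \<Rightarrow> 'a set) \<Rightarrow> bool" where
  "end_rich v e \<longleftrightarrow> ham_path v e \<and> t \<le> card (end_free v e)"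

lemma end_rich_ham_path: "end_rich v e \<Longrightarrow> ham_path v e"
  by (simp add: end_rich_def)

lemma end_rich_few_start_free: "end_rich v e \<Longrightarrow> card (start_free v e) < t"
  using even_order_not_many_free_at_both_ends[OF _ n_even, of v e]
  unfolding end_rich_def not_le[symmetric] by blast

lemma end_rich_start_edges: "end_rich v e \<Longrightarrow> t \<le> card (start_edges v e)"
  using few_free_t_le_start_edges end_rich_few_start_free end_rich_ham_path by blast

lemma end_rich_rotate:
  "end_rich v e \<Longrightarrow> rotation i f v e \<Longrightarrow> end_rich (rotate_verts i v) (rotate_edges i f e)"
  unfolding end_rich_def using ham_path_rotate card_end_free_rotate le_trans by blast

lemma end_rich_rotate_edge:
  "end_rich v e \<Longrightarrow> i \<in> start_edges v e \<Longrightarrow> end_rich (rotate_verts i v) (rotate_edges i (e i) e)"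
  using end_rich_rotate start_edges_rotation end_rich_ham_path by blast

lemma free_edges_rotate_edge:
  "ham_path v e \<Longrightarrow> i \<in> start_edges v e \<Longrightarrow> free_edges (rotate_edges i (e i) e) = free_edges e"
  using free_edges_rotate_path_edge start_edges_rotation by blast

lemma rotate_verts_start_edge: "i \<in> start_edges v e \<Longrightarrow> rotate_verts i v 1 = v i"
  by (simp add: start_edges_def rotate_verts_start)

lemma start_edges_if_far_from_end_free:
  assumes rich: "end_rich v e" and ne: "end_free v e \<noteq> {Suc (Suc t)..<n}"
    and l: "1 \<le> l" "l < n" "l \<notin> end_free v e" "l - 1 \<notin> end_free v e"
  shows "l \<in> start_edges v e"
proof -
  have h: "ham_path v e" using rich by (rule end_rich_ham_path)
  let ?C = "{1..<n} - end_free v e"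
  define I where "I = {l \<in> ?C. l - 1 \<notin> end_free v e}"
  have I: "I \<subseteq> ?C" by (auto simp: I_def)
  have "card ?C = n - 1 - card (end_free v e)" by (simp add: card_Diff_subset index_sets_subset)
  then have card_C: "card ?C \<le> Suc t" using rich n_even unfolding end_rich_def by linarith
  have "card I \<le> t"
  proof (rule ccontr)
    assume "\<not> card I \<le> t"
    then have "card ?C \<le> card I" using card_C by simp
    then have all: "I = ?C" by (intro card_seteq I) auto
    have un: "?C \<union> end_free v e = {1..<n}" "?C \<inter> end_free v e = {}"
      using index_sets_subset(3)[of v e] by auto
    have "end_free v e = {1 + card ?C..<n}"
    proof (rule no_descent_split(2)[OF un])
      show "i - 1 \<notin> end_free v e" if "i \<in> ?C" for i
        using that unfolding all[symmetric] by (simp add: I_def)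
    qed
    moreover have "card ?C = Suc t" using card_C \<open>\<not> card I \<le> t\<close> unfolding all by simp
    ultimately show False using ne unfolding Suc_eq_plus1_left by simp
  qed
  then have "card I \<le> card (start_edges v e)" using end_rich_start_edges[OF rich] by simp
  moreover have "start_edges v e \<subseteq> I"
    using start_edges_avoid_end_free[OF h] index_sets_subset(2)[of v e] by (auto simp: I_def)
  ultimately have "start_edges v e = I" by (intro card_seteq) (auto simp: I_def)
  then show ?thesis using l by (simp add: I_def)
qed

lemma end_free_rotate_edge_gt:
  assumes "ham_path v e" "i \<in> start_edges v e" "i < l"
  shows "l \<in> end_free (rotate_verts i v) (rotate_edges i (e i) e) \<longleftrightarrow> l \<in> end_free v e"
  using free_edges_rotate_edge[OF assms(1,2)] rotation_end[OF start_edges_rotation[OF assms(1,2)]]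
    assms(3)
  by (simp add: end_free_def rotate_verts_gt)

lemma pivot_not_end_free_rotate_edge:
  assumes h: "ham_path v e" and i: "i \<in> start_edges v e"
  shows "i \<notin> end_free (rotate_verts i v) (rotate_edges i (e i) e)"
proof (rule start_edges_not_end_free[OF ham_path_rotate[OF h start_edges_rotation[OF h i]]])
  show "i \<in> start_edges (rotate_verts i v) (rotate_edges i (e i) e)"
    using i path_edge_left[OF h, of i] rotate_verts_start_edge[OF i]
    by (simp add: start_edges_def rotate_edges_pivot)
qed

lemma end_free_eq_if_rotated:
  assumes rich: "end_rich v e" and i: "i \<in> start_edges v e"
    and eq: "end_free (rotate_verts i v) (rotate_edges i (e i) e) = {Suc (Suc t)..<n}"
  shows "end_free v e = {Suc (Suc t)..<n}"
proof (rule card_seteq)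
  have h: "ham_path v e" using rich by (rule end_rich_ham_path)
  note rot = start_edges_rotation[OF h i]
  have "i < n" using i by (simp add: start_edges_def)
  then have it: "i \<le> Suc t" using pivot_not_end_free_rotate_edge[OF h i] unfolding eq by simp
  show "end_free v e \<subseteq> {Suc (Suc t)..<n}"
  proof
    fix l assume l: "l \<in> end_free v e"
    then have l1: "1 \<le> l" by (simp add: end_free_def)
    show "l \<in> {Suc (Suc t)..<n}"
    proof (cases "i < l")
      case True
      then show ?thesis using end_free_rotate_gt[OF h rot l] eq by simp
    next
      case False
      then have "i + 1 - l \<in> {Suc (Suc t)..<n}" using end_free_rotate_le[OF h rot l] eq by simp
      moreover have "i + 1 - l \<le> Suc t" using it l1 by linarith
      ultimately show ?thesis by simp
    qed
  qed
  show "card {Suc (Suc t)..<n} \<le> card (end_free v e)" using rich n_even unfolding end_rich_def by simp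
qed simp

lemma start_edges_linked:
  assumes rich: "end_rich v e" and ne: "end_free v e \<noteq> {Suc (Suc t)..<n}"
    and i: "i \<in> start_edges v e" and l: "l \<in> start_edges v e" and "i < l"
  shows "v i \<in> e l"
proof -
  have h: "ham_path v e" using rich by (rule end_rich_ham_path)
  let ?v = "rotate_verts i v" and ?e = "rotate_edges i (e i) e"
  note gt = end_free_rotate_edge_gt[OF h i]
  have "l \<notin> end_free ?v ?e" using gt[OF \<open>i < l\<close>] start_edges_avoid_end_free(1)[OF h l] by simp
  moreover have "l - 1 \<notin> end_free ?v ?e"
  proof (cases "l - 1 = i")
    case True
    then show ?thesis using pivot_not_end_free_rotate_edge[OF h i] by simp
  next
    case False
    then have "i < l - 1" using \<open>i < l\<close> by simp
    then show ?thesis using gt start_edges_avoid_end_free(2)[OF h l] by simp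
  qed
  moreover have "end_free ?v ?e \<noteq> {Suc (Suc t)..<n}" using end_free_eq_if_rotated[OF rich i] ne by blast
  moreover have "1 \<le> l" "l < n" using l by (simp_all add: start_edges_def)
  ultimately have "l \<in> start_edges ?v ?e"
    by (intro start_edges_if_far_from_end_free end_rich_rotate_edge[OF rich i])
  then show ?thesis
    using rotate_verts_start_edge[OF i] \<open>i < l\<close> by (simp add: start_edges_def rotate_edges_gt)
qed

lemma end_rich_end_free:
  assumes rich: "end_rich v e"
  shows "end_free v e = {Suc (Suc t)..<n}"
proof (rule ccontr)
  assume "end_free v e \<noteq> {Suc (Suc t)..<n}"
  then have "card (start_edges v e) < r"
    by (intro card_linked_start_edges[OF end_rich_ham_path[OF rich]] start_edges_linked[OF rich])
  then show False using end_rich_start_edges[OF rich] r_le_t by simp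
qed

lemma end_rich_start_pivots_le:
  assumes rich: "end_rich v e"
  shows "start_pivots v e \<subseteq> {1..Suc t}"
proof
  fix i assume i: "i \<in> start_pivots v e"
  then have "i \<notin> {Suc (Suc t)..<n}"
    using start_pivots_not_end_free[OF end_rich_ham_path[OF rich]] end_rich_end_free[OF rich] by blast
  then show "i \<in> {1..Suc t}" using i index_sets_subset(5)[of v e] by auto
qed

lemma end_rich_start_edges_le: "end_rich v e \<Longrightarrow> start_edges v e \<subseteq> {1..Suc t}"
  using end_rich_start_pivots_le[of v e] by (auto simp: start_pivots_def)

lemma end_rich_path_degree:
  assumes rich: "end_rich v e" and i: "i \<in> start_edges v e"
  shows "t \<le> card {l \<in> {1..Suc t}. v i \<in> e l}"
proof -
  have h: "ham_path v e" using rich by (rule end_rich_ham_path)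
  let ?v = "rotate_verts i v" and ?e = "rotate_edges i (e i) e"
  note rich' = end_rich_rotate_edge[OF rich i] and start = rotate_verts_start_edge[OF i]
  have low: "l \<le> Suc t" if l: "l < n" "v i \<in> e l" for l
  proof (cases "i < l")
    case True
    then have "l \<in> start_edges ?v ?e" using l start by (simp add: start_edges_def rotate_edges_gt)
    then show ?thesis using end_rich_start_edges_le[OF rich'] by auto
  next
    case False
    then show ?thesis using end_rich_start_edges_le[OF rich] i by auto
  qed
  have "t \<le> card (start_edges ?v ?e)" by (rule end_rich_start_edges[OF rich'])
  also have "\<dots> = path_degree e (v i)"
    unfolding card_start_edges start
    by (rule path_degree_cong[OF h end_rich_ham_path[OF rich'] free_edges_rotate_edge[OF h i]])
  also have "\<dots> \<le> card {l \<in> {1..Suc t}. v i \<in> e l}"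
    unfolding path_degree_def by (rule card_mono) (use low in auto)
  finally show ?thesis .
qed

lemma end_rich_incidence_count:
  assumes rich: "end_rich v e"
  shows "card (start_edges v e) * t \<le> (\<Sum>l\<in>{1..Suc t}. card {x \<in> v ` start_edges v e. x \<in> e l})"
proof -
  let ?S = "v ` start_edges v e"
  have "card (start_edges v e) * t = (\<Sum>x\<in>?S. t)"
    using card_vertex_image[OF end_rich_ham_path[OF rich] start_edges_subset_vertices] by simp
  also have "\<dots> \<le> (\<Sum>x\<in>?S. card {l \<in> {1..Suc t}. x \<in> e l})"
    using end_rich_path_degree[OF rich] by (intro sum_mono) auto
  also have "\<dots> = (\<Sum>l\<in>{1..Suc t}. card {x \<in> ?S. x \<in> e l})"
    by (rule sum_multicount_gen) auto
  finally show ?thesis .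
qed

lemma low_edge_mem: "end_rich v e \<Longrightarrow> l \<in> {1..Suc t} \<Longrightarrow> e l \<in> E"
  using path_edge_mem[OF end_rich_ham_path, of v e l] two_past_t_less_n by simp

lemma card_members_le: "f \<in> E \<Longrightarrow> card {x \<in> S. x \<in> f} \<le> r"
  using card_mono[OF finite_edge, of f "{x \<in> S. x \<in> f}"] card_edge[of f] by auto

lemma no_uniform_incidence_bound:
  assumes rich: "end_rich v e"
    and le: "\<And>l. l \<in> {1..Suc t} \<Longrightarrow> card {x \<in> v ` start_edges v e. x \<in> e l} \<le> t - 1"
  shows False
proof -
  have "t * t \<le> card (start_edges v e) * t" using end_rich_start_edges[OF rich] by simp
  also have "\<dots> \<le> (\<Sum>l\<in>{1..Suc t}. card {x \<in> v ` start_edges v e. x \<in> e l})"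
    by (rule end_rich_incidence_count[OF rich])
  also have "\<dots> \<le> Suc t * (t - 1)" using sum_bounded_above[of "{1..Suc t}", OF le] by simp
  also have "\<dots> < t * t" using three_le_t by (cases t) auto
  finally show False by simp
qed

lemma end_rich_rank:
  assumes rich: "end_rich v e"
  shows "r = t"
proof (rule ccontr)
  assume "r \<noteq> t"
  then have "r \<le> t - 1" using r_le_t by simp
  then show False
    by (intro no_uniform_incidence_bound[OF rich] order_trans[OF card_members_le[OF low_edge_mem[OF rich]]])
qed

lemma end_rich_card_start_edges:
  assumes rich: "end_rich v e"
  shows "card (start_edges v e) = t"
proof (rule ccontr)
  assume "card (start_edges v e) \<noteq> t"
  then have all: "start_edges v e = {1..Suc t}"
    using end_rich_start_edges[OF rich] by (intro card_seteq end_rich_start_edges_le[OF rich]) auto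
  have h: "ham_path v e" using rich by (rule end_rich_ham_path)
  let ?c = "\<lambda>l. card {x \<in> v ` {1..Suc t}. x \<in> e l}"
  have last: "e (Suc t) \<in> E" "v (Suc (Suc t)) \<in> e (Suc t)"
    using low_edge_mem[OF rich] path_edge_right[OF h, of "Suc t"] two_past_t_less_n by auto
  have "v (Suc (Suc t)) \<notin> v ` {1..Suc t}"
    by (subst vertex_mem_image_iff[OF h]) (use two_past_t_less_n in auto)
  then have "{x \<in> v ` {1..Suc t}. x \<in> e (Suc t)} \<subseteq> e (Suc t) - {v (Suc (Suc t))}" by blast
  then have "?c (Suc t) \<le> card (e (Suc t) - {v (Suc (Suc t))})"
    using finite_edge[OF last(1)] by (intro card_mono) auto
  also have "\<dots> = t - 1"
    using last card_edge[OF last(1)] end_rich_rank[OF rich] by (simp add: card_Diff_singleton)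
  finally have "?c (Suc t) \<le> t - 1" .
  moreover have "(\<Sum>l\<in>{1..t}. ?c l) \<le> t * t"
  proof -
    have "?c l \<le> t" if "l \<in> {1..t}" for l
      using card_members_le[OF low_edge_mem[OF rich, of l], of "v ` {1..Suc t}"] that
        end_rich_rank[OF rich] by simp
    then show ?thesis using sum_bounded_above[of "{1..t}" ?c t] by simp
  qed
  moreover have "(\<Sum>l\<in>{1..Suc t}. ?c l) = (\<Sum>l\<in>{1..t}. ?c l) + ?c (Suc t)" by simp
  moreover have "Suc t * t \<le> (\<Sum>l\<in>{1..Suc t}. ?c l)"
    using end_rich_incidence_count[OF rich] unfolding all by simp
  ultimately show False using three_le_t by simp
qed

lemma end_rich_hdegree_free:
  assumes rich: "end_rich v e"
  shows "hdegree (free_edges e) (v 1) = 1"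
proof -
  have h: "ham_path v e" using rich by (rule end_rich_ham_path)
  have "hdegree (free_edges e) (v 1) \<le> card (start_free v e) choose (r - 1)"
    by (rule hdegree_free_start_le[OF h])
  also have "\<dots> \<le> t - 1 choose (r - 1)"
    using end_rich_few_start_free[OF rich] by (intro binomial_right_mono) simp
  also have "\<dots> = 1" using end_rich_rank[OF rich] by simp
  finally have "hdegree (free_edges e) (v 1) \<le> 1" .
  moreover have "t < hdegree E (v 1)"
    using degree_gt[OF start_mem[OF h]] binomial_eq_t[OF end_rich_rank[OF rich]] by simp
  ultimately show ?thesis using hdegree_start[OF h] end_rich_card_start_edges[OF rich] by simp
qed

lemma end_rich_free_edge_exists: "end_rich v e \<Longrightarrow> \<exists>f\<in>free_edges e. v 1 \<in> f"
  using end_rich_hdegree_free[of v e] hdegree_pos_iff[OF free_edges_subset, of e "v 1"] by simp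

lemma end_rich_free_edge_unique:
  "end_rich v e \<Longrightarrow> f \<in> free_edges e \<Longrightarrow> v 1 \<in> f \<Longrightarrow> g \<in> free_edges e \<Longrightarrow> v 1 \<in> g \<Longrightarrow> f = g"
  using hdegree_le_1_unique[OF free_edges_subset] end_rich_hdegree_free[of v e] by (metis order_refl)

lemma start_free_subset_start_edges:
  assumes rich: "end_rich v e"
  shows "start_free v e \<subseteq> start_edges v e"
proof -
  have h: "ham_path v e" using rich by (rule end_rich_ham_path)
  have "start_pivots v e \<noteq> {1..Suc t}"
  proof
    assume all: "start_pivots v e = {1..Suc t}"
    have "{Suc t..<n} \<subseteq> end_pivots (reverse_verts v) (reverse_edges e)"
    proof
      fix l assume l: "l \<in> {Suc t..<n}"
      then have "Suc t \<le> l" "l < n" by auto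
      then have "1 \<le> n - l" "n - l \<le> Suc t" using n_even by linarith+
      then have "n - l \<in> start_pivots v e" unfolding all by simp
      then show "l \<in> end_pivots (reverse_verts v) (reverse_edges e)"
        using end_pivots_reverse[OF h, of l] l by simp
    qed
    then show False
      using no_end_pivots_from[OF ham_path_reverse[OF h]] card_start_free_reverse[OF h] rich
      by (simp add: end_rich_def)
  qed
  then have "card (start_pivots v e) < card {1..Suc t}"
    using end_rich_start_pivots_le[OF rich] by (intro psubset_card_mono) auto
  then have "card (start_pivots v e) \<le> card (start_edges v e)"
    using end_rich_card_start_edges[OF rich] by simp
  then have "start_edges v e = start_pivots v e" by (intro card_seteq) (auto simp: start_pivots_def)
  then show ?thesis unfolding start_pivots_def by blast
qed

lemma free_edge_pred_mem:
  assumes rich: "end_rich v e" and f: "f \<in> free_edges e" "v 1 \<in> f"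
    and i: "i \<in> start_edges v e" "v (Suc i) \<in> f"
  shows "v i \<in> f"
proof -
  have h: "ham_path v e" using rich by (rule end_rich_ham_path)
  have i': "1 \<le> i" "i < n" using i(1) by (simp_all add: start_edges_def)
  have rot: "rotation i f v e" using f i(2) i' by (simp add: rotation_def)
  note start = rotate_verts_start_edge[OF i(1)]
  obtain g where g: "g \<in> free_edges e" "v i \<in> g"
    using end_rich_free_edge_exists[OF end_rich_rotate_edge[OF rich i(1)]] start
      free_edges_rotate_edge[OF h i(1)] by auto
  have not_free: "e i \<notin> free_edges e" by (rule path_edge_not_free[OF i'])
  have "g = f"
  proof (rule ccontr)
    assume "g \<noteq> f"
    moreover have "e i \<noteq> f" using not_free f(1) by blast
    ultimately have "g \<in> free_edges (rotate_edges i f e)" "e i \<in> free_edges (rotate_edges i f e)"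
      using free_edges_rotate[OF h rot] g(1) by simp_all
    then have "g = e i"
      using end_rich_free_edge_unique[OF end_rich_rotate[OF rich rot]] start g(2)
        path_edge_left[OF h i'] by simp
    then show False using not_free g(1) by simp
  qed
  then show ?thesis using g(2) by simp
qed

lemma end_rich_first_block_free:
  assumes rich: "end_rich v e"
  shows "start_free v e = {1..<t}" "v ` {1..t} \<in> free_edges e"
proof -
  have h: "ham_path v e" using rich by (rule end_rich_ham_path)
  obtain f where f: "f \<in> free_edges e" "v 1 \<in> f" using end_rich_free_edge_exists[OF rich] by blast
  have "(\<exists>g\<in>free_edges e. v 1 \<in> g \<and> x \<in> g) \<longleftrightarrow> x \<in> f" for x
    using f end_rich_free_edge_unique[OF rich f] by blast
  then have free: "start_free v e = {i \<in> {1..<n}. v (Suc i) \<in> f}" by (simp add: start_free_def)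
  note indices = start_edge_indices[OF h free_edge_mem[OF f(1)] f(2), folded free]
  have "start_free v e = {1..<1 + card (start_free v e)}"
  proof (rule down_closed_interval)
    fix i assume i: "i \<in> start_free v e" "1 < i"
    then have "i \<in> start_edges v e" using start_free_subset_start_edges[OF rich] by blast
    moreover have "v (Suc i) \<in> f" "i < n" using i(1) by (simp_all add: free)
    ultimately have "v (Suc (i - 1)) \<in> f" using free_edge_pred_mem[OF rich f] i(2) by simp
    then show "i - 1 \<in> start_free v e" using i(2) \<open>i < n\<close> by (auto simp: free)
  qed (auto simp: start_free_def)
  then show eq: "start_free v e = {1..<t}" using indices(2) end_rich_rank[OF rich] three_le_t by simp
  have "f = insert (v 1) (f - {v 1})" using f(2) by auto
  also have "f - {v 1} = v ` Suc ` {1..<t}" unfolding indices(1)[symmetric] eq image_image ..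
  also have "insert (v 1) (v ` Suc ` {1..<t}) = v ` {1..t}"
  proof -
    have "insert 1 (Suc ` {1..<t}) = {1..t}"
      using three_le_t by (auto simp: One_nat_def image_Suc_atLeastLessThan)
    then show ?thesis by (metis image_insert)
  qed
  finally show "v ` {1..t} \<in> free_edges e" using f(1) by simp
qed

lemma Suc_t_in_start_edges:
  assumes rich: "end_rich v e"
  shows "Suc t \<in> start_edges v e"
proof (rule ccontr)
  assume "Suc t \<notin> start_edges v e"
  then have "start_edges v e \<subseteq> {1..t}"
    using end_rich_start_edges_le[OF rich] by (auto simp: atLeastAtMostSuc_conv)
  then have all: "start_edges v e = {1..t}"
    using end_rich_card_start_edges[OF rich] by (intro card_seteq) auto
  note block = end_rich_first_block_free(2)[OF rich]
  note block_edge = free_edge_mem[OF block]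
  show False
  proof (rule no_uniform_incidence_bound[OF rich])
    fix l assume l: "l \<in> {1..Suc t}"
    then have edge: "e l \<in> E" by (rule low_edge_mem[OF rich])
    have "e l \<noteq> v ` {1..t}" using path_edge_not_free[of l e] l two_past_t_less_n block by auto
    then have "\<not> v ` {1..t} \<subseteq> e l" using edge_eqI[OF block_edge edge] by blast
    then have "{x \<in> v ` {1..t}. x \<in> e l} \<subset> v ` {1..t}" by blast
    then have "card {x \<in> v ` {1..t}. x \<in> e l} < card (v ` {1..t})" by (intro psubset_card_mono) auto
    then show "card {x \<in> v ` start_edges v e. x \<in> e l} \<le> t - 1"
      using card_edge[OF block_edge] end_rich_rank[OF rich] unfolding all by simp
  qed
qed

text \<open>The first $t$ vertices form a free edge; so do those of the path rotated along $e_{t+1}$, and both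
free edges contain $v_2$.\<close>

lemma not_end_rich: "\<not> end_rich v e"
proof
  assume rich: "end_rich v e"
  have h: "ham_path v e" using rich by (rule end_rich_ham_path)
  note last = Suc_t_in_start_edges[OF rich]
  have "2 \<in> {1..<t}" using three_le_t by simp
  then have two: "2 \<in> start_edges v e"
    using start_free_subset_start_edges[OF rich] end_rich_first_block_free(1)[OF rich] by blast
  have "rotate_verts (Suc t) v ` {1..t} = v ` (\<lambda>j. Suc t + 1 - j) ` {1..t}"
    unfolding image_image by (rule image_cong) (auto simp: rotate_verts_le)
  also have "(\<lambda>j. Suc t + 1 - j) ` {1..t} = {2..Suc t}"
    by (rule bij_betw_imp_surj_on, rule bij_betw_byWitness[where f' = "\<lambda>j. Suc t + 1 - j"]) auto
  finally have "v ` {2..Suc t} \<in> free_edges e"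
    using end_rich_first_block_free(2)[OF end_rich_rotate_edge[OF rich last]]
      free_edges_rotate_edge[OF h last] by simp
  moreover have "v 2 \<in> v ` {1..t}" "v 2 \<in> v ` {2..Suc t}" using three_le_t by simp_all
  ultimately have "v ` {1..t} = v ` {2..Suc t}"
    using end_rich_free_edge_unique[OF end_rich_rotate_edge[OF rich two]]
      end_rich_first_block_free(2)[OF rich]
      free_edges_rotate_edge[OF h two] rotate_verts_start_edge[OF two] by simp
  moreover have "v 1 \<in> v ` {1..t}" using three_le_t by simp
  moreover have "v 1 \<notin> v ` {2..Suc t}"
    by (subst vertex_mem_image_iff[OF h]) (use two_past_t_less_n in auto)
  ultimately show False by simp
qed

end

section \<open>Excluding hamiltonian paths\<close>

lemma sum_two_values:
  fixes a b :: nat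
  assumes "finite V" "W \<subseteq> V"
  shows "(\<Sum>x\<in>V. if x \<in> W then a else b) = card W * a + (card V - card W) * b"
proof -
  have "(\<Sum>x\<in>V. if x \<in> W then a else b) = (\<Sum>x\<in>W. a) + (\<Sum>x\<in>V - W. b)"
    unfolding sum.subset_diff[OF assms(2,1)] by (simp add: add.commute)
  also have "\<dots> = card W * a + (card V - card W) * b"
    using assms by (simp add: card_Diff_subset finite_subset)
  finally show ?thesis .
qed

lemma orbit_arithmetic:
  fixes t m w n :: nat
  assumes "3 \<le> t" "4 \<le> m" and w: "2 * t \<le> w" "w \<le> n" and n: "n = 2 * t + 1 \<or> n = 2 * t + 2"
    and path: "w * t + (n - w) * 2 \<le> t * (n - 1)" and free: "t * m \<le> w + (n - w) * m"
  shows "t = 4" "m = 4" "w = 8" "n = 10"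
proof -
  obtain a b where a: "t = 3 + a" and b: "m = 4 + b" using assms(1,2) le_Suc_ex by blast
  consider "n = 2 * t + 1" "w = 2 * t" | "n = 2 * t + 1" "w = 2 * t + 1" | "n = 2 * t + 2" "w = 2 * t"
    | "n = 2 * t + 2" "w = 2 * t + 1" | "n = 2 * t + 2" "w = 2 * t + 2"
    using w n by linarith
  then have "t = 4 \<and> m = 4 \<and> w = 8 \<and> n = 10"
  proof cases
    case 3
    then have "n - w = 2" "n - 1 = 2 * t + 1" by simp_all
    then have "t * m \<le> 2 * t + 2 * m" "2 * t * t + 4 \<le> t * (2 * t + 1)" using free path 3(2) by simp_all
    then have "a * b + 2 * a + b \<le> 2" "1 \<le> a" unfolding a b by (simp_all add: algebra_simps)
    then have "a = 1" "b = 0" by (cases a; cases b; simp)+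
    then show ?thesis using 3 a b by simp
  qed (use path free in \<open>simp_all add: a b algebra_simps\<close>)
  then show "t = 4" "m = 4" "w = 8" "n = 10" by simp_all
qed

context dirac_hg
begin

lemma few_start_free:
  assumes h: "ham_path v e"
  shows "card (start_free v e) < t"
  using n_eq
proof
  assume "n = 2 * t + 1"
  then show ?thesis by (rule odd_order_few_start_free[OF h])
next
  assume "n = 2 * t + 2"
  then interpret even_order_hg V E n r t by unfold_locales
  have "\<not> t \<le> card (start_free v e)"
    using not_end_rich[of "reverse_verts v" "reverse_edges e"] ham_path_reverse[OF h]
      card_end_free_reverse[OF h]
    by (simp add: end_rich_def)
  then show ?thesis by simp
qed

definition start_orbit :: "(nat \<Rightarrow> 'a) \<Rightarrow> (nat \<Rightarrow> 'a set) \<Rightarrow> 'a set" where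
  "start_orbit v e = v ` start_edges v e"

definition end_orbit :: "(nat \<Rightarrow> 'a) \<Rightarrow> (nat \<Rightarrow> 'a set) \<Rightarrow> 'a set" where
  "end_orbit v e = start_orbit (reverse_verts v) (reverse_edges e)"

definition orbit :: "(nat \<Rightarrow> 'a) \<Rightarrow> (nat \<Rightarrow> 'a set) \<Rightarrow> 'a set" where
  "orbit v e = start_orbit v e \<union> end_orbit v e"

lemma card_start_orbit: "ham_path v e \<Longrightarrow> card (start_orbit v e) = card (start_edges v e)"
  unfolding start_orbit_def by (rule card_vertex_image[OF _ start_edges_subset_vertices])

lemma start_in_start_orbit: "ham_path v e \<Longrightarrow> v 1 \<in> start_orbit v e"
  unfolding start_orbit_def by (rule imageI[OF one_in_start_edges])

lemma start_orbit_subset: "ham_path v e \<Longrightarrow> start_orbit v e \<subseteq> V"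
  using path_vertex_mem by (auto simp: start_orbit_def start_edges_def)

lemma ends_in_orbit: "ham_path v e \<Longrightarrow> v 1 \<in> orbit v e" "ham_path v e \<Longrightarrow> v n \<in> orbit v e"
  using start_in_start_orbit[of v e] start_in_start_orbit[OF ham_path_reverse, of v e]
  by (simp_all add: orbit_def end_orbit_def)

lemma orbit_subset: "ham_path v e \<Longrightarrow> orbit v e \<subseteq> V"
  unfolding orbit_def end_orbit_def using start_orbit_subset ham_path_reverse by blast

lemma start_orbit_end_orbit_disjoint:
  assumes h: "ham_path v e"
  shows "start_orbit v e \<inter> end_orbit v e = {}"
proof (rule ccontr)
  assume "start_orbit v e \<inter> end_orbit v e \<noteq> {}"
  then obtain i j where i: "i \<in> start_edges v e"
    and j: "j \<in> start_edges (reverse_verts v) (reverse_edges e)"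
    and eq: "v i = reverse_verts v j"
    by (auto simp: start_orbit_def end_orbit_def)
  have i': "1 \<le> i" "i < n" and j': "1 \<le> j" "j < n" using i j by (simp_all add: start_edges_def)
  have "1 \<le> n + 1 - j" "n + 1 - j \<le> n" using j' by auto
  then have "i = n + 1 - j"
    using eq path_vertex_inject[OF h, of i "n + 1 - j"] i' by (simp add: reverse_verts_def)
  then have "i - 1 = n - j" by simp
  then have "i - 1 \<in> end_pivots v e" using start_edges_reverse[OF h j'] j by (simp add: end_pivots_def)
  then show False using start_pivot_pred_not_end_pivot[OF h, of i] i by (simp add: start_pivots_def)
qed

lemma card_orbit_ge:
  assumes h: "ham_path v e"
  shows "2 * t \<le> card (orbit v e)"
proof -
  have ge: "t \<le> card (start_orbit w d)" if "ham_path w d" for w d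
    unfolding card_start_orbit[OF that] using few_free_t_le_start_edges[OF that] few_start_free[OF that]
    by blast
  have "finite (start_orbit v e)" "finite (end_orbit v e)"
    by (simp_all add: start_orbit_def end_orbit_def)
  then have "card (orbit v e) = card (start_orbit v e) + card (end_orbit v e)"
    unfolding orbit_def using start_orbit_end_orbit_disjoint[OF h] by (rule card_Un_disjoint)
  then show ?thesis using ge[OF h] ge[OF ham_path_reverse[OF h]] by (simp add: end_orbit_def)
qed

lemma start_orbit_degrees:
  assumes h: "ham_path v e" and x: "x \<in> start_orbit v e"
  shows "t \<le> path_degree e x" "hdegree (free_edges e) x \<le> t - 1 choose (r - 1)"
proof -
  obtain i where i: "i \<in> start_edges v e" and x: "x = v i" using x by (auto simp: start_orbit_def)
  let ?v = "rotate_verts i v" and ?e = "rotate_edges i (e i) e"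
  note rot = start_edges_rotation[OF h i]
  have h': "ham_path ?v ?e" by (rule ham_path_rotate[OF h rot])
  have free: "free_edges ?e = free_edges e" by (rule free_edges_rotate_path_edge[OF h rot])
  have start: "?v 1 = x" using rotation_index[OF rot] by (simp add: rotate_verts_start x)
  have "t \<le> card (start_edges ?v ?e)" by (rule few_free_t_le_start_edges[OF h' few_start_free[OF h']])
  then show "t \<le> path_degree e x" unfolding card_start_edges start path_degree_cong[OF h h' free] .
  have "hdegree (free_edges ?e) (?v 1) \<le> card (start_free ?v ?e) choose (r - 1)"
    by (rule hdegree_free_start_le[OF h'])
  also have "\<dots> \<le> t - 1 choose (r - 1)" using few_start_free[OF h'] by (intro binomial_right_mono) simp
  finally show "hdegree (free_edges e) x \<le> t - 1 choose (r - 1)" unfolding free start .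
qed

lemma orbit_degrees:
  assumes h: "ham_path v e" and x: "x \<in> orbit v e"
  shows "t \<le> path_degree e x" "hdegree (free_edges e) x \<le> t - 1 choose (r - 1)"
proof -
  note h' = ham_path_reverse[OF h] and free = free_edges_reverse[OF h]
  from x consider "x \<in> start_orbit v e" | "x \<in> end_orbit v e" by (auto simp: orbit_def)
  then show "t \<le> path_degree e x" "hdegree (free_edges e) x \<le> t - 1 choose (r - 1)"
    using start_orbit_degrees[OF h, of x] start_orbit_degrees[OF h', of x]
      path_degree_cong[OF h h' free, of x]
    unfolding end_orbit_def free by (cases; simp)+
qed

lemma path_rank:
  assumes h: "ham_path v e"
  shows "r = t"
proof (rule ccontr)
  assume "r \<noteq> t"
  then have r: "r \<le> t - 1" using r_le_t by simp
  have "2 * t * t \<le> card (orbit v e) * t" using card_orbit_ge[OF h] by (rule mult_le_mono1)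
  also have "\<dots> \<le> (\<Sum>x\<in>orbit v e. path_degree e x)"
    using sum_bounded_below[of "orbit v e" t "path_degree e"] orbit_degrees(1)[OF h] by simp
  also have "\<dots> \<le> (\<Sum>x\<in>V. path_degree e x)" by (rule sum_mono2[OF finite_V orbit_subset[OF h]]) simp
  also have "\<dots> = r * (n - 1)" by (rule sum_path_degree[OF h])
  also have "\<dots> \<le> (t - 1) * (2 * t + 1)" using r n_bounds(2) by (rule mult_le_mono)
  also have "\<dots> < 2 * t * t" using three_le_t by (cases t) auto
  finally show False by simp
qed

lemma inner_vertex_edges:
  assumes "ham_path v e" "2 \<le> p" "p < n"
  shows "{p - 1, p} \<subseteq> {i \<in> {1..<n}. v p \<in> e i}"
proof -
  have "Suc (p - 1) = p" using assms(2) by simp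
  then show ?thesis
    using path_edge_left[OF assms(1), of p] path_edge_right[OF assms(1), of "p - 1"] assms(2,3) by auto
qed

lemma off_orbit_inner:
  assumes h: "ham_path v e" and x: "x \<in> V - orbit v e"
  obtains p where "2 \<le> p" "p < n" "x = v p"
proof -
  obtain p where p: "1 \<le> p" "p \<le> n" "x = v p" using path_vertexE[OF h, of x] x by blast
  then have "p \<noteq> 1" "p \<noteq> n" using x ends_in_orbit[OF h] by blast+
  then show thesis using that[of p] p by simp
qed

lemma two_le_path_degree:
  assumes h: "ham_path v e" and x: "x \<in> V - orbit v e"
  shows "2 \<le> path_degree e x"
proof -
  obtain p where p: "2 \<le> p" "p < n" "x = v p" by (rule off_orbit_inner[OF h x])
  have "card {p - 1, p} = 2" using p(1) by simp
  then show ?thesis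
    using card_mono[OF _ inner_vertex_edges[OF h p(1,2)]] unfolding path_degree_def p(3) by simp
qed

lemma path_degree_ge: "ham_path v e \<Longrightarrow> x \<in> V \<Longrightarrow> (if x \<in> orbit v e then t else 2) \<le> path_degree e x"
  using orbit_degrees(1) two_le_path_degree by simp

lemma hdegree_free_le:
  assumes "ham_path v e"
  shows "hdegree (free_edges e) x \<le> (if x \<in> orbit v e then 1 else card (free_edges e))"
  using orbit_degrees(2)[OF assms] hdegree_le_card[OF free_edges_subset] path_rank[OF assms] by simp

lemma orbit_parameters:
  assumes h: "ham_path v e"
  shows "t = 4" "card (free_edges e) = 4" "card (orbit v e) = 8" "n = 10"
proof -
  note rank = path_rank[OF h] and two_values =
    sum_two_values[OF finite_V orbit_subset[OF h], unfolded card_V]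
  have free_ge: "4 \<le> card (free_edges e)"
    using card_E_ge[OF rank] card_free_edges[OF h] four_le_n by linarith
  have orbit_le: "card (orbit v e) \<le> n" using card_mono[OF finite_V orbit_subset[OF h]] card_V by simp
  have path: "card (orbit v e) * t + (n - card (orbit v e)) * 2 \<le> t * (n - 1)"
    unfolding two_values[symmetric] using sum_mono[OF path_degree_ge[OF h], of V id]
      sum_path_degree[OF h] rank by simp
  have "t * card (free_edges e) = (\<Sum>x\<in>V. hdegree (free_edges e) x)"
    using sum_hdegree[OF free_edges_subset] rank by simp
  also have "\<dots> \<le> (\<Sum>x\<in>V. if x \<in> orbit v e then 1 else card (free_edges e))"
    by (rule sum_mono) (rule hdegree_free_le[OF h])
  finally have free: "t * card (free_edges e)
      \<le> card (orbit v e) + (n - card (orbit v e)) * card (free_edges e)"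
    unfolding two_values by simp
  show "t = 4" "card (free_edges e) = 4" "card (orbit v e) = 8" "n = 10"
    by (rule orbit_arithmetic[OF three_le_t free_ge card_orbit_ge[OF h] orbit_le n_eq path free])+
qed

lemma card_off_orbit: "ham_path v e \<Longrightarrow> card (V - orbit v e) = 2"
  using orbit_parameters(3,4)[of v e]
    card_Diff_subset[OF finite_subset[OF orbit_subset finite_V] orbit_subset, of v e] card_V
  by simp

lemma off_orbit_path_degree:
  assumes h: "ham_path v e" and x: "x \<in> V - orbit v e"
  shows "path_degree e x = 2"
proof -
  have "(\<Sum>x\<in>V. if x \<in> orbit v e then t else 2) = (\<Sum>x\<in>V. path_degree e x)"
    unfolding sum_two_values[OF finite_V orbit_subset[OF h]] sum_path_degree[OF h] path_rank[OF h]
      card_V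
      orbit_parameters(1,3)[OF h]
    using orbit_parameters(4)[OF h] by linarith
  then have "(if x \<in> orbit v e then t else 2) = path_degree e x"
    by (rule sum_mono_inv) (use path_degree_ge[OF h] x finite_V in auto)
  then show ?thesis using x by simp
qed

lemma hdegree_free_eq:
  assumes h: "ham_path v e" and x: "x \<in> V"
  shows "hdegree (free_edges e) x = (if x \<in> orbit v e then 1 else card (free_edges e))"
proof -
  have "(\<Sum>x\<in>V. hdegree (free_edges e) x) = (\<Sum>x\<in>V. if x \<in> orbit v e then 1 else card (free_edges e))"
    unfolding sum_two_values[OF finite_V orbit_subset[OF h]] sum_hdegree[OF free_edges_subset]
      path_rank[OF h] card_V
      orbit_parameters(1-3)[OF h]
    using orbit_parameters(4)[OF h] by linarith
  then show ?thesis by (rule sum_mono_inv) (use hdegree_free_le[OF h] x finite_V in auto)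
qed

lemma off_orbit_subset_free_edge:
  assumes h: "ham_path v e" and f: "f \<in> free_edges e"
  shows "V - orbit v e \<subseteq> f"
proof
  fix x assume "x \<in> V - orbit v e"
  then have "card {g \<in> free_edges e. x \<in> g} = card (free_edges e)"
    using hdegree_free_eq[OF h, of x] by (simp add: hdegree_def)
  then have "{g \<in> free_edges e. x \<in> g} = free_edges e" by (intro card_subset_eq finite_free_edges) auto
  then show "x \<in> f" using f by blast
qed

lemma off_orbit_rotate:
  assumes h: "ham_path v e" and f: "f \<in> free_edges e" and rot: "rotation i f v e"
  shows "V - orbit (rotate_verts i v) (rotate_edges i f e) = V - orbit v e"
proof (rule card_subset_eq)
  note h' = ham_path_rotate[OF h rot]
  show "V - orbit (rotate_verts i v) (rotate_edges i f e) \<subseteq> V - orbit v e"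
  proof
    fix x assume x: "x \<in> V - orbit (rotate_verts i v) (rotate_edges i f e)"
    have "g \<in> free_edges e - {f} \<Longrightarrow> x \<in> g" for g
      using off_orbit_subset_free_edge[OF h', of g] free_edges_rotate[OF h rot] x by blast
    then have "card (free_edges e - {f}) \<le> hdegree (free_edges e) x"
      unfolding hdegree_def using finite_free_edges by (intro card_mono) auto
    then have "3 \<le> hdegree (free_edges e) x" using orbit_parameters(2)[OF h] f by simp
    then show "x \<in> V - orbit v e" using hdegree_free_eq[OF h, of x] x by (auto split: if_splits)
  qed
  show "card (V - orbit (rotate_verts i v) (rotate_edges i f e)) = card (V - orbit v e)"
    using card_off_orbit[OF h'] card_off_orbit[OF h] by simp
qed (use finite_V in simp)

lemma off_orbit_subset_pred_edge:
  assumes h: "ham_path v e" and p: "2 \<le> p" "p < n" "v p \<in> V - orbit v e"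
  shows "V - orbit v e \<subseteq> e (p - 1)"
proof -
  have "hdegree (free_edges e) (v 1) = 1"
    using hdegree_free_eq[OF h start_mem[OF h]] ends_in_orbit(1)[OF h] by simp
  then obtain f where f: "f \<in> free_edges e" "v 1 \<in> f"
    using hdegree_pos_iff[OF free_edges_subset, of e "v 1"] by auto
  have "1 \<le> p - 1" "p - 1 < n" "Suc (p - 1) = p" using p by auto
  then have rot: "rotation (p - 1) f v e"
    using off_orbit_subset_free_edge[OF h f(1)] f p(3) by (auto simp: rotation_def)
  have "e (p - 1) \<noteq> f" using path_edge_not_free[OF rotation_index[OF rot]] f(1) by blast
  then have "e (p - 1) \<in> free_edges (rotate_edges (p - 1) f e)"
    using free_edges_rotate[OF h rot] by simp
  then show ?thesis
    using off_orbit_subset_free_edge[OF ham_path_rotate[OF h rot]] off_orbit_rotate[OF h f(1) rot]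
    by blast
qed

lemma off_orbit_edge_index:
  assumes h: "ham_path v e" and p: "2 \<le> p" "p < n" "v p \<in> V - orbit v e"
    and i: "1 \<le> i" "i < n" "v p \<in> e i"
  shows "i = p - 1 \<or> i = p"
proof -
  have "card {p - 1, p} = 2" using p(1) by simp
  then have "{p - 1, p} = {i \<in> {1..<n}. v p \<in> e i}"
    using off_orbit_path_degree[OF h p(3)] inner_vertex_edges[OF h p(1,2)] unfolding path_degree_def
    by (intro card_subset_eq) auto
  then show ?thesis using i by auto
qed

text \<open>The two vertices off the orbit are $v_p$ and $v_q$; each lies on the path edge before the other
one, but $v_p$ lies on $e_{p-1}$ and $e_p$ only.\<close>

lemma no_ham_path: "\<not> ham_path v e"
proof
  assume h: "ham_path v e"
  obtain x y where xy: "V - orbit v e = {x, y}" "x \<noteq> y" using card_off_orbit[OF h] by (meson card_2_iff)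
  obtain p where p: "2 \<le> p" "p < n" "x = v p" using off_orbit_inner[OF h, of x] xy by blast
  obtain q where q: "2 \<le> q" "q < n" "y = v q" using off_orbit_inner[OF h, of y] xy by blast
  have off: "v p \<in> V - orbit v e" "v q \<in> V - orbit v e" unfolding xy(1) p(3) q(3) by simp_all
  have "v p \<in> e (q - 1)" "v q \<in> e (p - 1)"
    using off_orbit_subset_pred_edge[OF h p(1,2) off(1)] off_orbit_subset_pred_edge[OF h q(1,2) off(2)]
      off by blast+
  then have "q - 1 = p - 1 \<or> q - 1 = p" "p - 1 = q - 1 \<or> p - 1 = q"
    using off_orbit_edge_index[OF h p(1,2) off(1), of "q - 1"]
      off_orbit_edge_index[OF h q(1,2) off(2), of "p - 1"] p q
    by auto
  moreover have "p \<noteq> q" using xy(2) p(3) q(3) by blast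
  ultimately show False using p(1) q(1) by linarith
qed

end

section \<open>Saturation\<close>

definition cyclic_interval :: "nat \<Rightarrow> nat \<Rightarrow> nat \<Rightarrow> nat set" where
  "cyclic_interval m r i = (\<lambda>j. (i + j) mod m) ` {..<r}"

lemma cyclic_interval_subset: "0 < m \<Longrightarrow> cyclic_interval m r i \<subseteq> {..<m}"
  by (auto simp: cyclic_interval_def)

lemma inj_on_mod_shift: "0 < m \<Longrightarrow> inj_on (\<lambda>j. (i + j) mod m) {..<m :: nat}"
  using bij_betw_mod_shift[of m i 0] by (simp add: bij_betw_def lessThan_atLeast0)

lemma mem_cyclic_interval_iff:
  "r \<le> m \<Longrightarrow> d < m \<Longrightarrow> (i + d) mod m \<in> cyclic_interval m r i \<longleftrightarrow> d < r"
  unfolding cyclic_interval_def using inj_on_image_mem_iff[OF inj_on_mod_shift, of m d "{..<r}" i]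
  by simp

lemma card_cyclic_interval:
  assumes "0 < m" "r \<le> m"
  shows "card (cyclic_interval m r i) = r"
proof -
  have "inj_on (\<lambda>j. (i + j) mod m) {..<r}"
    by (rule inj_on_subset[OF inj_on_mod_shift[OF assms(1)]]) (use assms(2) in auto)
  then show ?thesis by (simp add: cyclic_interval_def card_image)
qed

text \<open>The first element of a proper cyclic interval is the only one whose predecessor lies outside.\<close>

lemma inj_on_cyclic_interval:
  assumes "0 < r" "r < m"
  shows "inj_on (cyclic_interval m r) {..<m}"
proof (rule inj_onI)
  fix i j assume ij: "i \<in> {..<m}" "j \<in> {..<m}" and eq: "cyclic_interval m r i = cyclic_interval m r j"
  note mem = mem_cyclic_interval_iff[OF less_imp_le[OF assms(2)]]
  have "j \<in> cyclic_interval m r i" using mem[of 0 j] assms ij(2) unfolding eq by simp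
  then obtain d where d: "d < r" "j = (i + d) mod m" by (auto simp: cyclic_interval_def)
  have "d = 0"
  proof (rule ccontr)
    assume "d \<noteq> 0"
    then have "i + d + (m - 1) = i + (d - 1) + m" using assms by simp
    then have "(j + (m - 1)) mod m = (i + (d - 1)) mod m"
      unfolding d(2) by (metis mod_add_left_eq mod_add_self2)
    moreover have "(i + (d - 1)) mod m \<in> cyclic_interval m r j"
      using mem[of "d - 1" i] d(1) assms unfolding eq by simp
    moreover have "(j + (m - 1)) mod m \<notin> cyclic_interval m r j" using mem[of "m - 1" j] assms by simp
    ultimately show False by simp
  qed
  then show "i = j" using d(2) ij(1) by simp
qed

context uniform_hg
begin

lemma complete_hamiltonian:
  assumes all: "\<And>f. f \<subseteq> V \<Longrightarrow> card f = r \<Longrightarrow> f \<in> E"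
  shows "\<exists>vs es. hamiltonian_berge_cycle V E vs es"
proof -
  have n: "0 < n" "0 < r" "r \<le> n" using three_le_r r_less_n by auto
  obtain v where "bij_betw v {0..<n} V" using ex_bij_betw_nat_finite[OF finite_V] card_V by blast
  then have inj: "inj_on v {..<n}" and image: "v ` {..<n} = V"
    by (simp_all add: bij_betw_def lessThan_atLeast0)
  let ?I = "cyclic_interval n r"
  have inj_edges: "inj_on (\<lambda>i. v ` ?I i) {..<n}"
  proof (rule inj_onI)
    fix i j assume ij: "i \<in> {..<n}" "j \<in> {..<n}" "v ` ?I i = v ` ?I j"
    then have "?I i = ?I j"
      using inj_on_image_eq_iff[OF inj cyclic_interval_subset[OF n(1)] cyclic_interval_subset[OF n(1)]]
      by blast
    then show "i = j" using inj_onD[OF inj_on_cyclic_interval[OF n(2) r_less_n]] ij(1,2) by blast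
  qed
  have edge: "v ` ?I i \<in> E" for i
  proof (rule all)
    show "v ` ?I i \<subseteq> V" using cyclic_interval_subset[OF n(1)] image by blast
    show "card (v ` ?I i) = r"
      using card_image[OF inj_on_subset[OF inj cyclic_interval_subset[OF n(1)]]]
        card_cyclic_interval[OF n(1,3)] by simp
  qed
  let ?vs = "map v [0..<n]" and ?es = "map (\<lambda>i. v ` ?I i) [0..<n]"
  have "hamiltonian_berge_cycle V E ?vs ?es"
    unfolding hamiltonian_berge_cycle_def berge_cycle_def card_V
  proof (intro conjI allI impI)
    show "length ?vs = n" "length ?es = n" by simp_all
    show "distinct ?vs" "distinct ?es"
      using inj inj_edges by (simp_all add: distinct_map lessThan_atLeast0)
    show "set ?vs \<subseteq> V" "set ?es \<subseteq> E" using image edge by (auto simp: lessThan_atLeast0)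
    fix i assume i: "i < n"
    have "i \<in> ?I i" "(i + 1) mod n \<in> ?I i"
      using mem_cyclic_interval_iff[OF n(3), of 0 i] mem_cyclic_interval_iff[OF n(3), of 1 i] three_le_r
        r_less_n i by auto
    then show "{?vs ! i, ?vs ! ((i + 1) mod n)} \<subseteq> ?es ! i" using i by simp
  qed
  then show ?thesis by blast
qed

lemma ham_path_of_cycle:
  assumes cycle: "hamiltonian_berge_cycle V (insert f E) vs es" and k: "k < n" "es ! k = f"
  shows "ham_path (\<lambda>j. vs ! ((k + j) mod n)) (\<lambda>j. es ! ((k + j) mod n))"
proof -
  have lists: "length vs = n" "length es = n" "distinct vs" "distinct es" "set vs \<subseteq> V"
    "set es \<subseteq> insert f E"
    and incident: "\<And>i. i < n \<Longrightarrow> vs ! i \<in> es ! i \<and> vs ! ((i + 1) mod n) \<in> es ! i"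
    using cycle card_V unfolding hamiltonian_berge_cycle_def berge_cycle_def by auto
  have n: "0 < n" using four_le_n by simp
  let ?e = "\<lambda>j. es ! ((k + j) mod n)"
  have shift: "bij_betw (\<lambda>j. (k + j) mod n) {1..n} {..<n}"
    using bij_betw_mod_shift[OF n, of k 1] by (simp add: atLeastLessThanSuc_atLeastAtMost One_nat_def)
  have "set vs = V" using lists distinct_card[of vs] card_V finite_V by (intro card_subset_eq) auto
  then have "bij_betw (\<lambda>j. vs ! ((k + j) mod n)) {1..n} V"
    using bij_betw_trans[OF shift bij_betw_nth[OF lists(3)]] lists(1) by (simp add: comp_def)
  moreover have "bij_betw ?e {1..n} (set es)"
    using bij_betw_trans[OF shift bij_betw_nth[OF lists(4)]] lists(2) by (simp add: comp_def)
  then have inj: "inj_on ?e {1..n}" and image: "?e ` {1..n} = set es" by (simp_all add: bij_betw_def)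
  have "inj_on ?e {1..<n}" by (rule inj_on_subset[OF inj]) auto
  moreover have "?e ` {1..<n} \<subseteq> E"
  proof (rule image_subsetI)
    fix j assume j: "j \<in> {1..<n}"
    have "?e n = f" using k by simp
    then have "?e j \<noteq> f" using inj_onD[OF inj, of j n] j by auto
    moreover have "?e j \<in> set es" unfolding image[symmetric] using j by (intro imageI) simp
    ultimately show "?e j \<in> E" using lists(6) by blast
  qed
  moreover have "vs ! ((k + j) mod n) \<in> ?e j \<and> vs ! ((k + Suc j) mod n) \<in> ?e j" for j
  proof -
    have "((k + j) mod n + 1) mod n = (k + Suc j) mod n" by (simp add: mod_Suc_eq One_nat_def)
    then show ?thesis using incident[of "(k + j) mod n"] n by simp
  qed
  ultimately show ?thesis unfolding ham_path_def by blast
qed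

lemma saturated_ham_path:
  assumes none: "\<nexists>vs es. hamiltonian_berge_cycle V E vs es"
  obtains M v e where "E \<subseteq> M" "nonhamiltonian_hg V M n r" "uniform_hg.ham_path V M n v e"
proof -
  define A where "A = {f. f \<subseteq> V \<and> card f = r}"
  define F where "F = {M \<in> Pow A. \<nexists>vs es. hamiltonian_berge_cycle V M vs es}"
  have "finite F" using finite_V by (simp add: F_def A_def)
  moreover have "E \<subseteq> A" using edge_subset card_edge by (auto simp: A_def)
  then have "E \<in> F" using none by (simp add: F_def)
  ultimately obtain M where M: "M \<in> F" "E \<subseteq> M" and maximal: "\<forall>N\<in>F. M \<subseteq> N \<longrightarrow> M = N"
    using finite_has_maximal2[of F E] by auto
  have edges: "M \<subseteq> A" and no_cycle: "\<nexists>vs es. hamiltonian_berge_cycle V M vs es"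
    using M(1) by (simp_all add: F_def)
  interpret M: nonhamiltonian_hg V M n r
    by unfold_locales (use finite_V card_V three_le_r r_less_n edges no_cycle in \<open>auto simp: A_def\<close>)
  obtain f where f: "f \<in> A" "f \<notin> M" using M.complete_hamiltonian no_cycle by (auto simp: A_def)
  then have "insert f M \<notin> F" using maximal by blast
  then obtain vs es where cycle: "hamiltonian_berge_cycle V (insert f M) vs es"
    using f(1) edges by (auto simp: F_def)
  have "f \<in> set es"
  proof (rule ccontr)
    assume "f \<notin> set es"
    then have "hamiltonian_berge_cycle V M vs es"
      using cycle unfolding hamiltonian_berge_cycle_def berge_cycle_def by blast
    then show False using no_cycle by blast
  qed
  moreover have "length es = n"
    using cycle card_V by (simp add: hamiltonian_berge_cycle_def berge_cycle_def)
  ultimately obtain k where "k < n" "es ! k = f" by (metis in_set_conv_nth)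
  then show thesis using that[OF M(2) M.nonhamiltonian_hg_axioms M.ham_path_of_cycle[OF cycle]] by blast
qed

end

theorem theorem1p6:
  fixes n r t :: nat and V :: "'a set" and E :: "'a set set"
  assumes "3 \<le> r" and "r < n"
    and "t = (n - 1) div 2"
    and "finite V" and "card V = n"
    and "uniform_hypergraph r V E"
    and "(r \<le> t \<and> min_hdegree V E \<ge> (t choose (r - 1)) + 1) \<or>
         (real r \<ge> real n / 2 \<and> min_hdegree V E \<ge> r)"
  shows "\<exists>vs es. hamiltonian_berge_cycle V E vs es"
proof (rule ccontr)
  interpret uniform_hg V E n r
    using assms(1,2,4-6) by unfold_locales (auto simp: uniform_hypergraph_def hypergraph_def)
  assume "\<not> ?thesis"
  then obtain M v e where M: "E \<subseteq> M" "nonhamiltonian_hg V M n r" "uniform_hg.ham_path V M n v e"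
    by (rule saturated_ham_path)
  interpret M: nonhamiltonian_hg V M n r by (rule M(2))
  have degree: "min_hdegree V E \<le> hdegree M x" if "x \<in> V" for x
  proof -
    have "min_hdegree V E \<le> hdegree E x" unfolding min_hdegree_def using that finite_V by simp
    also have "\<dots> \<le> hdegree M x" unfolding hdegree_def using M(1) M.finite_E by (intro card_mono) auto
    finally show ?thesis .
  qed
  from assms(7) show False
  proof (elim disjE conjE)
    assume a: "r \<le> t" "min_hdegree V E \<ge> (t choose (r - 1)) + 1"
    have "n = 2 * t + 1 \<or> n = 2 * t + 2" using assms(2,3) by presburger
    then interpret dirac_hg V M n r t by unfold_locales (use a degree in fastforce)+
    show False using no_ham_path M(3) by blast
  next
    assume b: "real r \<ge> real n / 2" "min_hdegree V E \<ge> r"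
    interpret large_rank_hg V M n r by unfold_locales (use b degree in fastforce)+
    show False using no_ham_path M(3) by blast
  qed
qed

end
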